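(* Assume $\varphi'(0)>0$. If $\mathrm P(V(0)<\infty)=1$, then the following equations hold almost surely. (i) Assuming that $X(1)$ has a finite third moment (i.e., $|\varphi^{(3)}(0)|<\infty$), and defining for any $v\ge 0$ $$k_1(v):=\frac{v^2}{2\varphi'(0)}+\frac16\frac{\varphi^{(3)}(0)}{(\varphi'(0))^2}-\frac14\frac{(\varphi^{(2)}(0))^2}{(\varphi'(0))^3},$$ we have $$\sum_{n=1}^\infty\big(\mathrm E[V_n\mid V(0)]-\mathrm E V\big)=\xi\,k_1(V(0)).$$ (ii) Defining for any $v,\alpha\ge 0$ $$k_2(v,\alpha):=-\frac{e^{-\alpha v}+\alpha v}{\varphi(\alpha)}+\frac{\alpha}{(\varphi(\alpha))^2}\varphi'(0)+\frac{\alpha}{\varphi(\alpha)}\frac{\varphi^{(2)}(0)}{2\varphi'(0)},$$ we have, for any $\alpha\ge 0$, $$\sum_{n=1}^\infty\big(\mathrm E[e^{-\alpha V_n}\mid V(0)]-\mathrm E[e^{-\alpha V}]\big)=\xi\,k_2(V(0),\alpha).$$ (iii) Defining for any $v,\alpha\ge 0$ $$k_3(v,\alpha):=\frac{\varphi'(\alpha)}{\varphi(\alpha)^2}\Big(\alpha v-e^{-\alpha v}-\frac{v}{\varphi(\alpha)}(1-e^{-\alpha v})\Big)-\frac{\varphi'(0)}{(\varphi(\alpha))^2}\Big(1-2\frac{\varphi'(\alpha)}{\varphi(\alpha)}\Big)+\frac{1}{\varphi(\alpha)}\frac{\varphi^{(2)}(0)}{2\varphi'(0)}\Big(1-\frac{\alpha\varphi'(\alpha)}{\varphi(\alpha)}\Big),$$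 we have, for any $\alpha\ge 0$, $$\sum_{n=1}^\infty\big(\mathrm E[V_ne^{-\alpha V_n}\mid V(0)]-\mathrm E[Ve^{-\alpha V}]\big)=\xi\,k_3(V(0),\alpha).$$
   Context: $J(\cdot)$ is a non-decreasing Lévy process (subordinator) with Lévy measure $\nu$ on $(0,\infty)$, and $X(t)=J(t)-t$. Its Laplace exponent is $\varphi(\alpha):=\log\mathrm E\,e^{-\alpha X(1)}=\alpha-\int_{(0,\infty)}(1-e^{-\alpha x})\,\nu(\mathrm dx)$; derivatives at $0$ are limits as $\alpha\downarrow0$, so $\varphi'(0)=1-\int x\,\nu(\mathrm dx)=-\mathrm E X(1)$ and $\varphi^{(k)}(0)=(-1)^k\int x^k\,\nu(\mathrm dx)$ for $k\ge2$. The workload process is $V(t)=X(t)+\max\{V(0),L(t)\}$ with $L(t):=-\inf_{0\le s\le t}X(s)$, where $V(0)\ge0$ is the initial workload. It is sampled at the epochs $S_n$ ($n=1,2,\ldots$) of an independent Poisson process of rate $\xi>0$, and $V_n:=V(S_n)$. When $\varphi'(0)>0$ (stability), $V$ denotes a random variable with the stationary distribution of the workload, whose Laplace transform is $\mathrm E e^{-\alpha V}=\alpha\varphi'(0)/\varphi(\alpha)$.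
   Formalization: The printed k_3 is false (ν=0, v=0 gives 2/α³−2/α² instead of 0) and is replaced by −∂k_2/∂α; at α=0, where k_2 and k_3 read 0/0, k_2 is set to 0 and k_3 to its limit as α↓0, with (iii) at α=0 requiring φ''(0)<∞. *)

theory Defs
  imports "HOL-Probability.Probability"
begin

text \<open>
  A driftless subordinator with Levy measure \<open>\<nu>\<close> on \<open>(0,\<infinity>)\<close>. Together with monotonicity, right
  continuity gives cadlag paths. The Levy measure enters as usual through the Levy--Khintchine
  representation: \<open>log E exp (-\<alpha> J(1)) = -\<integral>(1 - exp (-\<alpha> x)) \<nu>(dx)\<close>; this also says that the drift is 0.
\<close>

definition subordinator :: "'a measure \<Rightarrow> real measure \<Rightarrow> (real \<Rightarrow> 'a \<Rightarrow> real) \<Rightarrow> bool" where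
  "subordinator M \<nu> J \<longleftrightarrow>
     (\<forall>t\<ge>0. J t \<in> borel_measurable M) \<and>
     (\<forall>\<omega>\<in>space M. J 0 \<omega> = 0 \<and> mono_on {0..} (\<lambda>t. J t \<omega>) \<and>
        (\<forall>t\<ge>0. continuous (at_right t) (\<lambda>s. J s \<omega>))) \<and>
     (\<forall>\<tau>::nat \<Rightarrow> real. 0 \<le> \<tau> 0 \<and> mono \<tau> \<longrightarrow>
        prob_space.indep_vars M (\<lambda>_. borel) (\<lambda>i \<omega>. J (\<tau> (Suc i)) \<omega> - J (\<tau> i) \<omega>) UNIV) \<and>
     (\<forall>t\<ge>0. \<forall>h\<ge>0. distr M borel (\<lambda>\<omega>. J (t + h) \<omega> - J t \<omega>) = distr M borel (J h)) \<and>
     sets \<nu> = sets borel \<and> emeasure \<nu> {..0} = 0 \<and>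
     (\<integral>\<^sup>+x. ennreal (min 1 x) \<partial>\<nu>) < \<infinity> \<and>
     (\<forall>\<alpha>\<ge>0. ln (\<integral>\<omega>. exp (- \<alpha> * J 1 \<omega>) \<partial>M) = - (\<integral>x. (1 - exp (- \<alpha> * x)) \<partial>\<nu>))"

definition net_input :: "(real \<Rightarrow> 'a \<Rightarrow> real) \<Rightarrow> real \<Rightarrow> 'a \<Rightarrow> real" where
  "net_input J t \<omega> = J t \<omega> - t"

definition laplace_exponent :: "'a measure \<Rightarrow> (real \<Rightarrow> 'a \<Rightarrow> real) \<Rightarrow> real \<Rightarrow> real" where
  "laplace_exponent M X \<alpha> = ln (\<integral>\<omega>. exp (- \<alpha> * X 1 \<omega>) \<partial>M)"

text \<open>
  The \<open>k\<close>-th derivative at \<open>0\<close>, as the limit of the \<open>k\<close>-th derivative for \<open>\<alpha> \<down> 0\<close>. It is taken in the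
  extended reals, because it is infinite when the \<open>k\<close>-th moment of \<open>\<nu>\<close> is.
\<close>

definition deriv0 :: "nat \<Rightarrow> (real \<Rightarrow> real) \<Rightarrow> ereal" where
  "deriv0 k \<phi> = Lim (at_right 0) (\<lambda>\<alpha>. ereal ((deriv ^^ k) \<phi> \<alpha>))"

definition running_loss :: "(real \<Rightarrow> 'a \<Rightarrow> real) \<Rightarrow> real \<Rightarrow> 'a \<Rightarrow> real" where
  "running_loss X t \<omega> = - (INF s\<in>{0..t}. X s \<omega>)"

definition workload :: "(real \<Rightarrow> 'a \<Rightarrow> real) \<Rightarrow> ('a \<Rightarrow> ereal) \<Rightarrow> real \<Rightarrow> 'a \<Rightarrow> ereal" where
  "workload X V0 t \<omega> = ereal (X t \<omega>) + max (V0 \<omega>) (ereal (running_loss X t \<omega>))"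

text \<open>Epochs \<open>S 1 < S 2 < \<dots>\<close> of a Poisson process of rate \<open>\<xi>\<close>; \<open>S 0 = 0\<close> is not an epoch.\<close>

definition poisson_epochs :: "'a measure \<Rightarrow> real \<Rightarrow> (nat \<Rightarrow> 'a \<Rightarrow> real) \<Rightarrow> bool" where
  "poisson_epochs M \<xi> S \<longleftrightarrow>
     (\<forall>\<omega>\<in>space M. S 0 \<omega> = 0 \<and> strict_mono (\<lambda>n. S n \<omega>)) \<and>
     prob_space.indep_vars M (\<lambda>_. borel) (\<lambda>n \<omega>. S (Suc n) \<omega> - S n \<omega>) UNIV \<and>
     (\<forall>n. distributed M lborel (\<lambda>\<omega>. S (Suc n) \<omega> - S n \<omega>) (exponential_density \<xi>))"

text \<open>
  Mutual independence of the sigma-algebras generated by the initial workload, the input process and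
  the sampling epochs.
\<close>

definition indep_inputs ::
  "'a measure \<Rightarrow> ('a \<Rightarrow> ereal) \<Rightarrow> (real \<Rightarrow> 'a \<Rightarrow> real) \<Rightarrow> (nat \<Rightarrow> 'a \<Rightarrow> real) \<Rightarrow> bool" where
  "indep_inputs M V0 J S \<longleftrightarrow>
     prob_space.indep_sets M
       (\<lambda>i. [sets (vimage_algebra (space M) V0 borel),
             sets (vimage_algebra (space M) (\<lambda>\<omega>. \<lambda>t\<in>{0..}. J t \<omega>) (Pi\<^sub>M {0..} (\<lambda>_. borel))),
             sets (vimage_algebra (space M) (\<lambda>\<omega> n. S n \<omega>) (Pi\<^sub>M UNIV (\<lambda>_. borel)))] ! i)
       {..<3}"

text \<open>
  \<open>\<pi>\<close> is a stationary law of the workload: an initial workload with law \<open>\<pi>\<close>, independent of the input,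
  gives a workload with law \<open>\<pi>\<close> at every time.
\<close>

definition stationary_workload ::
  "'a measure \<Rightarrow> (real \<Rightarrow> 'a \<Rightarrow> real) \<Rightarrow> real measure \<Rightarrow> bool" where
  "stationary_workload M X \<pi> \<longleftrightarrow>
     prob_space \<pi> \<and> sets \<pi> = sets borel \<and> (AE v in \<pi>. 0 \<le> v) \<and>
     (\<forall>t\<ge>0. distr (\<pi> \<Otimes>\<^sub>M M) borel
        (\<lambda>(v, \<omega>). real_of_ereal (workload X (\<lambda>_. ereal v) t \<omega>)) = \<pi>)"

text \<open>
  Conditional expectation given the random variable \<open>Y\<close>. For a nonnegative integrand (the only case
  used) it needs no integrability.
\<close>

definition cond_exp_given :: "'a measure \<Rightarrow> ('a \<Rightarrow> ereal) \<Rightarrow> ('a \<Rightarrow> real) \<Rightarrow> 'a \<Rightarrow> real" where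
  "cond_exp_given M Y f = real_cond_exp M (vimage_algebra (space M) Y borel) f"

definition k1 :: "(real \<Rightarrow> real) \<Rightarrow> real \<Rightarrow> real" where
  "k1 \<phi> v =
     (let d1 = real_of_ereal (deriv0 1 \<phi>); d2 = real_of_ereal (deriv0 2 \<phi>);
          d3 = real_of_ereal (deriv0 3 \<phi>)
      in v\<^sup>2 / (2 * d1) + 1/6 * (d3 / d1\<^sup>2) - 1/4 * (d2\<^sup>2 / d1 ^ 3))"

text \<open>
  In \<open>k2\<close> and \<open>k3\<close> the second derivative at \<open>0\<close> may be \<open>\<infinity>\<close>, so the values are extended reals.
  At \<open>\<alpha> = 0\<close> the formula for \<open>k2\<close> reads \<open>0/0\<close>; \<open>0\<close> is its limit for \<open>\<alpha> \<down> 0\<close> when that derivative is finite.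
\<close>

definition k2 :: "(real \<Rightarrow> real) \<Rightarrow> real \<Rightarrow> real \<Rightarrow> ereal" where
  "k2 \<phi> v \<alpha> =
     (if \<alpha> = 0 then 0 else
      (let d1 = real_of_ereal (deriv0 1 \<phi>); d2 = deriv0 2 \<phi>
       in ereal (- ((exp (- \<alpha> * v) + \<alpha> * v) / \<phi> \<alpha>) + \<alpha> / (\<phi> \<alpha>)\<^sup>2 * d1)
          + ereal (\<alpha> / \<phi> \<alpha>) * (d2 / ereal (2 * d1))))"

text \<open>
  \<open>k3_pos\<close> is minus the derivative of \<open>k2\<close> in \<open>\<alpha>\<close>, for \<open>\<alpha> > 0\<close>. This corrects the formula in the source,
  \<open>\<phi>'(\<alpha>)/\<phi>(\<alpha>)\<^sup>2 (\<alpha> v - exp (-\<alpha> v) - v/\<phi>(\<alpha>) (1 - exp (-\<alpha> v))) - \<phi>'(0)/\<phi>(\<alpha>)\<^sup>2 (1 - 2 \<phi>'(\<alpha>)/\<phi>(\<alpha>))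
  + 1/\<phi>(\<alpha>) \<phi>''(0)/(2 \<phi>'(0)) (1 - \<alpha> \<phi>'(\<alpha>)/\<phi>(\<alpha>))\<close>,
  which has misprints: for \<open>\<nu> = 0\<close> and \<open>v = 0\<close> it is \<open>2/\<alpha>\<^sup>3 - 2/\<alpha>\<^sup>2\<close>, while the workload is 0.
  At \<open>\<alpha> = 0\<close>, where the formula reads \<open>0/0\<close>, \<open>k3\<close> is its limit for \<open>\<alpha> \<down> 0\<close>.
\<close>

definition k3_pos :: "(real \<Rightarrow> real) \<Rightarrow> real \<Rightarrow> real \<Rightarrow> ereal" where
  "k3_pos \<phi> v \<alpha> =
     (let d1 = real_of_ereal (deriv0 1 \<phi>); d2 = deriv0 2 \<phi>
      in ereal (deriv \<phi> \<alpha> / (\<phi> \<alpha>)\<^sup>2 * (- \<alpha> * v - exp (- \<alpha> * v))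
                + v / \<phi> \<alpha> * (1 - exp (- \<alpha> * v))
                - d1 / (\<phi> \<alpha>)\<^sup>2 * (1 - 2 * \<alpha> * deriv \<phi> \<alpha> / \<phi> \<alpha>))
         - ereal (1 / \<phi> \<alpha> * (1 - \<alpha> * deriv \<phi> \<alpha> / \<phi> \<alpha>)) * (d2 / ereal (2 * d1)))"

definition k3 :: "(real \<Rightarrow> real) \<Rightarrow> real \<Rightarrow> real \<Rightarrow> ereal" where
  "k3 \<phi> v \<alpha> = (if \<alpha> = 0 then Lim (at_right 0) (k3_pos \<phi> v) else k3_pos \<phi> v \<alpha>)"

end

theory Submission
  imports Defs "HOL-Real_Asymp.Real_Asymp"
begin

text \<open>
  Put \<open>g x = exp (-\<alpha> x) + \<alpha> x\<close>. Its derivative vanishes at the reflecting barrier \<open>0\<close>, so for the workload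
  \<open>W\<close> started in \<open>v\<close> the derivative of \<open>E g (W t)\<close> is \<open>\<phi>(\<alpha>) E exp (-\<alpha> W t) - \<alpha> \<phi>'(0)\<close>: reflection only
  contributes \<open>O(h\<^sup>2)\<close> over a time step \<open>h\<close>, and the step is otherwise exact because increments are
  independent. Integrating by parts against the Erlang densities of the epochs gives the identity
  \<open>\<Sum>n=1..N. (\<phi>(\<alpha>) E exp (-\<alpha> V n) - \<alpha> \<phi>'(0)) = \<xi> (E g (V N) - g v)\<close>. Stationarity of \<open>\<pi>\<close> makes the left
  side \<open>\<phi>(\<alpha>)\<close> times the partial sum of (ii), so only \<open>E g (V N)\<close> has to be followed as \<open>N \<rightarrow> \<infinity>\<close>. Two workloads
  driven by the same input coincide once the loss process exceeds both initial values, which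
  yields convergence in law and, by comparison with the stationary workload, of the first two moments
  even if they are infinite in the limit. Part (iii) is the derivative of the identity in \<open>\<alpha>\<close>; its case
  \<open>\<alpha> = 0\<close> and part (i) follow by dividing the identity by \<open>\<alpha>\<^sup>2\<close> and letting \<open>\<alpha> \<down> 0\<close>.
\<close>

section \<open>Laplace transforms and the Levy measure\<close>

text \<open>The second moment of \<nu> may be infinite, and then E V_N tends to infinity. The
  partial sums are therefore not handled as convergent real series: for each N they are expressed
  exactly through the law of the last sampled workload, as a convergent real part plus a fixed
  multiple of its mean, and only this expression is followed to its limit in the extended reals. For
  the same reason the moments are reached as limits for \<alpha> tending to 0 of quotients that stay
  below their own limit, which needs no integrable majorant. Independence is given for increments
  along a sequence of times, while the workload depends on the whole path; the running loss is
  therefore approximated by maxima over finite grids. Independence also points forward in time, so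
  only forward steps of the expectation can be computed, and the two-sided derivative needs an
  additional Lipschitz estimate. The stationary law is given by invariance alone. Its Laplace
  transform is derived from the same one-step estimate, integrated over \<pi>, since the error
  constant does not depend on the initial workload.\<close>

lemma nn_integral_tendsto_at_right_0:
  fixes h :: "real \<Rightarrow> 'b \<Rightarrow> ennreal"
  assumes meas: "\<And>a. a > 0 \<Longrightarrow> h a \<in> borel_measurable N"
    and H: "H \<in> borel_measurable N"
    and le: "\<And>a. a > 0 \<Longrightarrow> AE x in N. h a x \<le> H x"
    and lim: "AE x in N. ((\<lambda>a. h a x) \<longlongrightarrow> H x) (at_right 0)"
  shows "((\<lambda>a. \<integral>\<^sup>+x. h a x \<partial>N) \<longlongrightarrow> (\<integral>\<^sup>+x. H x \<partial>N)) (at_right 0)"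
  unfolding tendsto_at_iff_sequentially comp_def
proof (intro allI impI)
  fix Z :: "nat \<Rightarrow> real" assume "\<forall>i. Z i \<in> {0<..} - {0}" and Z0: "Z \<longlonglongrightarrow> 0"
  then have Z: "Z i > 0" for i by auto
  have "AE x in N. H x = liminf (\<lambda>i. h (Z i) x)"
    using lim
  proof eventually_elim
    case (elim x)
    then have "(\<lambda>i. h (Z i) x) \<longlonglongrightarrow> H x"
      using Z Z0 unfolding tendsto_at_iff_sequentially comp_def by auto
    then show ?case by (metis lim_imp_Liminf sequentially_bot)
  qed
  then have "(\<integral>\<^sup>+x. H x \<partial>N) = (\<integral>\<^sup>+x. liminf (\<lambda>i. h (Z i) x) \<partial>N)"
    by (rule nn_integral_cong_AE)
  \<comment> \<open>Fatou bounds the limit from below, and domination by \<open>H\<close> itself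
    bounds it from above. Unlike dominated convergence this does not ask \<open>H\<close> to be
    integrable, so an infinite moment is a legitimate limit.\<close>
  also have "\<dots> \<le> liminf (\<lambda>i. \<integral>\<^sup>+x. h (Z i) x \<partial>N)"
    by (intro nn_integral_liminf meas Z)
  finally have 1: "(\<integral>\<^sup>+x. H x \<partial>N) \<le> liminf (\<lambda>i. \<integral>\<^sup>+x. h (Z i) x \<partial>N)" .
  have 2: "limsup (\<lambda>i. \<integral>\<^sup>+x. h (Z i) x \<partial>N) \<le> (\<integral>\<^sup>+x. H x \<partial>N)"
    by (intro Limsup_bounded always_eventually allI nn_integral_mono_AE le Z)
  have 3: "liminf (\<lambda>i. \<integral>\<^sup>+x. h (Z i) x \<partial>N) \<le> limsup (\<lambda>i. \<integral>\<^sup>+x. h (Z i) x \<partial>N)"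
    by (simp add: Liminf_le_Limsup)
  show "(\<lambda>i. \<integral>\<^sup>+x. h (Z i) x \<partial>N) \<longlonglongrightarrow> (\<integral>\<^sup>+x. H x \<partial>N)"
    using 1 2 3 by (auto simp: tendsto_iff_Liminf_eq_Limsup intro!: antisym)
qed

text \<open>Mean value bound with the weight taken at a lower end \<open>b\<close>. With
  \<open>b = a/2\<close> it dominates difference quotients at \<open>a\<close>; with
  \<open>b = 0\<close> and the roles of rate and state exchanged it is the Lipschitz bound for
  \<open>exp (- a * x)\<close> in \<open>x\<close>.\<close>

lemma abs_exp_minus_diff_le:
  fixes x y b :: real
  assumes "b \<le> x" "b \<le> y" "0 \<le> Y"
  shows "\<bar>exp (- x * Y) - exp (- y * Y)\<bar> \<le> \<bar>x - y\<bar> * (Y * exp (- b * Y))"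
proof -
  have *: "\<bar>exp (- x * Y) - exp (- y * Y)\<bar> \<le> \<bar>x - y\<bar> * (Y * exp (- b * Y))"
    if "b \<le> x" "x \<le> y" for x y :: real
  proof -
    have "exp (- x * Y) - exp (- y * Y) = exp (- x * Y) * (1 - exp (- ((y - x) * Y)))"
      by (simp add: algebra_simps flip: exp_add)
    also have "\<dots> \<le> exp (- b * Y) * ((y - x) * Y)"
      using that \<open>0 \<le> Y\<close> exp_ge_add_one_self[of "- ((y - x) * Y)"]
      by (intro mult_mono) (auto intro: mult_right_mono)
    finally show ?thesis
      using that \<open>0 \<le> Y\<close> by (simp add: mult_ac mult_left_mono)
  qed
  show ?thesis
    using *[of x y] *[of y x] assms by (cases "x \<le> y") (auto simp: abs_minus_commute)
qed

text \<open>The summand \<open>c\<close> serves the integrand \<open>1 - exp (- a * x)\<close>: for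
  an infinite Levy measure neither of its two terms is integrable alone. It cancels in every
  difference quotient.\<close>

lemma has_real_derivative_laplace:
  fixes c w Y :: "'b \<Rightarrow> real"
  assumes int0: "\<And>a. a > 0 \<Longrightarrow> integrable N (\<lambda>x. c x + w x * exp (- a * Y x))"
    and int1: "\<And>a. a > 0 \<Longrightarrow> integrable N (\<lambda>x. w x * (Y x * exp (- a * Y x)))"
    and Y: "AE x in N. 0 \<le> Y x" and a: "a > 0"
  shows "((\<lambda>a. \<integral>x. c x + w x * exp (- a * Y x) \<partial>N) has_real_derivative
           - (\<integral>x. w x * (Y x * exp (- a * Y x)) \<partial>N)) (at a)"
proof -
  let ?F = "\<lambda>a. \<integral>x. c x + w x * exp (- a * Y x) \<partial>N"
  \<comment> \<open>Restricting to rates above \<open>a/2\<close> leaves the limit at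
    \<open>a\<close> unchanged and gives all difference quotients one majorant, with rate
    \<open>a/2\<close>.\<close>
  have "((\<lambda>y. (?F y - ?F a) / (y - a)) \<longlongrightarrow> - (\<integral>x. w x * (Y x * exp (- a * Y x)) \<partial>N))
      (at a within {a/2<..})"
    unfolding tendsto_at_iff_sequentially comp_def
  proof (intro allI impI)
    fix Z :: "nat \<Rightarrow> real" assume "\<forall>i. Z i \<in> {a/2<..} - {a}" and Za: "Z \<longlonglongrightarrow> a"
    then have Z: "Z i > a/2" "Z i > 0" "Z i \<noteq> a" for i using a by (auto intro: less_trans[of 0 "a/2"])
    have eq: "(?F (Z i) - ?F a) / (Z i - a)
       = (\<integral>x. w x * ((exp (- Z i * Y x) - exp (- a * Y x)) / (Z i - a)) \<partial>N)" for i
      using Z[of i] a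
      by (subst Bochner_Integration.integral_diff[symmetric], intro int0, simp, intro int0, simp,
          subst integral_divide_zero[symmetric])
         (auto intro!: Bochner_Integration.integral_cong simp: algebra_simps diff_divide_distrib)
    have "(\<lambda>i. \<integral>x. w x * ((exp (- Z i * Y x) - exp (- a * Y x)) / (Z i - a)) \<partial>N)
       \<longlonglongrightarrow> (\<integral>x. - (w x * (Y x * exp (- a * Y x))) \<partial>N)"
    proof (rule integral_dominated_convergence[where w = "\<lambda>x. \<bar>w x * (Y x * exp (- (a/2) * Y x))\<bar>"])
      show "(\<lambda>x. - (w x * (Y x * exp (- a * Y x)))) \<in> borel_measurable N"
        using int1[OF a] by auto
      show "(\<lambda>x. w x * ((exp (- Z i * Y x) - exp (- a * Y x)) / (Z i - a))) \<in> borel_measurable N" for i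
      proof -
        \<comment> \<open>Neither \<open>w\<close> nor \<open>Y\<close> is assumed measurable, so
          measurability of the quotient is extracted from the two integrable integrands.\<close>
        have "(\<lambda>x. ((c x + w x * exp (- Z i * Y x)) - (c x + w x * exp (- a * Y x))) / (Z i - a))
           \<in> borel_measurable N"
          using int0[OF Z(2)[of i]] int0[OF a]
          by (intro borel_measurable_divide borel_measurable_diff borel_measurable_const) auto
        then show ?thesis by (simp add: right_diff_distrib)
      qed
      show "integrable N (\<lambda>x. \<bar>w x * (Y x * exp (- (a/2) * Y x))\<bar>)"
        using int1[of "a/2"] a by auto
      show "AE x in N. norm (w x * ((exp (- Z i * Y x) - exp (- a * Y x)) / (Z i - a)))
         \<le> \<bar>w x * (Y x * exp (- (a/2) * Y x))\<bar>" for i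
        using Y
      proof eventually_elim
        case (elim x)
        have "\<bar>exp (- Z i * Y x) - exp (- a * Y x)\<bar> / \<bar>Z i - a\<bar> \<le> Y x * exp (- (a/2) * Y x)"
          using abs_exp_minus_diff_le[of "a/2" "Z i" a "Y x"] Z[of i] a elim
          by (simp add: field_simps)
        then have "\<bar>w x\<bar> * (\<bar>exp (- Z i * Y x) - exp (- a * Y x)\<bar> / \<bar>Z i - a\<bar>)
           \<le> \<bar>w x\<bar> * (Y x * exp (- (a/2) * Y x))" by (rule mult_left_mono) simp
        then show ?case using elim by (simp add: abs_mult)
      qed
      show "AE x in N. (\<lambda>i. w x * ((exp (- Z i * Y x) - exp (- a * Y x)) / (Z i - a)))
         \<longlonglongrightarrow> - (w x * (Y x * exp (- a * Y x)))"
      proof (rule AE_I2)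
        fix x
        have "((\<lambda>a. exp (- a * Y x)) has_real_derivative - (Y x * exp (- a * Y x))) (at a)"
          by (auto intro!: derivative_eq_intros)
        then have "((\<lambda>y. (exp (- y * Y x) - exp (- a * Y x)) / (y - a)) \<longlongrightarrow> - (Y x * exp (- a * Y x))) (at a)"
          by (simp add: has_field_derivative_iff)
        then have "(\<lambda>i. (exp (- Z i * Y x) - exp (- a * Y x)) / (Z i - a)) \<longlonglongrightarrow> - (Y x * exp (- a * Y x))"
          using Z Za unfolding tendsto_at_iff_sequentially comp_def by auto
        from tendsto_mult_left[OF this, of "w x"]
        show "(\<lambda>i. w x * ((exp (- Z i * Y x) - exp (- a * Y x)) / (Z i - a)))
         \<longlonglongrightarrow> - (w x * (Y x * exp (- a * Y x)))" by simp
      qed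
    qed
    then show "(\<lambda>i. (?F (Z i) - ?F a) / (Z i - a)) \<longlonglongrightarrow> - (\<integral>x. w x * (Y x * exp (- a * Y x)) \<partial>N)"
      unfolding eq by simp
  qed
  moreover have "at a within {a/2<..} = at a"
    using a by (intro at_within_open) auto
  ultimately show ?thesis by (simp add: has_field_derivative_iff)
qed

lemma exp_minus_taylor1: "0 \<le> y \<Longrightarrow> 1 - exp (- y) \<le> (y::real)"
  using exp_ge_add_one_self[of "- y"] by simp

lemma exp_minus_ge1: "0 \<le> exp (- y) - 1 + (y::real)"
  using exp_ge_add_one_self[of "- y"] by simp

lemma exp_minus_taylor2:
  assumes "0 \<le> (y::real)" shows "exp (- y) - 1 + y \<le> y\<^sup>2 / 2"
proof -
  have "0\<^sup>2 / 2 - (exp (- 0) - 1 + 0) \<le> y\<^sup>2 / 2 - (exp (- y) - 1 + y)"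
  proof (rule DERIV_nonneg_imp_nondecreasing[OF assms])
    fix x :: real assume "0 \<le> x" "x \<le> y"
    then show "\<exists>d. ((\<lambda>y. y\<^sup>2 / 2 - (exp (- y) - 1 + y)) has_real_derivative d) (at x) \<and> 0 \<le> d"
      using exp_minus_ge1[of x]
      by (intro exI[of _ "exp (- x) - 1 + x"]) (auto intro!: derivative_eq_intros)
  qed
  then show ?thesis by simp
qed

lemma exp_minus_taylor3:
  assumes "0 \<le> (y::real)"
  shows "0 \<le> 1 - y + y\<^sup>2 / 2 - exp (- y)" "1 - y + y\<^sup>2 / 2 - exp (- y) \<le> y ^ 3 / 6"
proof -
  show "0 \<le> 1 - y + y\<^sup>2 / 2 - exp (- y)" using exp_minus_taylor2[OF assms] by simp
  have "0 ^ 3 / 6 - (1 - 0 + 0\<^sup>2 / 2 - exp (- 0)) \<le> y ^ 3 / 6 - (1 - y + y\<^sup>2 / 2 - exp (- y))"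
  proof (rule DERIV_nonneg_imp_nondecreasing[OF assms])
    fix x :: real assume "0 \<le> x" "x \<le> y"
    then show "\<exists>d. ((\<lambda>y. y ^ 3 / 6 - (1 - y + y\<^sup>2 / 2 - exp (- y))) has_real_derivative d) (at x) \<and> 0 \<le> d"
      using exp_minus_taylor2[of x]
      by (intro exI[of _ "x\<^sup>2 / 2 - (exp (- x) - 1 + x)"])
         (auto intro!: derivative_eq_intros)
  qed
  then show "1 - y + y\<^sup>2 / 2 - exp (- y) \<le> y ^ 3 / 6" by simp
qed

lemma exp_minus_limits:
  fixes x :: real
  assumes "0 \<le> x"
  shows "((\<lambda>a. (1 - exp (- a * x)) / a) \<longlongrightarrow> x) (at_right 0)"
    and "((\<lambda>a. (exp (- a * x) - 1 + a * x) / a\<^sup>2) \<longlongrightarrow> x\<^sup>2 / 2) (at_right 0)"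
    and "((\<lambda>a. (1 - a * x + (a * x)\<^sup>2 / 2 - exp (- a * x)) / a ^ 3) \<longlongrightarrow> x ^ 3 / 6) (at_right 0)"
proof -
  have 1: "((\<lambda>a. (1 - exp (- a * x)) / a) \<longlongrightarrow> x) (at_right 0)"
    and 2: "((\<lambda>a. (exp (- a * x) - 1 + a * x) / a\<^sup>2) \<longlongrightarrow> x\<^sup>2 / 2) (at_right 0)"
    and 3: "((\<lambda>a. (1 - a * x + (a * x)\<^sup>2 / 2 - exp (- a * x)) / a ^ 3) \<longlongrightarrow> x ^ 3 / 6) (at_right 0)"
    if "x > 0"
    using that by (real_asymp simp: power2_eq_square power3_eq_cube)+
  show "((\<lambda>a. (1 - exp (- a * x)) / a) \<longlongrightarrow> x) (at_right 0)"
    and "((\<lambda>a. (exp (- a * x) - 1 + a * x) / a\<^sup>2) \<longlongrightarrow> x\<^sup>2 / 2) (at_right 0)"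
    and "((\<lambda>a. (1 - a * x + (a * x)\<^sup>2 / 2 - exp (- a * x)) / a ^ 3) \<longlongrightarrow> x ^ 3 / 6) (at_right 0)"
    using 1 2 3 assms by (cases "x = 0"; simp)+
qed

text \<open>The Taylor remainders alternate in sign, so each quotient lies below its own limit; this
  is the domination that \<open>nn_integral_tendsto_at_right_0\<close> asks for, and the moments on
  the right may be infinite.\<close>

lemma
  fixes Y :: "'b \<Rightarrow> real"
  assumes Y[measurable]: "Y \<in> borel_measurable N" and pos: "AE x in N. 0 \<le> Y x"
  shows nn_integral_exp_minus_limit1:
      "((\<lambda>a. \<integral>\<^sup>+x. ennreal ((1 - exp (- a * Y x)) / a) \<partial>N) \<longlongrightarrow> (\<integral>\<^sup>+x. ennreal (Y x) \<partial>N)) (at_right 0)"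
    and nn_integral_exp_minus_limit2:
      "((\<lambda>a. \<integral>\<^sup>+x. ennreal ((exp (- a * Y x) - 1 + a * Y x) / a\<^sup>2) \<partial>N) \<longlongrightarrow>
        (\<integral>\<^sup>+x. ennreal ((Y x)\<^sup>2 / 2) \<partial>N)) (at_right 0)"
    and nn_integral_exp_minus_limit3:
      "((\<lambda>a. \<integral>\<^sup>+x. ennreal ((1 - a * Y x + (a * Y x)\<^sup>2 / 2 - exp (- a * Y x)) / a ^ 3) \<partial>N) \<longlongrightarrow>
        (\<integral>\<^sup>+x. ennreal (Y x ^ 3 / 6) \<partial>N)) (at_right 0)"
proof -
  have 1: "(1 - exp (- a * y)) / a \<le> y" if "a > 0" "y \<ge> 0" for a y :: real
    using exp_minus_taylor1[of "a * y"] that by (simp add: field_simps)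
  show "((\<lambda>a. \<integral>\<^sup>+x. ennreal ((1 - exp (- a * Y x)) / a) \<partial>N) \<longlongrightarrow> (\<integral>\<^sup>+x. ennreal (Y x) \<partial>N)) (at_right 0)"
    using pos
    by (intro nn_integral_tendsto_at_right_0)
       (auto elim!: eventually_mono intro!: ennreal_leI 1[simplified] tendsto_ennrealI exp_minus_limits(1)[simplified])
  have 2: "(exp (- a * y) - 1 + a * y) / a\<^sup>2 \<le> y\<^sup>2 / 2" if "a > 0" "y \<ge> 0" for a y :: real
    using exp_minus_taylor2[of "a * y"] that by (simp add: field_simps power2_eq_square)
  show "((\<lambda>a. \<integral>\<^sup>+x. ennreal ((exp (- a * Y x) - 1 + a * Y x) / a\<^sup>2) \<partial>N) \<longlongrightarrow>
        (\<integral>\<^sup>+x. ennreal ((Y x)\<^sup>2 / 2) \<partial>N)) (at_right 0)"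
    using pos
    by (intro nn_integral_tendsto_at_right_0)
       (auto elim!: eventually_mono intro!: ennreal_leI 2[simplified] tendsto_ennrealI exp_minus_limits(2)[simplified])
  have 3: "(1 - a * y + (a * y)\<^sup>2 / 2 - exp (- a * y)) / a ^ 3 \<le> y ^ 3 / 6" if "a > 0" "y \<ge> 0" for a y :: real
    using exp_minus_taylor3(2)[of "a * y"] that by (simp add: field_simps power_mult_distrib)
  show "((\<lambda>a. \<integral>\<^sup>+x. ennreal ((1 - a * Y x + (a * Y x)\<^sup>2 / 2 - exp (- a * Y x)) / a ^ 3) \<partial>N) \<longlongrightarrow>
        (\<integral>\<^sup>+x. ennreal (Y x ^ 3 / 6) \<partial>N)) (at_right 0)"
    using pos
    by (intro nn_integral_tendsto_at_right_0)
       (auto elim!: eventually_mono intro!: ennreal_leI 3[simplified] tendsto_ennrealI exp_minus_limits(3)[simplified])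
qed

text \<open>The inequality y <= exp y at y = a x / k, raised to the power k. It bounds moments
  damped by an exponential.\<close>

lemma power_le_exp:
  fixes a x :: real
  assumes "a > 0" "x \<ge> 0"
  shows "x ^ k \<le> (real k / a) ^ k * exp (a * x)"
proof (cases "k = 0")
  case False
  have "x \<le> (real k / a) * exp (a * x / real k)"
    using exp_ge_add_one_self[of "a * x / real k"] False assms by (simp add: field_simps)
  then have "x ^ k \<le> ((real k / a) * exp (a * x / real k)) ^ k"
    using assms by (intro power_mono) auto
  also have "\<dots> = (real k / a) ^ k * exp (a * x)"
    using False by (simp only: power_mult_distrib) (simp flip: exp_of_nat_mult)
  finally show ?thesis .
qed (use assms in simp)

text \<open>This is 1 + y < exp y times exp (- y). It fixes the sign of the gaps between a
  difference quotient and a derivative of a Laplace transform.\<close>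

lemma exp_gap:
  fixes y :: real
  assumes "0 < y"
  shows "y * exp (- y) < 1 - exp (- y)"
proof -
  have "(1 + y) * exp (- y) < exp y * exp (- y)"
    using exp_ge_add_one_self[of y] exp_minus_greater[of "- y"] assms
    by (intro mult_strict_right_mono) (auto simp: less_le exp_eq_one_iff)
  then show ?thesis by (simp add: algebra_simps flip: exp_add)
qed

section \<open>Integrals against the Levy measure\<close>

locale levy_measure =
  fixes \<nu> :: "real measure"
  assumes sets_nu: "sets \<nu> = sets borel"
    and null_nonpos: "emeasure \<nu> {..0} = 0"
    and min_finite: "(\<integral>\<^sup>+x. ennreal (min 1 x) \<partial>\<nu>) < \<infinity>"
begin

lemmas [measurable_cong] = sets_nu

definition eta :: "real \<Rightarrow> real" where
  "eta a = (\<integral>x. (1 - exp (- a * x)) \<partial>\<nu>)"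

text \<open>For \<open>k \<ge> 1\<close> this is the Laplace transform of the measure x^k \<nu>(dx)
  and, up to sign, the k-th derivative of \<open>eta\<close>. For infinite \<nu> the integral may
  diverge at \<open>k = 0\<close>, whence the side conditions \<open>k \<ge> 1\<close>
  below.\<close>

definition lap :: "nat \<Rightarrow> real \<Rightarrow> real" where
  "lap k a = (\<integral>x. x ^ k * exp (- a * x) \<partial>\<nu>)"

text \<open>Extended nonnegative values keep an infinite moment visible; a Bochner integral would
  turn it into 0.\<close>

definition nmom :: "nat \<Rightarrow> ennreal" where
  "nmom k = (\<integral>\<^sup>+x. ennreal (x ^ k) \<partial>\<nu>)"

lemma AE_pos: "AE x in \<nu>. 0 < x"
  using null_nonpos by (intro AE_I[of _ _ "{..0}"]) (auto simp: sets_nu)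

lemma integrable_min: "integrable \<nu> (\<lambda>x. min 1 x)"
  using min_finite AE_pos by (intro integrableI_nonneg) (auto elim: eventually_mono)

lemma integrable_eta: "a \<ge> 0 \<Longrightarrow> integrable \<nu> (\<lambda>x. 1 - exp (- a * x))"
proof (rule Bochner_Integration.integrable_bound[OF integrable_mult_right[OF integrable_min, of "max 1 a"]])
  assume a: "a \<ge> 0"
  show "AE x in \<nu>. norm (1 - exp (- a * x)) \<le> norm (max 1 a * min 1 x)"
    using AE_pos
  proof eventually_elim
    case (elim x)
    have "1 - exp (- a * x) \<le> max 1 a * min 1 x"
    proof (cases "x \<le> 1")
      case True
      have "1 - exp (- a * x) \<le> a * x" using exp_minus_taylor1[of "a * x"] elim a by simp
      also have "\<dots> \<le> max 1 a * x" using elim by (intro mult_right_mono) auto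
      finally show ?thesis using True by simp
    next
      case False
      have "1 - exp (- a * x) \<le> 1" by simp
      also have "1 \<le> max 1 a * min 1 x" using False by simp
      finally show ?thesis .
    qed
    moreover have "0 \<le> 1 - exp (- a * x)" using elim a by simp
    ultimately show ?case by (metis abs_ge_self abs_of_nonneg order_trans real_norm_def)
  qed
qed measurable

lemma integrable_lap:
  assumes "a > 0" "k \<ge> 1" shows "integrable \<nu> (\<lambda>x. x ^ k * exp (- a * x))"
\<comment> \<open>The factor covers both ranges: x^k <= x for x <= 1, and
  \<open>power_le_exp\<close> for x > 1.\<close>
proof (rule Bochner_Integration.integrable_bound[OF integrable_mult_right[OF integrable_min,
        of "max 1 ((real k / a) ^ k)"]])
  show "AE x in \<nu>. norm (x ^ k * exp (- a * x)) \<le> norm (max 1 ((real k / a) ^ k) * min 1 x)"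
    using AE_pos
  proof eventually_elim
    case (elim x)
    have "x ^ k * exp (- a * x) \<le> max 1 ((real k / a) ^ k) * min 1 x"
    proof (cases "x \<le> 1")
      case True
      have "x ^ k * exp (- a * x) \<le> x ^ 1 * 1"
        using True elim assms by (intro mult_mono power_decreasing) auto
      also have "\<dots> \<le> max 1 ((real k / a) ^ k) * x"
        using elim mult_right_mono[of 1 "max 1 ((real k / a) ^ k)" x] by simp
      finally show ?thesis using True by simp
    next
      case False
      have "x ^ k * exp (- a * x) \<le> (real k / a) ^ k * exp (a * x) * exp (- a * x)"
        using power_le_exp[of a x k] assms elim by (intro mult_right_mono) auto
      also have "\<dots> = (real k / a) ^ k" by (simp flip: exp_add)
      finally show ?thesis using False by simp
    qed
    moreover have "0 \<le> x ^ k * exp (- a * x)" using elim by simp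
    ultimately show ?case by (metis abs_ge_self abs_of_nonneg order_trans real_norm_def)
  qed
qed simp_all

lemma eta_deriv:
  assumes "a > 0" shows "(eta has_real_derivative lap 1 a) (at a)"
proof -
  have "((\<lambda>a. \<integral>x. 1 + (- 1) * exp (- a * x) \<partial>\<nu>) has_real_derivative
      - (\<integral>x. (- 1) * (x * exp (- a * x)) \<partial>\<nu>)) (at a)"
    using integrable_eta integrable_lap[of _ 1] AE_pos assms
    by (intro has_real_derivative_laplace) (auto elim: eventually_mono)
  then show ?thesis by (simp add: eta_def[abs_def] lap_def)
qed

lemma lap_deriv:
  assumes "a > 0" "k \<ge> 1" shows "(lap k has_real_derivative - lap (Suc k) a) (at a)"
proof -
  have "((\<lambda>a. \<integral>x. 0 + x ^ k * exp (- a * x) \<partial>\<nu>) has_real_derivative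
      - (\<integral>x. x ^ k * (x * exp (- a * x)) \<partial>\<nu>)) (at a)"
    using integrable_lap[of _ k] integrable_lap[of _ "Suc k"] AE_pos assms
    by (intro has_real_derivative_laplace) (auto elim: eventually_mono simp: mult_ac)
  then show ?thesis by (simp add: lap_def[abs_def] mult_ac)
qed

lemma ennreal_lap:
  assumes "a > 0" "k \<ge> 1"
  shows "ennreal (lap k a) = (\<integral>\<^sup>+x. ennreal (x ^ k * exp (- a * x)) \<partial>\<nu>)"
  unfolding lap_def using integrable_lap[OF assms] AE_pos
  by (intro nn_integral_eq_integral[symmetric]) (auto elim: eventually_mono)

lemma lap_nonneg: "0 \<le> lap k a"
  unfolding lap_def using AE_pos by (intro integral_nonneg_AE) (auto elim: eventually_mono)

lemma lap_limit:
  assumes "k \<ge> 1" shows "((\<lambda>a. ennreal (lap k a)) \<longlongrightarrow> nmom k) (at_right 0)"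
proof -
  have "((\<lambda>a. \<integral>\<^sup>+x. ennreal (x ^ k * exp (- a * x)) \<partial>\<nu>) \<longlongrightarrow> nmom k) (at_right 0)"
    unfolding nmom_def
  proof (rule nn_integral_tendsto_at_right_0)
    show "AE x in \<nu>. ennreal (x ^ k * exp (- a * x)) \<le> ennreal (x ^ k)" if "a > 0" for a
      using AE_pos by eventually_elim (use that in \<open>auto intro!: ennreal_leI mult_left_le\<close>)
    show "AE x in \<nu>. ((\<lambda>a. ennreal (x ^ k * exp (- a * x))) \<longlongrightarrow> ennreal (x ^ k)) (at_right 0)"
    proof (intro AE_I2 tendsto_ennrealI)
      fix x :: real
      have "((\<lambda>a. x ^ k * exp (- a * x)) \<longlongrightarrow> x ^ k * exp (- 0 * x)) (at_right 0)"
        by (intro tendsto_intros)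
      then show "((\<lambda>a. x ^ k * exp (- a * x)) \<longlongrightarrow> x ^ k) (at_right 0)" by simp
    qed
  qed measurable
  then show ?thesis
    using ennreal_lap[OF _ assms] by (auto elim!: Lim_transform_eventually simp: eventually_at_filter)
qed

context
  fixes \<phi> :: "real \<Rightarrow> real"
  assumes \<phi>: "\<And>a. a \<ge> 0 \<Longrightarrow> \<phi> a = a - eta a"
begin

lemma phi_deriv: "a > 0 \<Longrightarrow> (\<phi> has_real_derivative 1 - lap 1 a) (at a)"
proof -
  assume a: "a > 0"
  have "((\<lambda>a. a - eta a) has_real_derivative 1 - lap 1 a) (at a)"
    using a by (auto intro!: derivative_eq_intros eta_deriv)
  then show ?thesis
    by (rule DERIV_cong_ev[THEN iffD1, rotated 3])
       (use a in \<open>auto intro!: eventually_mono[OF eventually_nhds_in_open[of "{0<..}"]] simp: \<phi>\<close>)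
qed

text \<open>\<open>deriv\<close> sees only the germ at \<open>a\<close>. Formulas valid on the open
  half-line can thus be differentiated again, although \<phi> is left unspecified for negative
  arguments.\<close>

lemma deriv_eqI_pos:
  fixes f g :: "real \<Rightarrow> real"
  assumes "\<And>a. a > 0 \<Longrightarrow> f a = g a" "(g has_real_derivative D) (at a)" "a > 0"
  shows "deriv f a = D"
proof -
  have "(f has_real_derivative D) (at a) \<longleftrightarrow> (g has_real_derivative D) (at a)"
    by (rule DERIV_cong_ev)
       (use assms in \<open>auto intro!: eventually_mono[OF eventually_nhds_in_open[of "{0<..}"]]\<close>)
  then show ?thesis using assms by (intro DERIV_imp_deriv) simp
qed

lemma deriv_phi: "a > 0 \<Longrightarrow> deriv \<phi> a = 1 - lap 1 a"
  using phi_deriv by (rule DERIV_imp_deriv)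

lemma deriv2_phi: "a > 0 \<Longrightarrow> (deriv ^^ 2) \<phi> a = lap 2 a"
  unfolding numeral_2_eq_2 funpow.simps comp_def id_def
  by (rule deriv_eqI_pos[OF deriv_phi]) (auto intro!: derivative_eq_intros lap_deriv)

lemma deriv3_phi: "a > 0 \<Longrightarrow> (deriv ^^ 3) \<phi> a = - lap 3 a"
  unfolding numeral_3_eq_3 funpow.simps(2)[of "Suc (Suc 0)"] comp_def
  by (rule deriv_eqI_pos[OF deriv2_phi[unfolded numeral_2_eq_2]])
     (auto intro!: derivative_eq_intros lap_deriv)

lemma lap_limit_ereal: "k \<ge> 1 \<Longrightarrow> ((\<lambda>a. ereal (lap k a)) \<longlongrightarrow> enn2ereal (nmom k)) (at_right 0)"
  using tendsto_enn2erealI[OF lap_limit] lap_nonneg by (simp add: enn2ereal_ennreal)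

lemma deriv0_eqI:
  assumes "\<And>a. a > 0 \<Longrightarrow> ereal ((deriv ^^ k) \<phi> a) = f a" "(f \<longlongrightarrow> l) (at_right 0)"
  shows "deriv0 k \<phi> = l"
  unfolding deriv0_def
proof (rule tendsto_Lim)
  show "((\<lambda>a. ereal ((deriv ^^ k) \<phi> a)) \<longlongrightarrow> l) (at_right 0)"
    using assms(2) by (rule Lim_transform_eventually) (auto simp: eventually_at_filter assms(1))
qed simp

lemma deriv0_phi:
  "deriv0 1 \<phi> = 1 - enn2ereal (nmom 1)"
  "deriv0 2 \<phi> = enn2ereal (nmom 2)"
  "deriv0 3 \<phi> = - enn2ereal (nmom 3)"
proof -
  have "((\<lambda>a. ereal 1 - ereal (lap 1 a)) \<longlongrightarrow> 1 - enn2ereal (nmom 1)) (at_right 0)"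
    unfolding one_ereal_def
    by (rule tendsto_diff_ereal_general[OF tendsto_const lap_limit_ereal]) auto
  then show "deriv0 1 \<phi> = 1 - enn2ereal (nmom 1)"
    by (rule deriv0_eqI[rotated]) (simp add: deriv_phi)
  show "deriv0 2 \<phi> = enn2ereal (nmom 2)"
    by (rule deriv0_eqI[OF _ lap_limit_ereal]) (simp_all add: deriv2_phi)
  have "((\<lambda>a. - ereal (lap 3 a)) \<longlongrightarrow> - enn2ereal (nmom 3)) (at_right 0)"
    by (intro tendsto_uminus_ereal lap_limit_ereal) simp
  then show "deriv0 3 \<phi> = - enn2ereal (nmom 3)"
    by (rule deriv0_eqI[rotated]) (simp add: deriv3_phi)
qed

end

end

section \<open>The exponent near 0 under stability\<close>

locale stable_levy = levy_measure +
  assumes stable: "nmom 1 < 1"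
begin

definition mu :: real where "mu = enn2real (nmom 1)"
definition d1 :: real where "d1 = 1 - mu"
definition phi :: "real \<Rightarrow> real" where "phi a = a - eta a"
definition m2 :: real where "m2 = enn2real (nmom 2)"
definition m3 :: real where "m3 = enn2real (nmom 3)"

lemma ennreal_mu: "ennreal mu = nmom 1"
  unfolding mu_def by (rule ennreal_enn2real) (metis ennreal_one_less_top order.strict_trans stable)

lemma mu_nonneg: "0 \<le> mu" by (simp add: mu_def)

lemma d1_pos: "0 < d1"
proof -
  have "ennreal mu < ennreal 1" using stable by (simp add: ennreal_mu)
  then show ?thesis by (simp add: d1_def ennreal_less_iff mu_nonneg)
qed

lemma AE_nonneg: "AE x in \<nu>. 0 \<le> x"
  using AE_pos by eventually_elim simp

lemma integrable_id: "integrable \<nu> (\<lambda>x. x)"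
proof (rule integrableI_nonneg)
  show "AE x in \<nu>. 0 \<le> x" using AE_pos by eventually_elim simp
  have "(\<integral>\<^sup>+x. ennreal x \<partial>\<nu>) = ennreal mu" by (simp add: ennreal_mu nmom_def)
  then show "(\<integral>\<^sup>+x. ennreal x \<partial>\<nu>) < \<infinity>" by simp
qed simp

lemma mu_eq: "mu = (\<integral>x. x \<partial>\<nu>)"
proof -
  have nn: "AE x in \<nu>. 0 \<le> x" using AE_pos by eventually_elim simp
  have "ennreal (\<integral>x. x \<partial>\<nu>) = ennreal mu"
    using nn_integral_eq_integral[OF integrable_id nn] by (simp add: ennreal_mu nmom_def)
  then show ?thesis using mu_nonneg integral_nonneg_AE[OF nn] by simp
qed

lemma eta_nonneg: "a \<ge> 0 \<Longrightarrow> 0 \<le> eta a"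
  unfolding eta_def using AE_pos by (intro integral_nonneg_AE) (auto elim: eventually_mono)

lemma eta_le: "a \<ge> 0 \<Longrightarrow> eta a \<le> a * mu"
  unfolding eta_def mu_eq integral_mult_right_zero[symmetric]
proof (intro integral_mono_AE integrable_eta integrable_mult_right integrable_id)
  assume a: "a \<ge> 0"
  show "AE x in \<nu>. 1 - exp (- a * x) \<le> a * x"
    using AE_pos
  proof eventually_elim
    case (elim x)
    then show ?case using exp_minus_taylor1[of "a * x"] a by simp
  qed
qed

lemma phi_bounds: "a \<ge> 0 \<Longrightarrow> a * d1 \<le> phi a" "a \<ge> 0 \<Longrightarrow> phi a \<le> a"
  using eta_le[of a] eta_nonneg[of a] by (simp_all add: phi_def d1_def algebra_simps)

lemma phi_pos: "a > 0 \<Longrightarrow> 0 < phi a"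
  using phi_bounds(1)[of a] d1_pos mult_pos_pos[of a d1] by linarith

lemma DERIV_phi: "a > 0 \<Longrightarrow> (phi has_real_derivative 1 - lap 1 a) (at a)"
  by (rule phi_deriv) (simp_all add: phi_def)

lemma lap1_limit: "(lap 1 \<longlongrightarrow> mu) (at_right 0)"
  using lap_limit[of 1] mu_nonneg lap_nonneg
  by (intro tendsto_ennrealD) (auto simp: ennreal_mu)

lemma eta_limit: "((\<lambda>a. eta a / a) \<longlongrightarrow> mu) (at_right 0)"
proof (rule tendsto_ennrealD)
  have eq: "(\<integral>\<^sup>+x. ennreal ((1 - exp (- a * x)) / a) \<partial>\<nu>) = ennreal (eta a / a)" if "a > 0" for a
  proof -
    have "ennreal (\<integral>x. (1 - exp (- a * x)) / a \<partial>\<nu>) = (\<integral>\<^sup>+x. ennreal ((1 - exp (- a * x)) / a) \<partial>\<nu>)"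
      using that AE_pos
      by (intro nn_integral_eq_integral[symmetric] integrable_divide integrable_eta)
        (auto elim!: eventually_mono)
    then show ?thesis by (simp add: eta_def)
  qed
  have "((\<lambda>a. \<integral>\<^sup>+x. ennreal ((1 - exp (- a * x)) / a) \<partial>\<nu>) \<longlongrightarrow> ennreal mu) (at_right 0)"
    using nn_integral_exp_minus_limit1[of "\<lambda>x. x" \<nu>] AE_nonneg
    by (simp add: ennreal_mu nmom_def measurable_ident_sets[OF sets_nu])
  then show "((\<lambda>a. ennreal (eta a / a)) \<longlongrightarrow> ennreal mu) (at_right 0)"
    by (rule Lim_transform_eventually) (rule eventually_mono[OF eventually_at_right_less eq])
qed (auto simp: mu_nonneg eventually_at_filter eta_nonneg intro!: always_eventually divide_nonneg_nonneg)

lemma phi_limit: "((\<lambda>a. phi a / a) \<longlongrightarrow> d1) (at_right 0)"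
proof -
  have "((\<lambda>a. 1 - eta a / a) \<longlongrightarrow> d1) (at_right 0)"
    unfolding d1_def by (intro tendsto_intros eta_limit)
  then show ?thesis
    by (rule Lim_transform_eventually) (auto simp: eventually_at_filter phi_def field_simps)
qed

text \<open>\<open>phi a - a * d1\<close> equals \<open>a * mu - eta a\<close>, the second order
  Taylor remainder integrated against \<nu>. The limit is kept in the extended nonnegative reals
  because it also has to decide the case of an infinite second moment.\<close>

lemma phi_limit2: "((\<lambda>a. ennreal ((phi a - a * d1) / a\<^sup>2)) \<longlongrightarrow> nmom 2 / 2) (at_right 0)"
proof -
  have eq: "(\<integral>\<^sup>+x. ennreal ((exp (- a * x) - 1 + a * x) / a\<^sup>2) \<partial>\<nu>) = ennreal ((phi a - a * d1) / a\<^sup>2)"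
    if a: "a > 0" for a
  proof -
    have "(\<integral>x. (exp (- a * x) - 1 + a * x) / a\<^sup>2 \<partial>\<nu>) = (\<integral>x. (a * x - (1 - exp (- a * x))) / a\<^sup>2 \<partial>\<nu>)"
      by (intro Bochner_Integration.integral_cong) auto
    also have "\<dots> = (a * mu - eta a) / a\<^sup>2"
      unfolding mu_eq eta_def using a
      by (simp add: integrable_id integrable_eta[simplified])
    finally have 1: "(\<integral>x. (exp (- a * x) - 1 + a * x) / a\<^sup>2 \<partial>\<nu>) = (phi a - a * d1) / a\<^sup>2"
      by (simp add: phi_def d1_def algebra_simps)
    have "integrable \<nu> (\<lambda>x. (a * x - (1 - exp (- a * x))) / a\<^sup>2)"
      using a by (intro integrable_divide Bochner_Integration.integrable_diff integrable_mult_right integrable_id integrable_eta) auto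
    then have 2: "integrable \<nu> (\<lambda>x. (exp (- a * x) - 1 + a * x) / a\<^sup>2)" by (simp add: algebra_simps)
    have "AE x in \<nu>. 0 \<le> (exp (- a * x) - 1 + a * x) / a\<^sup>2"
    proof (rule AE_I2)
      fix x show "0 \<le> (exp (- a * x) - 1 + a * x) / a\<^sup>2"
        using exp_minus_ge1[of "a * x"] by simp
    qed
    from nn_integral_eq_integral[OF 2 this] show ?thesis unfolding 1 .
  qed
  have "((\<lambda>a. \<integral>\<^sup>+x. ennreal ((exp (- a * x) - 1 + a * x) / a\<^sup>2) \<partial>\<nu>) \<longlongrightarrow> (\<integral>\<^sup>+x. ennreal (x\<^sup>2 / 2) \<partial>\<nu>)) (at_right 0)"
    using AE_pos by (intro nn_integral_exp_minus_limit2) (auto elim: eventually_mono)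
  also have "(\<integral>\<^sup>+x. ennreal (x\<^sup>2 / 2) \<partial>\<nu>) = nmom 2 / 2"
    unfolding nmom_def by (subst nn_integral_divide[symmetric]) (auto simp: divide_ennreal intro!: nn_integral_cong simp flip: ennreal_numeral)
  finally show ?thesis
    by (rule Lim_transform_eventually) (rule eventually_mono[OF eventually_at_right_less eq])
qed

text \<open>Since \<open>phi\<close> has derivative \<open>1 - lap 1 a\<close>, the left side is
  phi'(a) - phi(a)/a. It is the error left over when the limit of (iii) at 0 is split in
  \<open>K_limit\<close>, where it has to be of order \<open>a\<close>.\<close>

lemma gap_eq: "a > 0 \<Longrightarrow> eta a / a - lap 1 a = (\<integral>x. (1 - exp (- a * x)) / a - x * exp (- a * x) \<partial>\<nu>)"
  unfolding eta_def lap_def using integrable_eta[of a] integrable_lap[of a 1]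
  by (subst Bochner_Integration.integral_diff) auto

lemma integrable_gap: "a > 0 \<Longrightarrow> integrable \<nu> (\<lambda>x. (1 - exp (- a * x)) / a - x * exp (- a * x))"
  using integrable_eta[of a] integrable_lap[of a 1] by auto

lemma gap_nonneg_integrand:
  "(a::real) > 0 \<Longrightarrow> x > 0 \<Longrightarrow> 0 < (1 - exp (- a * x)) / a - x * exp (- a * x)"
  using exp_gap[of "a * x"] by (simp add: field_simps)

lemma gap_nonneg: "a > 0 \<Longrightarrow> 0 \<le> eta a / a - lap 1 a"
  unfolding gap_eq
  by (intro integral_nonneg_AE eventually_mono[OF AE_pos]) (rule less_imp_le[OF gap_nonneg_integrand])

context
  assumes fin2: "nmom 2 < \<infinity>"
begin

lemma ennreal_m2: "ennreal m2 = nmom 2"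
  unfolding m2_def using fin2 by simp

lemma m2_nonneg: "0 \<le> m2" by (simp add: m2_def)

lemma integrable_sq: "integrable \<nu> (\<lambda>x. x\<^sup>2)"
  using fin2 by (intro integrableI_nonneg) (auto simp: nmom_def)

lemma m2_eq: "m2 = (\<integral>x. x\<^sup>2 \<partial>\<nu>)"
  unfolding m2_def nmom_def by (subst nn_integral_eq_integral) (auto intro: integrable_sq)

lemma phi_limit2_real: "((\<lambda>a. (phi a - a * d1) / a\<^sup>2) \<longlongrightarrow> m2 / 2) (at_right 0)"
proof (rule tendsto_ennrealD)
  show "((\<lambda>a. ennreal ((phi a - a * d1) / a\<^sup>2)) \<longlongrightarrow> ennreal (m2 / 2)) (at_right 0)"
    using phi_limit2 by (simp add: ennreal_m2 m2_nonneg divide_ennreal[symmetric])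
qed (auto simp: m2_nonneg eventually_at_filter phi_bounds intro!: always_eventually divide_nonneg_nonneg)

lemma gap_le: "a > 0 \<Longrightarrow> eta a / a - lap 1 a \<le> a * m2"
  unfolding gap_eq m2_eq integral_mult_right_zero[symmetric]
proof (intro integral_mono_AE integrable_gap integrable_mult_right integrable_sq)
  assume a: "a > 0"
  show "AE x in \<nu>. (1 - exp (- a * x)) / a - x * exp (- a * x) \<le> a * x\<^sup>2"
    using AE_pos
  proof eventually_elim
    case (elim x)
    have "(1 - exp (- a * x)) / a \<le> x" using exp_minus_taylor1[of "a * x"] elim a by (simp add: field_simps)
    moreover have "x * (1 - exp (- a * x)) \<le> x * (a * x)"
      using exp_minus_taylor1[of "a * x"] elim a by (intro mult_left_mono) auto
    ultimately show ?case by (simp add: algebra_simps power2_eq_square)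
  qed
qed

lemma phi_limit3:
  assumes fin3: "nmom 3 < \<infinity>"
  shows "((\<lambda>a. (a * d1 + a\<^sup>2 * m2 / 2 - phi a) / a ^ 3) \<longlongrightarrow> m3 / 6) (at_right 0)"
proof (rule tendsto_ennrealD)
  let ?e = "\<lambda>a x. (1 - a * x + (a * x)\<^sup>2 / 2 - exp (- a * x)) / a ^ 3"
  have eq: "(\<integral>\<^sup>+x. ennreal (?e a x) \<partial>\<nu>) = ennreal ((a * d1 + a\<^sup>2 * m2 / 2 - phi a) / a ^ 3)"
    and nn: "0 \<le> (a * d1 + a\<^sup>2 * m2 / 2 - phi a) / a ^ 3"
    if a: "a > 0" for a
  proof -
    have e: "?e a = (\<lambda>x. ((1 - exp (- a * x)) - a * x + a\<^sup>2 / 2 * x\<^sup>2) / a ^ 3)"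
      by (auto simp: fun_eq_iff algebra_simps power_mult_distrib)
    have 1: "(\<integral>x. ?e a x \<partial>\<nu>) = (eta a - a * mu + a\<^sup>2 / 2 * m2) / a ^ 3"
      unfolding e mu_eq eta_def m2_eq using a
      by (simp add: integrable_id integrable_sq integrable_eta[simplified])
    have 2: "integrable \<nu> (?e a)"
      unfolding e using a
      by (intro integrable_divide Bochner_Integration.integrable_diff Bochner_Integration.integrable_add integrable_mult_right integrable_id integrable_eta integrable_sq) auto
    have 3: "AE x in \<nu>. 0 \<le> ?e a x"
      using AE_pos
    proof eventually_elim
      case (elim x)
      then show ?case using exp_minus_taylor3(1)[of "a * x"] a by simp
    qed
    have 4: "(eta a - a * mu + a\<^sup>2 / 2 * m2) / a ^ 3 = (a * d1 + a\<^sup>2 * m2 / 2 - phi a) / a ^ 3"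
      by (simp add: phi_def d1_def algebra_simps)
    show "(\<integral>\<^sup>+x. ennreal (?e a x) \<partial>\<nu>) = ennreal ((a * d1 + a\<^sup>2 * m2 / 2 - phi a) / a ^ 3)"
      using nn_integral_eq_integral[OF 2 3] unfolding 1 4 .
    show "0 \<le> (a * d1 + a\<^sup>2 * m2 / 2 - phi a) / a ^ 3"
      using integral_nonneg_AE[OF 3] unfolding 1 4 .
  qed
  have "((\<lambda>a. \<integral>\<^sup>+x. ennreal (?e a x) \<partial>\<nu>) \<longlongrightarrow> (\<integral>\<^sup>+x. ennreal (x ^ 3 / 6) \<partial>\<nu>)) (at_right 0)"
    using AE_pos by (intro nn_integral_exp_minus_limit3) (auto elim: eventually_mono)
  also have "(\<integral>\<^sup>+x. ennreal (x ^ 3 / 6) \<partial>\<nu>) = (\<integral>\<^sup>+x. ennreal (x ^ 3) / 6 \<partial>\<nu>)"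
    using AE_pos by (intro nn_integral_cong_AE) (auto elim!: eventually_mono simp: divide_ennreal simp flip: ennreal_numeral)
  also have "\<dots> = ennreal (m3 / 6)"
    using fin3 unfolding m3_def nmom_def
    by (subst nn_integral_divide) (auto simp: divide_ennreal[symmetric])
  finally show "((\<lambda>a. ennreal ((a * d1 + a\<^sup>2 * m2 / 2 - phi a) / a ^ 3)) \<longlongrightarrow> ennreal (m3 / 6)) (at_right 0)"
    by (rule Lim_transform_eventually) (rule eventually_mono[OF eventually_at_right_less eq])
  show "\<forall>\<^sub>F a in at_right 0. 0 \<le> (a * d1 + a\<^sup>2 * m2 / 2 - phi a) / a ^ 3"
    using nn by (auto simp: eventually_at_filter)
qed (simp add: m3_def)

end

lemma fin3_imp_fin2:
  assumes "nmom 3 < \<infinity>" shows "nmom 2 < \<infinity>"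
proof -
  have "nmom 2 \<le> (\<integral>\<^sup>+x. ennreal (x ^ 1) + ennreal (x ^ 3) \<partial>\<nu>)"
    unfolding nmom_def
  proof (rule nn_integral_mono_AE, use AE_pos in eventually_elim)
    case (elim x)
    have "x\<^sup>2 \<le> x ^ 1 + x ^ 3"
    proof (cases "x \<le> 1")
      case True
      then have "x\<^sup>2 \<le> x ^ 1" using elim by (intro power_decreasing) auto
      then show ?thesis using elim zero_le_power[of x 3] by linarith
    next
      case False
      then have "x\<^sup>2 \<le> x ^ 3" by (intro power_increasing) auto
      then show ?thesis using elim by simp
    qed
    then show ?case using elim by (simp add: ennreal_plus[symmetric] del: ennreal_plus)
  qed
  also have "\<dots> = nmom 1 + nmom 3"
    unfolding nmom_def
    by (rule nn_integral_add) auto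
  also have "\<dots> < \<infinity>" using stable assms by (auto simp: less_top[symmetric])
  finally show ?thesis .
qed

end

section \<open>The subordinator\<close>

text \<open>Cauchy's equation. Comparing the multiple n t with its neighbouring integers gives n |f
  t - t f 1| <= f 1 for every n, which forces equality.\<close>

lemma additive_mono_imp_linear:
  fixes f :: "real \<Rightarrow> real"
  assumes add: "\<And>s t. 0 \<le> s \<Longrightarrow> 0 \<le> t \<Longrightarrow> f (s + t) = f s + f t"
    and mono: "\<And>s t. 0 \<le> s \<Longrightarrow> s \<le> t \<Longrightarrow> f s \<le> f t"
    and t: "0 \<le> t"
  shows "f t = t * f 1"
proof -
  have f0: "f 0 = 0" using add[of 0 0] by simp
  have mult: "f (real n * s) = real n * f s" if "0 \<le> s" for n s
    using that by (induction n) (simp_all add: f0 add algebra_simps)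
  have bound: "real n * \<bar>f t - t * f 1\<bar> \<le> f 1" for n
  proof -
    define k where "k = nat \<lfloor>real n * t\<rfloor>"
    have k: "real k \<le> real n * t" "real n * t \<le> real k + 1"
      using t by (simp_all add: k_def le_nat_floor)
    have "real k * f 1 \<le> real n * f t"
      using mono[of "real k * 1" "real n * t"] mult[of 1 k] mult[of t n] k t by simp
    moreover have "real n * f t \<le> (real k + 1) * f 1"
      using mono[of "real n * t" "real (Suc k) * 1"] mult[of 1 "Suc k"] mult[of t n] k t
      by (simp add: add.commute)
    moreover have "0 \<le> f 1" using mono[of 0 1] f0 by simp
    then have "real k * f 1 \<le> (real n * t) * f 1" "(real n * t) * f 1 \<le> (real k + 1) * f 1"
      using k by (auto intro: mult_right_mono)
    ultimately have "\<bar>real n * f t - real n * t * f 1\<bar> \<le> f 1" by (simp add: algebra_simps abs_le_iff)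
    also have "real n * f t - real n * t * f 1 = real n * (f t - t * f 1)" by (simp add: algebra_simps)
    finally show ?thesis by (simp add: abs_mult)
  qed
  show ?thesis
  proof (rule ccontr)
    assume "f t \<noteq> t * f 1"
    then have "\<bar>f t - t * f 1\<bar> > 0" by simp
    from reals_Archimedean3[OF this] obtain n where "f 1 < real n * \<bar>f t - t * f 1\<bar>" by blast
    with bound[of n] show False by simp
  qed
qed

lemma one_minus_exp_limit:
  fixes u :: "real \<Rightarrow> real"
  assumes u: "((\<lambda>a. u a / a) \<longlongrightarrow> l) (at_right 0)" and nn: "\<And>a. a > 0 \<Longrightarrow> 0 \<le> u a"
  shows "((\<lambda>a. (1 - exp (- u a)) / a) \<longlongrightarrow> l) (at_right 0)"
proof (rule tendsto_sandwich)
  have "((\<lambda>a. u a / a - (u a / a)\<^sup>2 * a / 2) \<longlongrightarrow> l - l\<^sup>2 * 0 / 2) (at_right 0)"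
    by (intro tendsto_intros u) simp
  then show "((\<lambda>a. u a / a - (u a / a)\<^sup>2 * a / 2) \<longlongrightarrow> l) (at_right 0)" by simp
  show "\<forall>\<^sub>F a in at_right 0. u a / a - (u a / a)\<^sup>2 * a / 2 \<le> (1 - exp (- u a)) / a"
  proof (rule eventually_mono[OF eventually_at_right_less])
    fix a :: real assume a: "0 < a"
    have "u a - (u a)\<^sup>2 / 2 \<le> 1 - exp (- u a)" using exp_minus_taylor2[OF nn[OF a]] by simp
    then have "(u a - (u a)\<^sup>2 / 2) / a \<le> (1 - exp (- u a)) / a" using a by (intro divide_right_mono) auto
    moreover have "(u a - (u a)\<^sup>2 / 2) / a = u a / a - (u a / a)\<^sup>2 * a / 2"
      using a by (simp add: field_simps power2_eq_square)
    ultimately show "u a / a - (u a / a)\<^sup>2 * a / 2 \<le> (1 - exp (- u a)) / a" by simp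
  qed
  show "\<forall>\<^sub>F a in at_right 0. (1 - exp (- u a)) / a \<le> u a / a"
    using exp_minus_taylor1 nn
    by (intro eventually_mono[OF eventually_at_right_less]) (auto intro!: divide_right_mono)
qed (rule u)

locale levy_storage = prob_space M + stable_levy \<nu> for M :: "'a measure" and \<nu> +
  fixes J :: "real \<Rightarrow> 'a \<Rightarrow> real"
  assumes subord: "subordinator M \<nu> J"
begin

lemma J_meas [measurable]: "0 \<le> t \<Longrightarrow> J t \<in> borel_measurable M"
  and J_0: "\<omega> \<in> space M \<Longrightarrow> J 0 \<omega> = 0"
  and J_mono: "\<omega> \<in> space M \<Longrightarrow> 0 \<le> s \<Longrightarrow> s \<le> t \<Longrightarrow> J s \<omega> \<le> J t \<omega>"
  and J_right_cont: "\<omega> \<in> space M \<Longrightarrow> 0 \<le> t \<Longrightarrow> ((\<lambda>s. J s \<omega>) \<longlongrightarrow> J t \<omega>) (at_right t)"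
  and J_indep: "0 \<le> \<tau> 0 \<Longrightarrow> mono \<tau> \<Longrightarrow>
     indep_vars (\<lambda>_. borel) (\<lambda>i \<omega>. J (\<tau> (Suc i)) \<omega> - J (\<tau> i) \<omega>) (UNIV :: nat set)"
  and J_stat: "0 \<le> t \<Longrightarrow> 0 \<le> h \<Longrightarrow> distr M borel (\<lambda>\<omega>. J (t + h) \<omega> - J t \<omega>) = distr M borel (J h)"
  and J_laplace1: "0 \<le> a \<Longrightarrow> ln (\<integral>\<omega>. exp (- a * J 1 \<omega>) \<partial>M) = - eta a"
  using subord unfolding subordinator_def eta_def by (auto simp: mono_on_def continuous_within)

lemma J_nonneg: "\<omega> \<in> space M \<Longrightarrow> 0 \<le> t \<Longrightarrow> 0 \<le> J t \<omega>"
  using J_mono[of \<omega> 0 t] J_0[of \<omega>] by simp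

text \<open>\<open>\<Psi>\<close> packs an arbitrary functional of the first \<open>k\<close>
  increments into one real variable. Maxima over a time grid are of this form, and so become
  independent of the next increment.\<close>

lemma indep_increment:
  fixes \<tau> :: "nat \<Rightarrow> real"
  assumes "0 \<le> \<tau> 0" "mono \<tau>" "\<Psi> \<in> borel_measurable (PiM {..<k} (\<lambda>_. borel :: real measure))"
  shows "indep_var borel (\<lambda>\<omega>. \<Psi> (\<lambda>i\<in>{..<k}. J (\<tau> (Suc i)) \<omega> - J (\<tau> i) \<omega>) :: real)
           borel (\<lambda>\<omega>. J (\<tau> (Suc k)) \<omega> - J (\<tau> k) \<omega>)"
proof -
  have "indep_var (PiM {..<k} (\<lambda>_. borel)) (\<lambda>\<omega>. \<lambda>i\<in>{..<k}. J (\<tau> (Suc i)) \<omega> - J (\<tau> i) \<omega>)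
     (PiM {k} (\<lambda>_. borel)) (\<lambda>\<omega>. \<lambda>i\<in>{k}. J (\<tau> (Suc i)) \<omega> - J (\<tau> i) \<omega>)"
    by (rule indep_var_restrict[OF J_indep[OF assms(1,2)]]) auto
  from indep_var_compose[OF this assms(3), of "\<lambda>d. d k" borel]
  show ?thesis by (simp add: comp_def)
qed

lemma integrable_expJ: "0 \<le> t \<Longrightarrow> 0 \<le> a \<Longrightarrow> integrable M (\<lambda>\<omega>. exp (- a * J t \<omega>))"
  by (rule integrable_const_bound[where B = 1]) (auto intro!: AE_I2 simp: J_nonneg)

lemma expJ_increment:
  assumes "0 \<le> t" "0 \<le> h"
  shows "(\<integral>\<omega>. exp (- a * (J (t + h) \<omega> - J t \<omega>)) \<partial>M) = (\<integral>\<omega>. exp (- a * J h \<omega>) \<partial>M)"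
proof -
  have "(\<integral>x. exp (- a * x) \<partial>distr M borel (\<lambda>\<omega>. J (t + h) \<omega> - J t \<omega>)) = (\<integral>x. exp (- a * x) \<partial>distr M borel (J h))"
    using assms by (simp add: J_stat)
  then show ?thesis using assms by (simp add: integral_distr)
qed

lemma expJ_add:
  assumes "0 \<le> t" "0 \<le> h" "0 \<le> a"
  shows "(\<integral>\<omega>. exp (- a * J (t + h) \<omega>) \<partial>M) = (\<integral>\<omega>. exp (- a * J t \<omega>) \<partial>M) * (\<integral>\<omega>. exp (- a * J h \<omega>) \<partial>M)"
proof -
  define \<tau> :: "nat \<Rightarrow> real" where "\<tau> i = (if i = 0 then 0 else if i = 1 then t else t + h)" for i
  have "0 \<le> \<tau> 0" "mono \<tau>" using assms by (auto simp: \<tau>_def mono_def)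
  then have "indep_var borel (\<lambda>\<omega>. (\<lambda>d. d 0) (\<lambda>i\<in>{..<1}. J (\<tau> (Suc i)) \<omega> - J (\<tau> i) \<omega>))
      borel (\<lambda>\<omega>. J (\<tau> (Suc 1)) \<omega> - J (\<tau> 1) \<omega>)"
    by (rule indep_increment) auto
  then have "indep_var borel (\<lambda>\<omega>. J t \<omega> - J 0 \<omega>) borel (\<lambda>\<omega>. J (t + h) \<omega> - J t \<omega>)"
    by (simp add: \<tau>_def)
  then have ind: "indep_var borel (\<lambda>\<omega>. exp (- a * (J t \<omega> - J 0 \<omega>))) borel (\<lambda>\<omega>. exp (- a * (J (t + h) \<omega> - J t \<omega>)))"
    using indep_var_compose[of borel _ borel _ "\<lambda>x. exp (- a * x)" borel "\<lambda>x. exp (- a * x)" borel]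
    by (simp add: comp_def)
  have "(\<integral>\<omega>. exp (- a * J (t + h) \<omega>) \<partial>M) =
     (\<integral>\<omega>. exp (- a * (J t \<omega> - J 0 \<omega>)) * exp (- a * (J (t + h) \<omega> - J t \<omega>)) \<partial>M)"
    by (intro Bochner_Integration.integral_cong refl) (simp add: J_0 algebra_simps flip: exp_add)
  also have "\<dots> = (\<integral>\<omega>. exp (- a * (J t \<omega> - J 0 \<omega>)) \<partial>M) * (\<integral>\<omega>. exp (- a * (J (t + h) \<omega> - J t \<omega>)) \<partial>M)"
  proof (rule indep_var_lebesgue_integral[OF ind])
    show "integrable M (\<lambda>\<omega>. exp (- a * (J t \<omega> - J 0 \<omega>)))"
      using assms by (intro integrable_const_bound[where B = 1]) (auto intro!: AE_I2 simp: J_mono)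
    show "integrable M (\<lambda>\<omega>. exp (- a * (J (t + h) \<omega> - J t \<omega>)))"
      using assms by (intro integrable_const_bound[where B = 1]) (auto intro!: AE_I2 simp: J_mono)
  qed
  also have "(\<integral>\<omega>. exp (- a * (J t \<omega> - J 0 \<omega>)) \<partial>M) = (\<integral>\<omega>. exp (- a * J t \<omega>) \<partial>M)"
    by (intro Bochner_Integration.integral_cong refl) (simp add: J_0)
  finally show ?thesis unfolding expJ_increment[OF assms(1,2)] .
qed

text \<open>The Levy--Khintchine representation is assumed through a total \<open>ln\<close>;
  positivity is what allows it to be inverted.\<close>

lemma expJ_pos: "0 \<le> t \<Longrightarrow> 0 \<le> a \<Longrightarrow> 0 < (\<integral>\<omega>. exp (- a * J t \<omega>) \<partial>M)"
proof -
  assume "0 \<le> t" "0 \<le> a"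
  then have int: "integrable M (\<lambda>\<omega>. exp (- a * J t \<omega>))" by (rule integrable_expJ)
  have "(\<integral>\<omega>. exp (- a * J t \<omega>) \<partial>M) \<noteq> 0"
    using AE_False by (subst integral_nonneg_eq_0_iff_AE[OF int]) auto
  moreover have "0 \<le> (\<integral>\<omega>. exp (- a * J t \<omega>) \<partial>M)" by simp
  ultimately show ?thesis by linarith
qed

text \<open>Only the law of \<open>J 1\<close> is prescribed. Stationary independent increments make
  minus the logarithm additive in time, monotone paths make it monotone, and hence it is
  linear.\<close>

lemma laplace_J:
  assumes t: "0 \<le> t" and a: "0 \<le> a"
  shows "(\<integral>\<omega>. exp (- a * J t \<omega>) \<partial>M) = exp (- (t * eta a))"
proof -
  define f where "f t = - ln (\<integral>\<omega>. exp (- a * J t \<omega>) \<partial>M)" for t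
  have "f t = t * f 1"
  proof (rule additive_mono_imp_linear[OF _ _ t])
    fix r s :: real assume "0 \<le> r" "0 \<le> s"
    then show "f (r + s) = f r + f s"
      using a unfolding f_def by (subst expJ_add) (simp_all only: ln_mult_pos[OF expJ_pos expJ_pos] minus_add_distrib)
  next
    fix r s :: real assume "0 \<le> r" "r \<le> s"
    then have "(\<integral>\<omega>. exp (- a * J s \<omega>) \<partial>M) \<le> (\<integral>\<omega>. exp (- a * J r \<omega>) \<partial>M)"
      using a by (intro integral_mono integrable_expJ) (auto intro!: mult_left_mono J_mono)
    then show "f r \<le> f s"
      using \<open>0 \<le> r\<close> \<open>r \<le> s\<close> a expJ_pos[of s a] by (simp add: f_def)
  qed
  also have "f 1 = eta a" unfolding f_def J_laplace1[OF a] by simp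
  finally have "ln (\<integral>\<omega>. exp (- a * J t \<omega>) \<partial>M) = - (t * eta a)" by (simp add: f_def)
  with expJ_pos[OF t a] show ?thesis by (metis exp_ln)
qed

text \<open>The mean is read off the Laplace transform, as the limit of E (1 - exp (- a J)) / a for
  a tending to 0.\<close>

lemma nn_integral_J:
  assumes t: "0 \<le> t"
  shows "(\<integral>\<^sup>+\<omega>. ennreal (J t \<omega>) \<partial>M) = ennreal (t * mu)"
proof -
  have eq: "(\<integral>\<^sup>+\<omega>. ennreal ((1 - exp (- a * J t \<omega>)) / a) \<partial>M) = ennreal ((1 - exp (- (t * eta a))) / a)"
    if a: "a > 0" for a
  proof -
    have "(\<integral>\<^sup>+\<omega>. ennreal ((1 - exp (- a * J t \<omega>)) / a) \<partial>M) = ennreal (\<integral>\<omega>. (1 - exp (- a * J t \<omega>)) / a \<partial>M)"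
      using a t by (intro nn_integral_eq_integral integrable_divide Bochner_Integration.integrable_diff integrable_expJ)
        (auto intro!: AE_I2 divide_nonneg_nonneg simp: J_nonneg)
    also have "(\<integral>\<omega>. (1 - exp (- a * J t \<omega>)) / a \<partial>M) = (1 - exp (- (t * eta a))) / a"
      using a t laplace_J[of t a] integrable_expJ[of t a] prob_space by simp
    finally show ?thesis .
  qed
  have "((\<lambda>a. \<integral>\<^sup>+\<omega>. ennreal ((1 - exp (- a * J t \<omega>)) / a) \<partial>M) \<longlongrightarrow> (\<integral>\<^sup>+\<omega>. ennreal (J t \<omega>) \<partial>M)) (at_right 0)"
    using t by (intro nn_integral_exp_minus_limit1) (auto simp: J_nonneg)
  then have "((\<lambda>a. ennreal ((1 - exp (- (t * eta a))) / a)) \<longlongrightarrow> (\<integral>\<^sup>+\<omega>. ennreal (J t \<omega>) \<partial>M)) (at_right 0)"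
    by (rule Lim_transform_eventually) (rule eventually_mono[OF eventually_at_right_less eq])
  moreover have "((\<lambda>a. (1 - exp (- (t * eta a))) / a) \<longlongrightarrow> t * mu) (at_right 0)"
    using tendsto_mult_left[OF eta_limit, of t] t eta_nonneg by (intro one_minus_exp_limit) auto
  then have "((\<lambda>a. ennreal ((1 - exp (- (t * eta a))) / a)) \<longlongrightarrow> ennreal (t * mu)) (at_right 0)"
    by (rule tendsto_ennrealI)
  ultimately show ?thesis by (rule tendsto_unique[rotated]) simp
qed

lemma
  assumes t: "0 \<le> t"
  shows integrable_J: "integrable M (J t)" and expectation_J: "(\<integral>\<omega>. J t \<omega> \<partial>M) = t * mu"
proof -
  show "integrable M (J t)"
    using nn_integral_J[OF t] t by (intro integrableI_nonneg) (auto simp: J_nonneg)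
  then show "(\<integral>\<omega>. J t \<omega> \<partial>M) = t * mu"
    using nn_integral_J[OF t] t mu_nonneg by (intro integral_eq_nn_integral[THEN trans]) (auto simp: J_nonneg)
qed

text \<open>A second moment of \<open>J\<close> need not exist. The bounded variable exp (- J t / t)
  has one, and both terms of its square error are Laplace transforms, at rates 2/t and 1/t.\<close>

lemma weak_law: "((\<lambda>t. \<integral>\<omega>. (exp (- (1 / t) * J t \<omega>) - exp (- mu))\<^sup>2 \<partial>M) \<longlongrightarrow> 0) at_top"
proof -
  have lim: "((\<lambda>t. t * eta (c / t)) \<longlongrightarrow> c * mu) at_top" if "c > 0" for c
  proof -
    have "filterlim (\<lambda>t. c / t) (at_right 0) at_top"
      using that by (auto simp: filterlim_at intro!: tendsto_divide_0[OF tendsto_const] filterlim_at_top_imp_at_infinity filterlim_ident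
        intro: eventually_mono[OF eventually_gt_at_top[of 0]])
    from tendsto_mult_left[OF filterlim_compose[OF eta_limit this], of c]
    show ?thesis
      by (rule Lim_transform_eventually) (use that in \<open>auto intro!: eventually_mono[OF eventually_gt_at_top[of 0]]\<close>)
  qed
  have eq: "(\<integral>\<omega>. (exp (- (1 / t) * J t \<omega>) - exp (- mu))\<^sup>2 \<partial>M) =
     exp (- (t * eta (2 / t))) - 2 * exp (- mu) * exp (- (t * eta (1 / t))) + exp (- 2 * mu)" if t: "t > 0" for t
  proof -
    have "(\<integral>\<omega>. (exp (- (1 / t) * J t \<omega>) - exp (- mu))\<^sup>2 \<partial>M) =
      (\<integral>\<omega>. exp (- (2 / t) * J t \<omega>) - 2 * exp (- mu) * exp (- (1 / t) * J t \<omega>) + exp (- 2 * mu) \<partial>M)"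
    proof (intro Bochner_Integration.integral_cong refl)
      fix \<omega>
      have "exp (- (2 / t) * J t \<omega>) = (exp (- (1 / t) * J t \<omega>))\<^sup>2" "exp (- 2 * mu) = (exp (- mu))\<^sup>2"
        by (simp_all flip: exp_double)
      then show "(exp (- (1 / t) * J t \<omega>) - exp (- mu))\<^sup>2 =
        exp (- (2 / t) * J t \<omega>) - 2 * exp (- mu) * exp (- (1 / t) * J t \<omega>) + exp (- 2 * mu)"
        by (simp only: power2_diff) (simp add: algebra_simps)
    qed
    also have "\<dots> = (\<integral>\<omega>. exp (- (2 / t) * J t \<omega>) \<partial>M) - 2 * exp (- mu) * (\<integral>\<omega>. exp (- (1 / t) * J t \<omega>) \<partial>M) + exp (- 2 * mu)"
      using t integrable_expJ[of t "2 / t"] integrable_expJ[of t "1 / t"] prob_space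
      by (subst Bochner_Integration.integral_add, simp, simp, subst Bochner_Integration.integral_diff) auto
    finally show ?thesis using t laplace_J[of t "2 / t"] laplace_J[of t "1 / t"] by simp
  qed
  have "((\<lambda>t. exp (- (t * eta (2 / t))) - 2 * exp (- mu) * exp (- (t * eta (1 / t))) + exp (- 2 * mu)) \<longlongrightarrow>
     exp (- (2 * mu)) - 2 * exp (- mu) * exp (- (1 * mu)) + exp (- 2 * mu)) at_top"
    by (intro tendsto_intros lim) auto
  also have "exp (- (2 * mu)) - 2 * exp (- mu) * exp (- (1 * mu)) + exp (- 2 * mu) = 0"
    by (simp flip: exp_add)
  finally show ?thesis
    by (rule Lim_transform_eventually) (use eq in \<open>auto intro!: eventually_mono[OF eventually_gt_at_top[of 0]]\<close>)
qed

lemma prob_J_ge: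
  "((\<lambda>t. prob {\<omega> \<in> space M. t - v < J t \<omega>}) \<longlongrightarrow> 0) at_top"
proof (rule tendsto_sandwich[OF _ _ tendsto_const])
  \<comment> \<open>The threshold (1 + mu) / 2 lies halfway between the mean rate \<open>mu\<close>
    and the outflow rate 1; \<open>\<delta>\<close> is the distance between the exponentials at
    \<open>mu\<close> and at the threshold.\<close>
  define \<delta> where "\<delta> = exp (- mu) - exp (- ((1 + mu) / 2))"
  have \<delta>: "\<delta> > 0" using d1_pos by (simp add: \<delta>_def d1_def)
  \<comment> \<open>Beyond \<open>c\<close>, \<open>v\<close> is less than t d1 / 2, so t - v
    exceeds t (1 + mu) / 2.\<close>
  define c where "c = max 1 (2 * v / d1)"
  show "((\<lambda>t. (\<integral>\<omega>. (exp (- (1 / t) * J t \<omega>) - exp (- mu))\<^sup>2 \<partial>M) / \<delta>\<^sup>2) \<longlongrightarrow> 0) at_top"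
    using tendsto_divide[OF weak_law tendsto_const[of "\<delta>\<^sup>2"]] \<delta> by simp
  show "\<forall>\<^sub>F t in at_top. prob {\<omega> \<in> space M. t - v < J t \<omega>} \<le>
     (\<integral>\<omega>. (exp (- (1 / t) * J t \<omega>) - exp (- mu))\<^sup>2 \<partial>M) / \<delta>\<^sup>2"
  proof (rule eventually_mono[OF eventually_gt_at_top[of c]])
    fix t assume t: "c < t"
    then have t0: "t > 0" and tv: "2 * v / d1 < t" by (auto simp: c_def)
    let ?f = "\<lambda>\<omega>. (exp (- (1 / t) * J t \<omega>) - exp (- mu))\<^sup>2"
    have int: "integrable M ?f"
    proof (rule integrable_const_bound[where B = 1])
      show "AE \<omega> in M. norm (?f \<omega>) \<le> 1"
      proof (rule AE_I2)
        fix \<omega> assume "\<omega> \<in> space M"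
        then have "exp (- (1 / t) * J t \<omega>) \<le> 1" using t0 by (simp add: J_nonneg)
        moreover have "0 < exp (- (1 / t) * J t \<omega>)" "exp (- mu) \<le> 1" "0 < exp (- mu)" using mu_nonneg by auto
        ultimately have "\<bar>exp (- (1 / t) * J t \<omega>) - exp (- mu)\<bar> \<le> 1" by linarith
        then show "norm (?f \<omega>) \<le> 1" by (simp add: abs_square_le_1)
      qed
    qed (use t0 in simp)
    have "prob {\<omega> \<in> space M. t - v < J t \<omega>} \<le> prob {\<omega> \<in> space M. \<delta>\<^sup>2 \<le> ?f \<omega>}"
    proof (rule finite_measure_mono)
      show "{\<omega> \<in> space M. t - v < J t \<omega>} \<subseteq> {\<omega> \<in> space M. \<delta>\<^sup>2 \<le> ?f \<omega>}"
      proof safe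
        fix \<omega> assume \<omega>: "\<omega> \<in> space M" "t - v < J t \<omega>"
        have "2 * v < t * d1" using tv d1_pos by (simp add: field_simps)
        then have "(1 + mu) / 2 * t \<le> J t \<omega>" using \<omega>(2) unfolding d1_def by (simp add: field_simps)
        then have "(1 + mu) / 2 \<le> (1 / t) * J t \<omega>" using t0 by (simp add: field_simps)
        then have "exp (- (1 / t) * J t \<omega>) \<le> exp (- ((1 + mu) / 2))" by simp
        then have "\<delta> \<le> exp (- mu) - exp (- (1 / t) * J t \<omega>)" by (simp add: \<delta>_def)
        then have "\<delta>\<^sup>2 \<le> (exp (- mu) - exp (- (1 / t) * J t \<omega>))\<^sup>2" using \<delta> by (intro power_mono) auto
        then show "\<delta>\<^sup>2 \<le> ?f \<omega>" by (simp add: power2_commute)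
      qed
    qed (use t0 in simp)
    also have "\<dots> \<le> (\<integral>\<omega>. ?f \<omega> \<partial>M) / \<delta>\<^sup>2"
      using \<delta> by (intro integral_Markov_inequality_measure[OF int, of "{}"]) auto
    finally show "prob {\<omega> \<in> space M. t - v < J t \<omega>} \<le> (\<integral>\<omega>. ?f \<omega> \<partial>M) / \<delta>\<^sup>2" .
  qed
qed simp

end

section \<open>The workload path\<close>

text \<open>The time is replaced by a grid point (floor + 1) / (n + 1), which takes countably many
  values and lies to the right of it within 1 / (n + 1). The cut \<open>max 0 t\<close> makes the
  map total, since paths are controlled only for nonnegative times.\<close>

lemma right_continuous_joint_measurable:
  fixes f :: "real \<Rightarrow> 'a \<Rightarrow> real"
  assumes meas: "\<And>t. 0 \<le> t \<Longrightarrow> f t \<in> borel_measurable N"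
    and rc: "\<And>t \<omega> x. \<omega> \<in> space N \<Longrightarrow> 0 \<le> t \<Longrightarrow> x \<longlonglongrightarrow> t \<Longrightarrow> (\<And>n. t \<le> x n) \<Longrightarrow> (\<lambda>n. f (x n) \<omega>) \<longlonglongrightarrow> f t \<omega>"
  shows "(\<lambda>(t, \<omega>). f (max 0 t) \<omega>) \<in> borel_measurable (borel \<Otimes>\<^sub>M N)"
proof (rule borel_measurable_LIMSEQ_real)
  define x where "x n t = (real (nat \<lfloor>real (Suc n) * max 0 t\<rfloor>) + 1) / real (Suc n)" for n and t :: real
  show "(\<lambda>p. case p of (t, \<omega>) \<Rightarrow> f (x n t) \<omega>) \<in> borel_measurable (borel \<Otimes>\<^sub>M N)" for n
  proof -
    have "(\<lambda>p. (\<lambda>i p. f ((real i + 1) / real (Suc n)) (snd p)) (nat \<lfloor>real (Suc n) * max 0 (fst p)\<rfloor>) p)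
       \<in> borel_measurable (borel \<Otimes>\<^sub>M N)"
      by (rule measurable_compose_countable) (auto intro!: measurable_compose[OF measurable_snd meas])
    then show ?thesis by (simp add: x_def case_prod_beta')
  qed
  fix p :: "real \<times> 'a" assume "p \<in> space (borel \<Otimes>\<^sub>M N)"
  then obtain t \<omega> where p: "p = (t, \<omega>)" "\<omega> \<in> space N" by (auto simp: space_pair_measure)
  have x: "max 0 t \<le> x n t" "x n t \<le> max 0 t + 1 / real (Suc n)" for n
  proof -
    define m where "m = max 0 t"
    have "0 \<le> real (Suc n) * m" by (simp add: m_def)
    then have "real (Suc n) * m \<le> real (nat \<lfloor>real (Suc n) * m\<rfloor>) + 1"
      "real (nat \<lfloor>real (Suc n) * m\<rfloor>) \<le> real (Suc n) * m" by linarith+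
    then show "max 0 t \<le> x n t" "x n t \<le> max 0 t + 1 / real (Suc n)"
      unfolding x_def m_def[symmetric] by (simp_all add: field_simps del: of_nat_Suc)
  qed
  have "(\<lambda>n. max 0 t + 1 / real (Suc n)) \<longlonglongrightarrow> max 0 t + 0"
    by (intro tendsto_intros LIMSEQ_Suc[OF lim_const_over_n])
  then have up: "(\<lambda>n. max 0 t + 1 / real (Suc n)) \<longlonglongrightarrow> max 0 t" by (simp only: add_0_right)
  have "(\<lambda>n. x n t) \<longlonglongrightarrow> max 0 t"
    by (rule tendsto_sandwich[OF always_eventually always_eventually tendsto_const up]) (rule allI, rule x)+
  then have "(\<lambda>n. f (x n t) \<omega>) \<longlonglongrightarrow> f (max 0 t) \<omega>"
    using x p by (intro rc) auto
  then show "(\<lambda>n. case p of (t, \<omega>) \<Rightarrow> f (x n t) \<omega>) \<longlonglongrightarrow> (case p of (t, \<omega>) \<Rightarrow> f (max 0 t) \<omega>)"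
    by (simp add: p)
qed

context levy_storage
begin

abbreviation L :: "real \<Rightarrow> 'a \<Rightarrow> real" where
  "L \<equiv> running_loss (net_input J)"

text \<open>The workload from a deterministic real start, so that all estimates are free of the
  random and extended-real \<open>V0\<close>, which returns only when conditioning.\<close>

definition W :: "real \<Rightarrow> real \<Rightarrow> 'a \<Rightarrow> real" where
  "W v t \<omega> = J t \<omega> - t + max v (L t \<omega>)"

lemma L_ge: "\<omega> \<in> space M \<Longrightarrow> 0 \<le> s \<Longrightarrow> s \<le> t \<Longrightarrow> s - J s \<omega> \<le> L t \<omega>"
proof -
  assume \<omega>: "\<omega> \<in> space M" and s: "0 \<le> s" "s \<le> t"
  have "bdd_below ((\<lambda>s. net_input J s \<omega>) ` {0..t})"
  proof (rule bdd_belowI2[of _ "- t"])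
    fix x assume "x \<in> {0..t}"
    then show "- t \<le> net_input J x \<omega>" using J_nonneg[OF \<omega>, of x] by (simp add: net_input_def)
  qed
  then have "(INF s\<in>{0..t}. net_input J s \<omega>) \<le> net_input J s \<omega>"
    using s by (intro cINF_lower) auto
  then show ?thesis by (simp add: running_loss_def net_input_def)
qed

lemma L_le: "0 \<le> t \<Longrightarrow> (\<And>s. 0 \<le> s \<Longrightarrow> s \<le> t \<Longrightarrow> s - J s \<omega> \<le> c) \<Longrightarrow> L t \<omega> \<le> c"
proof -
  assume t: "0 \<le> t" and c: "\<And>s. 0 \<le> s \<Longrightarrow> s \<le> t \<Longrightarrow> s - J s \<omega> \<le> c"
  have "- c \<le> (INF s\<in>{0..t}. net_input J s \<omega>)"
    using t by (intro cINF_greatest) (auto simp: net_input_def dest: c)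
  then show ?thesis by (simp add: running_loss_def)
qed

lemma L_nonneg: "\<omega> \<in> space M \<Longrightarrow> 0 \<le> t \<Longrightarrow> 0 \<le> L t \<omega>"
  using L_ge[of \<omega> 0 t] J_0[of \<omega>] by simp

lemma L_upper: "\<omega> \<in> space M \<Longrightarrow> 0 \<le> t \<Longrightarrow> L t \<omega> \<le> t"
proof (rule L_le)
  fix s assume "\<omega> \<in> space M" "0 \<le> s" "s \<le> t"
  then show "s - J s \<omega> \<le> t" using J_nonneg[of \<omega> s] by simp
qed

lemma L_mono: "\<omega> \<in> space M \<Longrightarrow> 0 \<le> s \<Longrightarrow> s \<le> t \<Longrightarrow> L s \<omega> \<le> L t \<omega>"
  by (intro L_le L_ge) auto

text \<open>\<open>J\<close> is monotone, so for s between t and t + h the value s - J s is at most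
  t + h - J t.\<close>

lemma L_step:
  assumes \<omega>: "\<omega> \<in> space M" and "0 \<le> t" "0 \<le> h"
  shows "L (t + h) \<omega> \<le> max (L t \<omega>) (t + h - J t \<omega>)"
proof (rule L_le)
  fix s assume s: "0 \<le> s" "s \<le> t + h"
  show "s - J s \<omega> \<le> max (L t \<omega>) (t + h - J t \<omega>)"
  proof (cases "s \<le> t")
    case True
    then show ?thesis using L_ge[OF \<omega> s(1)] by (simp add: le_max_iff_disj)
  next
    case False
    then have "J t \<omega> \<le> J s \<omega>" using assms by (intro J_mono) auto
    then show ?thesis using s by (simp add: le_max_iff_disj)
  qed
qed (use assms in simp)

lemma L_0: "\<omega> \<in> space M \<Longrightarrow> L 0 \<omega> = 0"
  using L_nonneg[of \<omega> 0] L_upper[of \<omega> 0] by simp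

lemma W_0: "\<omega> \<in> space M \<Longrightarrow> 0 \<le> v \<Longrightarrow> W v 0 \<omega> = v"
  by (simp add: W_def L_0 J_0)

lemma W_nonneg: "\<omega> \<in> space M \<Longrightarrow> 0 \<le> t \<Longrightarrow> 0 \<le> W v t \<omega>"
  using L_ge[of \<omega> t t] by (simp add: W_def)

lemma W_upper: "\<omega> \<in> space M \<Longrightarrow> 0 \<le> t \<Longrightarrow> 0 \<le> v \<Longrightarrow> W v t \<omega> \<le> v + J t \<omega>"
  using L_upper[of \<omega> t] by (simp add: W_def)

text \<open>\<open>R\<close> is the push of the barrier. Over a step the net input falls by at most
  h, so the barrier is felt only from a workload below h, and pushes by no more than the missing
  amount.\<close>

lemma W_step:
  fixes v :: real
  assumes \<omega>: "\<omega> \<in> space M" and "0 \<le> t" "0 \<le> h"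
  defines "R \<equiv> W v (t + h) \<omega> - (W v t \<omega> + (J (t + h) \<omega> - J t \<omega> - h))"
  shows "0 \<le> R" "R \<le> max 0 (h - W v t \<omega>)"
proof -
  have R: "R = max v (L (t + h) \<omega>) - max v (L t \<omega>)" by (simp add: R_def W_def)
  show "0 \<le> R" unfolding R using L_mono[OF \<omega>, of t "t + h"] assms by simp
  show "R \<le> max 0 (h - W v t \<omega>)"
    unfolding R using L_step[OF assms(1-3)] by (auto simp: W_def max_def split: if_splits)
qed

lemma W_step_abs:
  assumes "\<omega> \<in> space M" "0 \<le> t" "0 \<le> h"
  shows "\<bar>W v (t + h) \<omega> - W v t \<omega>\<bar> \<le> (J (t + h) \<omega> - J t \<omega>) + h"
  using W_step[OF assms, of v] W_nonneg[OF assms(1,2), of v] J_mono[of \<omega> t "t + h"] assms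
  by (auto simp: abs_le_iff)

lemma W_coupled: "u \<le> L t \<omega> \<Longrightarrow> v \<le> L t \<omega> \<Longrightarrow> W u t \<omega> = W v t \<omega>"
  by (simp add: W_def)

text \<open>Once the loss reaches \<open>v\<close>, the start \<open>v\<close> gives the lowest
  possible workload; before that it costs at most \<open>v\<close>. This one-sided comparison is
  what carries unbounded functionals, where equality after coupling does not suffice.\<close>

lemma W_diff_le: "\<omega> \<in> space M \<Longrightarrow> 0 \<le> t \<Longrightarrow> 0 \<le> v \<Longrightarrow>
   W v t \<omega> \<le> W u t \<omega> + (if L t \<omega> < v then v else 0)"
  using L_nonneg[of \<omega> t] by (auto simp: W_def)

text \<open>A maximum over a uniform grid that contains both end points: measurable at once, and a
  function of finitely many increments of \<open>J\<close>. Dividing by \<open>Suc n\<close> avoids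
  an empty grid.\<close>

definition L_grid :: "nat \<Rightarrow> real \<Rightarrow> 'a \<Rightarrow> real" where
  "L_grid n t \<omega> = Max ((\<lambda>i. t * real i / real (Suc n) - J (t * real i / real (Suc n)) \<omega>) ` {..Suc n})"

lemma L_grid_le: "\<omega> \<in> space M \<Longrightarrow> 0 \<le> t \<Longrightarrow> L_grid n t \<omega> \<le> L t \<omega>"
  unfolding L_grid_def
proof (intro Max.boundedI; clarsimp)
  fix i assume \<omega>: "\<omega> \<in> space M" and "0 \<le> t" "i \<le> Suc n"
  then have "t * real i \<le> t * (1 + real n)" by (intro mult_left_mono) auto
  then show "t * real i / (1 + real n) - J (t * real i / (1 + real n)) \<omega> \<le> L t \<omega>"
    using \<open>0 \<le> t\<close> by (intro L_ge[OF \<omega>]) (auto simp: field_simps)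
qed

lemma L_grid_ge: "t - J t \<omega> \<le> L_grid n t \<omega>"
proof -
  have "(\<lambda>i. t * real i / real (Suc n) - J (t * real i / real (Suc n)) \<omega>) (Suc n) \<le> L_grid n t \<omega>"
    unfolding L_grid_def by (rule Max_ge[OF finite_imageI[OF finite_atMost]], rule imageI) simp
  then show ?thesis by simp
qed

lemma J_seq_right:
  assumes \<omega>: "\<omega> \<in> space M" and s: "0 \<le> s" and x: "x \<longlonglongrightarrow> s" "\<And>n. s \<le> x n"
  shows "(\<lambda>n. J (x n) \<omega>) \<longlonglongrightarrow> J s \<omega>"
proof (rule tendstoI)
  fix e :: real assume "0 < e"
  have "\<forall>\<^sub>F y in at_right s. dist (J y \<omega>) (J s \<omega>) < e"
    using J_right_cont[OF \<omega> s] \<open>0 < e\<close> by (rule tendstoD)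
  then have "\<forall>\<^sub>F y in nhds s. s \<le> y \<longrightarrow> dist (J y \<omega>) (J s \<omega>) < e"
    unfolding eventually_at_filter by eventually_elim (use \<open>0 < e\<close> in force)
  from eventually_compose_filterlim[OF this x(1)]
  show "\<forall>\<^sub>F n in sequentially. dist (J (x n) \<omega>) (J s \<omega>) < e"
    using x(2) by (auto elim: eventually_mono)
qed

text \<open>A nearly optimal time s is rounded up to the grid. Rounding up matters, because
  \<open>J\<close> is continuous only from the right.\<close>

lemma L_grid_tendsto:
  assumes \<omega>: "\<omega> \<in> space M" and t: "0 \<le> t"
  shows "(\<lambda>n. L_grid n t \<omega>) \<longlonglongrightarrow> L t \<omega>"
proof (rule order_tendstoI)
  fix c assume "L t \<omega> < c"
  then show "\<forall>\<^sub>F n in sequentially. L_grid n t \<omega> < c"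
    using L_grid_le[OF \<omega> t] by (intro always_eventually) (auto intro: le_less_trans)
next
  fix c assume c: "c < L t \<omega>"
  then obtain s where s: "0 \<le> s" "s \<le> t" "c < s - J s \<omega>"
    using L_le[OF t, of \<omega> c] by (meson not_le)
  \<comment> \<open>For \<open>t = 0\<close> the division by zero yields \<open>k n = 0\<close>,
    which is the right grid point, since then s = 0.\<close>
  define k where "k n = nat \<lceil>s * real (Suc n) / t\<rceil>" for n
  define x where "x n = t * real (k n) / real (Suc n)" for n
  have k: "real (k n) < s * real (Suc n) / t + 1" "s * real (Suc n) / t \<le> real (k n)" "k n \<le> Suc n" if "t > 0" for n
  proof -
    have nn: "0 \<le> s * real (Suc n) / t" using s that by simp
    show "real (k n) < s * real (Suc n) / t + 1" "s * real (Suc n) / t \<le> real (k n)"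
      unfolding k_def using nn by linarith+
    have "s * real (Suc n) / t \<le> real (Suc n)" using s that by (simp add: divide_le_eq mult.commute[of _ t] mult_right_mono del: of_nat_Suc)
    then show "k n \<le> Suc n" unfolding k_def using nn by linarith
  qed
  have x: "s \<le> x n" "x n \<le> s + t / real (Suc n)" "k n \<le> Suc n" for n
  proof -
    consider "t = 0" | "t > 0" using t by fastforce
    then have "s \<le> x n \<and> x n \<le> s + t / real (Suc n) \<and> k n \<le> Suc n"
    proof cases
      case 1
      then show ?thesis using s by (simp add: x_def k_def)
    next
      case 2
      then show ?thesis using k[OF 2, of n] by (simp add: x_def field_simps del: of_nat_Suc)
    qed
    then show "s \<le> x n" "x n \<le> s + t / real (Suc n)" "k n \<le> Suc n" by auto
  qed
  have "(\<lambda>n. s + t / real (Suc n)) \<longlonglongrightarrow> s + 0"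
    by (intro tendsto_intros LIMSEQ_Suc[OF lim_const_over_n])
  then have up: "(\<lambda>n. s + t / real (Suc n)) \<longlonglongrightarrow> s" by (simp only: add_0_right)
  have xs: "x \<longlonglongrightarrow> s"
    by (rule tendsto_sandwich[OF always_eventually always_eventually tendsto_const up]) (rule allI, rule x)+
  have "(\<lambda>n. x n - J (x n) \<omega>) \<longlonglongrightarrow> s - J s \<omega>"
    using s x by (intro tendsto_intros xs J_seq_right[OF \<omega>]) auto
  from order_tendstoD(1)[OF this s(3)]
  show "\<forall>\<^sub>F n in sequentially. c < L_grid n t \<omega>"
  proof eventually_elim
    case (elim n)
    have "(\<lambda>i. t * real i / real (Suc n) - J (t * real i / real (Suc n)) \<omega>) (k n) \<le> L_grid n t \<omega>"
      unfolding L_grid_def by (intro Max_ge) (use x(3) in auto)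
    then show ?case using elim by (simp add: x_def)
  qed
qed

text \<open>Measurability is shown for an arbitrary sigma-algebra that makes \<open>J\<close> measurable, because the
  independence assumption needs it for the one generated by \<open>J\<close>.\<close>

context
  fixes N :: "'a measure"
  assumes spaceN: "space N = space M" and J_measN: "\<And>t. 0 \<le> t \<Longrightarrow> J t \<in> borel_measurable N"
begin

lemma L_measN: "0 \<le> t \<Longrightarrow> L t \<in> borel_measurable N"
proof (rule borel_measurable_LIMSEQ_real)
  assume t: "0 \<le> t"
  show "(\<lambda>n. L_grid n t \<omega>) \<longlonglongrightarrow> L t \<omega>" if "\<omega> \<in> space N" for \<omega>
    using L_grid_tendsto t that by (simp add: spaceN)
  show "L_grid n t \<in> borel_measurable N" for n
    unfolding L_grid_def[abs_def] using t
    by (intro borel_measurable_Max borel_measurable_diff J_measN) auto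
qed

lemma J_meas_joint: "(\<lambda>(t, \<omega>). J (max 0 t) \<omega>) \<in> borel_measurable (borel \<Otimes>\<^sub>M N)"
  by (rule right_continuous_joint_measurable) (auto intro: J_measN J_seq_right simp: spaceN)

text \<open>From t to x the maximum of s - J s grows by at most x - t, which gives right continuity
  of \<open>L\<close>.\<close>

lemma L_meas_joint: "(\<lambda>(t, \<omega>). L (max 0 t) \<omega>) \<in> borel_measurable (borel \<Otimes>\<^sub>M N)"
proof (rule right_continuous_joint_measurable[OF L_measN])
  fix t :: real and \<omega> x assume \<omega>: "\<omega> \<in> space N" and t: "0 \<le> t" and x: "x \<longlonglongrightarrow> t" "\<And>n. t \<le> x n"
  have L: "L t \<omega> \<le> L (x n) \<omega>" "L (x n) \<omega> \<le> L t \<omega> + (x n - t)" for n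
  proof -
    show "L t \<omega> \<le> L (x n) \<omega>" using \<omega> t x by (intro L_mono) (auto simp: spaceN)
    show "L (x n) \<omega> \<le> L t \<omega> + (x n - t)"
      using L_step[of \<omega> t "x n - t"] L_ge[of \<omega> t t] \<omega> t x(2)[of n] by (auto simp: spaceN)
  qed
  have "(\<lambda>n. L t \<omega> + (x n - t)) \<longlonglongrightarrow> L t \<omega> + (t - t)" by (intro tendsto_intros x)
  then have up: "(\<lambda>n. L t \<omega> + (x n - t)) \<longlonglongrightarrow> L t \<omega>" by simp
  show "(\<lambda>n. L (x n) \<omega>) \<longlonglongrightarrow> L t \<omega>"
    by (rule tendsto_sandwich[OF always_eventually always_eventually tendsto_const up]) (rule allI, rule L)+
qed

lemma W_meas_joint:
  "(\<lambda>(v, t, \<omega>). W v (max 0 t) \<omega>) \<in> borel_measurable (borel \<Otimes>\<^sub>M (borel \<Otimes>\<^sub>M N))"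
proof -
  have [measurable]: "(\<lambda>p. J (max 0 (fst p)) (snd p)) \<in> borel_measurable (borel \<Otimes>\<^sub>M N)"
    "(\<lambda>p. L (max 0 (fst p)) (snd p)) \<in> borel_measurable (borel \<Otimes>\<^sub>M N)"
    using J_meas_joint L_meas_joint by (simp_all add: case_prod_beta')
  have "(\<lambda>p. J (max 0 (fst (snd p))) (snd (snd p)) - max 0 (fst (snd p)) +
      max (fst p) (L (max 0 (fst (snd p))) (snd (snd p)))) \<in> borel_measurable (borel \<Otimes>\<^sub>M (borel \<Otimes>\<^sub>M N))"
    by (intro borel_measurable_add borel_measurable_diff borel_measurable_max)
      (auto intro: measurable_compose[OF measurable_snd, where g = "\<lambda>p. J (max 0 (fst p)) (snd p)"]
        measurable_compose[OF measurable_snd, where g = "\<lambda>p. L (max 0 (fst p)) (snd p)"])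
  then show ?thesis by (simp add: W_def[abs_def] case_prod_beta')
qed

end

lemmas L_meas [measurable] = L_measN[OF refl J_meas]
lemmas W_meas_M = W_meas_joint[OF refl J_meas]

lemma W_meas [measurable]: "0 \<le> t \<Longrightarrow> W v t \<in> borel_measurable M"
  unfolding W_def[abs_def] by measurable

text \<open>\<open>L t\<close> is at least t - J t, and J t / t concentrates at mu < 1. This is
  where stability drives the coupling.\<close>

lemma prob_L_less: "((\<lambda>t. prob {\<omega> \<in> space M. L t \<omega> < v}) \<longlongrightarrow> 0) at_top"
proof (rule tendsto_sandwich[OF _ _ tendsto_const prob_J_ge[of v]])
  show "\<forall>\<^sub>F t in at_top. prob {\<omega> \<in> space M. L t \<omega> < v} \<le> prob {\<omega> \<in> space M. t - v < J t \<omega>}"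
  proof (rule eventually_mono[OF eventually_ge_at_top[of 0]])
    fix t :: real assume t: "0 \<le> t"
    show "prob {\<omega> \<in> space M. L t \<omega> < v} \<le> prob {\<omega> \<in> space M. t - v < J t \<omega>}"
    proof (rule finite_measure_mono)
      show "{\<omega> \<in> space M. L t \<omega> < v} \<subseteq> {\<omega> \<in> space M. t - v < J t \<omega>}"
        using L_ge[OF _ t order_refl] by fastforce
    qed (use t in simp)
  qed
qed simp

text \<open>The workload at t depends on the whole path, whereas independence is given along a
  sequence of times. The factorization is shown with \<open>L_grid\<close> in place of
  \<open>L\<close> and carried over by bounded convergence.\<close>

lemma W_increment_uncorrelated:
  assumes v: "0 \<le> v" and t: "0 \<le> t" and h: "0 \<le> h" and a: "0 \<le> a"
  shows "(\<integral>\<omega>. exp (- a * W v t \<omega>) * exp (- a * (J (t + h) \<omega> - J t \<omega>)) \<partial>M) =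
         (\<integral>\<omega>. exp (- a * W v t \<omega>) \<partial>M) * exp (- (h * eta a))"
proof -
  define Wn where "Wn n \<omega> = J t \<omega> - t + max v (L_grid n t \<omega>)" for n \<omega>
  have Wn_meas[measurable]: "Wn n \<in> borel_measurable M" for n
    unfolding Wn_def[abs_def] L_grid_def[abs_def] using t
    by (intro borel_measurable_add borel_measurable_diff borel_measurable_max borel_measurable_Max) auto
  have Wn_nonneg: "0 \<le> Wn n \<omega>" for n \<omega>
    using L_grid_ge[of t \<omega> n] by (simp add: Wn_def)
  have lim: "(\<lambda>n. Wn n \<omega>) \<longlonglongrightarrow> W v t \<omega>" if "\<omega> \<in> space M" for \<omega>
    unfolding Wn_def W_def by (intro tendsto_intros L_grid_tendsto that t)
  have eq: "(\<integral>\<omega>. exp (- a * Wn n \<omega>) * exp (- a * (J (t + h) \<omega> - J t \<omega>)) \<partial>M) =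
         (\<integral>\<omega>. exp (- a * Wn n \<omega>) \<partial>M) * exp (- (h * eta a))" for n
  proof -
    \<comment> \<open>The grid of [0, t], followed by a jump to t + h: the increment with index
      \<open>Suc n\<close> is then the one after t, and all later ones vanish.\<close>
    define \<tau> where "\<tau> i = (if i \<le> Suc n then t * real i / real (Suc n) else t + h)" for i
    have \<tau>0: "0 \<le> \<tau> 0" by (simp add: \<tau>_def)
    have le: "t * real i / real (Suc n) \<le> t" if "i \<le> Suc n" for i
    proof -
      have "t * real i \<le> t * real (Suc n)" using that t by (intro mult_left_mono) auto
      then show ?thesis by (simp add: field_simps)
    qed
    have mono: "mono \<tau>"
    proof (rule monoI)
      fix i j :: nat assume "i \<le> j"
      then show "\<tau> i \<le> \<tau> j"
        using t h le[of i] by (auto simp: \<tau>_def intro!: divide_right_mono mult_left_mono)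
    qed
    \<comment> \<open>The functional of the increments \<open>d\<close> that rebuilds the grid
      workload: since J 0 = 0, the partial sums of \<open>d\<close> are the values of
      \<open>J\<close> at the grid points.\<close>
    define \<Psi> where "\<Psi> d = exp (- a * ((\<Sum>j<Suc n. d j) - t +
        max v (Max ((\<lambda>i. t * real i / real (Suc n) - (\<Sum>j<i. d j)) ` {..Suc n}))))" for d :: "nat \<Rightarrow> real"
    have "\<Psi> \<in> borel_measurable (PiM {..<Suc n} (\<lambda>_. borel))"
      unfolding \<Psi>_def[abs_def]
      by (intro borel_measurable_exp[THEN measurable_compose_rev] borel_measurable_times borel_measurable_const
          borel_measurable_add borel_measurable_diff borel_measurable_max borel_measurable_Max borel_measurable_sum
          measurable_component_singleton) auto
    from indep_increment[OF \<tau>0 mono this]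
    have ind: "indep_var borel (\<lambda>\<omega>. \<Psi> (\<lambda>i\<in>{..<Suc n}. J (\<tau> (Suc i)) \<omega> - J (\<tau> i) \<omega>))
       borel (\<lambda>\<omega>. J (t + h) \<omega> - J t \<omega>)" by (simp add: \<tau>_def)
    have \<Psi>_eq: "\<Psi> (\<lambda>i\<in>{..<Suc n}. J (\<tau> (Suc i)) \<omega> - J (\<tau> i) \<omega>) = exp (- a * Wn n \<omega>)"
      if \<omega>: "\<omega> \<in> space M" for \<omega>
    proof -
      have sum: "(\<Sum>j<i. (\<lambda>i\<in>{..<Suc n}. J (\<tau> (Suc i)) \<omega> - J (\<tau> i) \<omega>) j) = J (t * real i / real (Suc n)) \<omega>"
        if "i \<le> Suc n" for i
      proof -
        have "(\<Sum>j<i. (\<lambda>i\<in>{..<Suc n}. J (\<tau> (Suc i)) \<omega> - J (\<tau> i) \<omega>) j) = (\<Sum>j<i. J (\<tau> (Suc j)) \<omega> - J (\<tau> j) \<omega>)"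
          using that by (intro sum.cong) auto
        also have "\<dots> = J (\<tau> i) \<omega> - J (\<tau> 0) \<omega>" by (rule sum_lessThan_telescope)
        also have "\<dots> = J (t * real i / real (Suc n)) \<omega>" using that \<omega> by (simp add: \<tau>_def J_0)
        finally show ?thesis .
      qed
      have img: "(\<lambda>i. t * real i / real (Suc n) - (\<Sum>j<i. (\<lambda>i\<in>{..<Suc n}. J (\<tau> (Suc i)) \<omega> - J (\<tau> i) \<omega>) j)) ` {..Suc n}
         = (\<lambda>i. t * real i / real (Suc n) - J (t * real i / real (Suc n)) \<omega>) ` {..Suc n}"
        by (intro image_cong refl) (simp only: sum atMost_iff)
      show ?thesis
        unfolding \<Psi>_def img Wn_def L_grid_def by (subst sum) auto
    qed
    have [measurable]: "(\<lambda>\<omega>. J (t + h) \<omega> - J t \<omega>) \<in> borel_measurable M" using t h by simp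
    have ind': "indep_var borel (\<lambda>\<omega>. \<Psi> (\<lambda>i\<in>{..<Suc n}. J (\<tau> (Suc i)) \<omega> - J (\<tau> i) \<omega>))
       borel (\<lambda>\<omega>. exp (- a * (J (t + h) \<omega> - J t \<omega>)))"
      using indep_var_compose[OF ind, of "\<lambda>x. x" borel "\<lambda>x. exp (- a * x)" borel] by (simp add: comp_def)
    have int: "integrable M (\<lambda>\<omega>. exp (- a * Wn n \<omega>))"
      using a Wn_nonneg by (intro integrable_const_bound[where B = 1]) auto
    have "(\<integral>\<omega>. exp (- a * Wn n \<omega>) * exp (- a * (J (t + h) \<omega> - J t \<omega>)) \<partial>M) =
      (\<integral>\<omega>. \<Psi> (\<lambda>i\<in>{..<Suc n}. J (\<tau> (Suc i)) \<omega> - J (\<tau> i) \<omega>) * exp (- a * (J (t + h) \<omega> - J t \<omega>)) \<partial>M)"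
      by (intro Bochner_Integration.integral_cong refl) (simp only: \<Psi>_eq)
    also have "\<dots> = (\<integral>\<omega>. \<Psi> (\<lambda>i\<in>{..<Suc n}. J (\<tau> (Suc i)) \<omega> - J (\<tau> i) \<omega>) \<partial>M) * (\<integral>\<omega>. exp (- a * (J (t + h) \<omega> - J t \<omega>)) \<partial>M)"
    proof (rule indep_var_lebesgue_integral[OF ind'])
      show "integrable M (\<lambda>\<omega>. \<Psi> (\<lambda>i\<in>{..<Suc n}. J (\<tau> (Suc i)) \<omega> - J (\<tau> i) \<omega>))"
        using int by (rule Bochner_Integration.integrable_cong[OF refl, THEN iffD1, rotated]) (simp only: \<Psi>_eq)
      show "integrable M (\<lambda>\<omega>. exp (- a * (J (t + h) \<omega> - J t \<omega>)))"
        using a t h by (intro integrable_const_bound[where B = 1]) (auto intro!: AE_I2 mult_nonneg_nonneg simp: J_mono)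
    qed
    also have "(\<integral>\<omega>. \<Psi> (\<lambda>i\<in>{..<Suc n}. J (\<tau> (Suc i)) \<omega> - J (\<tau> i) \<omega>) \<partial>M) = (\<integral>\<omega>. exp (- a * Wn n \<omega>) \<partial>M)"
      by (intro Bochner_Integration.integral_cong refl) (simp only: \<Psi>_eq)
    finally show ?thesis using expJ_increment[OF t h, of a] laplace_J[OF h a] by simp
  qed
  have "(\<lambda>n. \<integral>\<omega>. exp (- a * Wn n \<omega>) * exp (- a * (J (t + h) \<omega> - J t \<omega>)) \<partial>M) \<longlonglongrightarrow>
     (\<integral>\<omega>. exp (- a * W v t \<omega>) * exp (- a * (J (t + h) \<omega> - J t \<omega>)) \<partial>M)"
    using t h a Wn_nonneg
    by (intro integral_dominated_convergence[where w = "\<lambda>_. 1"])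
       (auto intro!: AE_I2 tendsto_intros lim mult_nonneg_nonneg mult_le_one simp: J_mono)
  moreover have "(\<lambda>n. \<integral>\<omega>. exp (- a * Wn n \<omega>) \<partial>M) \<longlonglongrightarrow> (\<integral>\<omega>. exp (- a * W v t \<omega>) \<partial>M)"
    using t h a Wn_nonneg
    by (intro integral_dominated_convergence[where w = "\<lambda>_. 1"])
       (auto intro!: AE_I2 tendsto_intros lim)
  then have "(\<lambda>n. (\<integral>\<omega>. exp (- a * Wn n \<omega>) \<partial>M) * exp (- (h * eta a))) \<longlonglongrightarrow>
     (\<integral>\<omega>. exp (- a * W v t \<omega>) \<partial>M) * exp (- (h * eta a))" by (intro tendsto_intros)
  ultimately show ?thesis unfolding eq by (rule LIMSEQ_unique)
qed

end

section \<open>Drift of the expected workload functional\<close>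

lemma abs_one_minus_exp_le:
  fixes z c :: real
  assumes "- c \<le> z" "0 \<le> c"
  shows "\<bar>1 - exp (- z)\<bar> \<le> \<bar>z\<bar> * exp c"
proof (cases "0 \<le> z")
  case True
  have "z * 1 \<le> z * exp c" using True assms by (intro mult_left_mono) auto
  then show ?thesis using True exp_minus_taylor1[OF True] by simp
next
  case False
  have "exp (- z) - 1 = exp (- z) * (1 - exp z)" by (simp add: algebra_simps flip: exp_add)
  also have "\<dots> \<le> exp c * (- z)"
    using False assms exp_minus_ge1[of "- z"] by (intro mult_mono) auto
  finally show ?thesis using False by (simp add: mult.commute)
qed

lemma abs_exp_minus_one_minus_le:
  fixes z c :: real
  assumes "0 \<le> z" "z \<le> c"
  shows "\<bar>exp z - 1 - z\<bar> \<le> z\<^sup>2 * exp c"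
proof -
  have "exp z - 1 = exp z * (1 - exp (- z))" by (simp add: algebra_simps flip: exp_add)
  also have "\<dots> \<le> exp c * z"
    using assms exp_minus_taylor1[of z] by (intro mult_mono) auto
  finally have 1: "exp z - 1 \<le> exp c * z" .
  have "0 \<le> exp z - 1 - z" using exp_minus_ge1[of "- z"] by simp
  moreover have "exp z - 1 - z = exp z * (1 - exp (- z) - z * exp (- z))" by (simp add: algebra_simps flip: exp_add)
  moreover have "exp z * (1 - exp (- z) - z * exp (- z)) \<le> exp c * (z * z)"
  proof (rule mult_mono)
    have "1 - exp (- z) - z * exp (- z) \<le> z - z * exp (- z)" using exp_minus_taylor1[OF assms(1)] by simp
    also have "\<dots> = z * (1 - exp (- z))" by (simp add: algebra_simps)
    also have "\<dots> \<le> z * z" using exp_minus_taylor1[OF assms(1)] assms by (intro mult_left_mono) auto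
    finally show "1 - exp (- z) - z * exp (- z) \<le> z * z" .
    have "exp z * exp (- z) \<ge> (1 + z) * exp (- z)" by (intro mult_right_mono) auto
    then show "0 \<le> 1 - exp (- z) - z * exp (- z)" by (simp add: algebra_simps flip: exp_add)
  qed (use assms in auto)
  ultimately show ?thesis unfolding power2_eq_square by (simp only: abs_of_nonneg mult.commute)
qed

text \<open>Only forward steps are controlled. The left derivative at t comes from stepping forward
  from y < t to t; this involves \<open>K y\<close>, which the Lipschitz bound replaces by
  \<open>K t\<close>.\<close>

lemma has_real_derivative_if_quadratic_error:
  fixes G K :: "real \<Rightarrow> real"
  assumes step: "\<And>t h. 0 \<le> t \<Longrightarrow> 0 \<le> h \<Longrightarrow> h \<le> 1 \<Longrightarrow> \<bar>G (t + h) - G t - h * K t\<bar> \<le> C * h\<^sup>2"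
    and lip: "\<And>t h. 0 \<le> t \<Longrightarrow> 0 \<le> h \<Longrightarrow> \<bar>K (t + h) - K t\<bar> \<le> D * h"
    and t: "0 < t"
  shows "(G has_real_derivative K t) (at t)"
proof -
  have bound: "\<bar>(G y - G t) / (y - t) - K t\<bar> \<le> (\<bar>C\<bar> + \<bar>D\<bar>) * \<bar>y - t\<bar>"
    if y: "y \<noteq> t" "0 < y" "\<bar>y - t\<bar> \<le> 1" for y
  proof -
    have "\<bar>G y - G t - (y - t) * K t\<bar> \<le> (\<bar>C\<bar> + \<bar>D\<bar>) * (y - t)\<^sup>2"
    proof (cases "t \<le> y")
      case True
      have "\<bar>G y - G t - (y - t) * K t\<bar> \<le> C * (y - t)\<^sup>2" using step[of t "y - t"] True t y by simp
      also have "\<dots> \<le> (\<bar>C\<bar> + \<bar>D\<bar>) * (y - t)\<^sup>2" by (intro mult_right_mono) auto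
      finally show ?thesis .
    next
      case False
      have 1: "\<bar>G t - G y - (t - y) * K y\<bar> \<le> C * (t - y)\<^sup>2" using step[of y "t - y"] False y by simp
      have "\<bar>K t - K y\<bar> \<le> D * (t - y)" using lip[of y "t - y"] False y by simp
      then have "(t - y) * \<bar>K t - K y\<bar> \<le> (t - y) * (D * (t - y))" using False by (intro mult_left_mono) auto
      then have 2: "\<bar>(t - y) * (K t - K y)\<bar> \<le> D * (t - y)\<^sup>2"
        using False by (simp add: abs_mult power2_eq_square mult_ac)
      have "G y - G t - (y - t) * K t = - (G t - G y - (t - y) * K y) + (t - y) * (K t - K y)"
        by (simp add: algebra_simps)
      then have "\<bar>G y - G t - (y - t) * K t\<bar> \<le> C * (t - y)\<^sup>2 + D * (t - y)\<^sup>2" using 1 2 by linarith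
      also have "\<dots> \<le> (\<bar>C\<bar> + \<bar>D\<bar>) * (y - t)\<^sup>2"
        by (simp add: power2_commute[of t] distrib_right add_mono mult_right_mono)
      finally show ?thesis .
    qed
    then have "\<bar>G y - G t - (y - t) * K t\<bar> / \<bar>y - t\<bar> \<le> ((\<bar>C\<bar> + \<bar>D\<bar>) * (y - t)\<^sup>2) / \<bar>y - t\<bar>"
      by (intro divide_right_mono) auto
    also have "\<bar>G y - G t - (y - t) * K t\<bar> / \<bar>y - t\<bar> = \<bar>(G y - G t) / (y - t) - K t\<bar>"
      using y by (simp flip: abs_divide add: diff_divide_distrib)
    also have "((\<bar>C\<bar> + \<bar>D\<bar>) * (y - t)\<^sup>2) / \<bar>y - t\<bar> = (\<bar>C\<bar> + \<bar>D\<bar>) * \<bar>y - t\<bar>"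
    proof -
      have "(\<bar>C\<bar> + \<bar>D\<bar>) * (y - t)\<^sup>2 / \<bar>y - t\<bar> = (\<bar>C\<bar> + \<bar>D\<bar>) * (\<bar>y - t\<bar> * \<bar>y - t\<bar>) / \<bar>y - t\<bar>"
        by (simp only: abs_mult_self_eq power2_eq_square)
      then show ?thesis using y by (simp del: abs_mult_self_eq)
    qed
    finally show ?thesis .
  qed
  have ev: "\<forall>\<^sub>F y in at t. \<bar>(G y - G t) / (y - t) - K t\<bar> \<le> (\<bar>C\<bar> + \<bar>D\<bar>) * \<bar>y - t\<bar>"
    unfolding eventually_at using t bound
    by (intro exI[of _ "min 1 t"]) (auto simp: dist_real_def abs_less_iff)
  have "((\<lambda>y. (\<bar>C\<bar> + \<bar>D\<bar>) * \<bar>y - t\<bar>) \<longlongrightarrow> (\<bar>C\<bar> + \<bar>D\<bar>) * \<bar>t - t\<bar>) (at t)"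
    by (intro tendsto_intros)
  then have "((\<lambda>y. (\<bar>C\<bar> + \<bar>D\<bar>) * \<bar>y - t\<bar>) \<longlongrightarrow> 0) (at t)" by simp
  from Lim_null_comparison[OF _ this, of "\<lambda>y. (G y - G t) / (y - t) - K t"] ev
  have "((\<lambda>y. (G y - G t) / (y - t) - K t) \<longlongrightarrow> 0) (at t)" by simp
  then show ?thesis by (simp add: has_field_derivative_iff LIM_zero_iff)
qed

context levy_storage
begin

lemma expectation_increment:
  "0 \<le> t \<Longrightarrow> 0 \<le> h \<Longrightarrow> integrable M (\<lambda>\<omega>. J (t + h) \<omega> - J t \<omega>)"
  "0 \<le> t \<Longrightarrow> 0 \<le> h \<Longrightarrow> (\<integral>\<omega>. J (t + h) \<omega> - J t \<omega> \<partial>M) = h * mu"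
  by (simp_all add: integrable_J expectation_J algebra_simps)

lemma integrable_W: "0 \<le> t \<Longrightarrow> 0 \<le> v \<Longrightarrow> integrable M (W v t)"
proof (rule Bochner_Integration.integrable_bound[of M "\<lambda>\<omega>. v + J t \<omega>"])
  assume "0 \<le> t" "0 \<le> v"
  then show "AE \<omega> in M. norm (W v t \<omega>) \<le> norm (v + J t \<omega>)"
    using W_nonneg W_upper by (intro AE_I2) (fastforce intro: order_trans[OF _ abs_ge_self])
qed (auto intro: integrable_J)

lemma integrable_exp_W: "0 \<le> t \<Longrightarrow> 0 \<le> a \<Longrightarrow> integrable M (\<lambda>\<omega>. exp (- a * W v t \<omega>))"
  by (rule integrable_const_bound[where B = 1]) (auto intro!: AE_I2 simp: W_nonneg)

definition F :: "real \<Rightarrow> real \<Rightarrow> real \<Rightarrow> real" where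
  "F v a t = (\<integral>\<omega>. exp (- a * W v t \<omega>) \<partial>M)"

text \<open>The derivative of \<open>x \<mapsto> exp (-a x) + a x\<close> vanishes at the reflecting barrier \<open>0\<close>; this is why
  the drift of its expectation has no boundary term.\<close>

definition G :: "real \<Rightarrow> real \<Rightarrow> real \<Rightarrow> real" where
  "G v a t = (\<integral>\<omega>. exp (- a * W v t \<omega>) + a * W v t \<omega> \<partial>M)"

lemma F_bounds: "0 \<le> t \<Longrightarrow> 0 \<le> a \<Longrightarrow> 0 \<le> F v a t" "0 \<le> t \<Longrightarrow> 0 \<le> a \<Longrightarrow> F v a t \<le> 1"
proof -
  assume t: "0 \<le> t" "0 \<le> a"
  show "0 \<le> F v a t" by (simp add: F_def)
  have "F v a t \<le> (\<integral>\<omega>. 1 \<partial>M)"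
    unfolding F_def using t by (intro integral_mono integrable_exp_W) (auto simp: W_nonneg)
  then show "F v a t \<le> 1" using prob_space by simp
qed

text \<open>\<open>Y\<close> is the step without the barrier. If the barrier acts, \<open>Y\<close>
  lies within the new input plus h of 0, where the derivative of exp (-a x) + a x is of that order,
  and the push is at most h. The product has expectation of order h^2.\<close>

lemma reflection_error:
  fixes v :: real
  assumes \<omega>: "\<omega> \<in> space M" and t: "0 \<le> t" and h: "0 \<le> h" "h \<le> 1" and a: "0 < a"
  defines "Y \<equiv> W v t \<omega> + (J (t + h) \<omega> - J t \<omega> - h)"
  shows "\<bar>(exp (- a * W v (t + h) \<omega>) + a * W v (t + h) \<omega>) - (exp (- a * Y) + a * Y)\<bar>
     \<le> a\<^sup>2 * exp a * (2 * h\<^sup>2 + h * (J (t + h) \<omega> - J t \<omega>))"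
proof -
  define R where "R = W v (t + h) \<omega> - Y"
  define I where "I = J (t + h) \<omega> - J t \<omega>"
  have I: "0 \<le> I" using J_mono[OF \<omega> t, of "t + h"] h by (simp add: I_def)
  have R: "0 \<le> R" "R \<le> max 0 (h - W v t \<omega>)"
    using W_step[OF \<omega> t h(1), of v] by (simp_all add: R_def Y_def)
  have W0: "0 \<le> W v t \<omega>" by (rule W_nonneg[OF \<omega> t])
  have rhs: "0 \<le> a\<^sup>2 * exp a * (2 * h\<^sup>2 + h * I)" using I h a by simp
  show ?thesis
  proof (cases "R = 0")
    case True
    then show ?thesis using rhs by (simp add: R_def I_def)
  next
    case False
    then have Wh: "W v t \<omega> < h" and Rh: "R \<le> h" using R W0 by (auto simp: max_def split: if_splits)
    have Y: "- h \<le> Y" "\<bar>Y\<bar> \<le> h + I" using W0 Wh I h by (auto simp: Y_def I_def)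
    have aY: "- a \<le> a * Y" using Y(1) h a mult_left_mono[of "-1" Y a] by simp
    have e1: "\<bar>1 - exp (- (a * Y))\<bar> \<le> a * (h + I) * exp a"
    proof -
      have "\<bar>1 - exp (- (a * Y))\<bar> \<le> \<bar>a * Y\<bar> * exp a" using aY a by (intro abs_one_minus_exp_le) auto
      also have "\<dots> \<le> a * (h + I) * exp a" using Y(2) a by (intro mult_right_mono) (auto simp: abs_mult)
      finally show ?thesis .
    qed
    have aR: "0 \<le> a * R" "a * R \<le> a * h" using a R Rh by auto
    have e2: "exp (- (a * R)) - 1 + a * R \<le> a\<^sup>2 * h\<^sup>2"
    proof -
      have "exp (- (a * R)) - 1 + a * R \<le> (a * R)\<^sup>2 / 2" by (rule exp_minus_taylor2[OF aR(1)])
      also have "\<dots> \<le> (a * h)\<^sup>2" using power_mono[OF aR(2,1), of 2] zero_le_power2[of "a * R"] by linarith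
      finally show ?thesis by (simp add: power_mult_distrib)
    qed
    \<comment> \<open>Exact expansion at \<open>Y\<close>: the first term is the derivative at
      \<open>Y\<close> times the push \<open>R\<close>, the second the Taylor remainder in
      \<open>R\<close>.\<close>
    have eq: "(exp (- a * (Y + R)) + a * (Y + R)) - (exp (- a * Y) + a * Y)
       = a * R * (1 - exp (- (a * Y))) + exp (- (a * Y)) * (exp (- (a * R)) - 1 + a * R)"
      by (simp add: algebra_simps flip: exp_add)
    have "\<bar>a * R * (1 - exp (- (a * Y)))\<bar> \<le> (a * h) * (a * (h + I) * exp a)"
      unfolding abs_mult[of "a * R"] using aR e1 a h by (intro mult_mono) auto
    moreover have "\<bar>exp (- (a * Y)) * (exp (- (a * R)) - 1 + a * R)\<bar> \<le> exp a * (a\<^sup>2 * h\<^sup>2)"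
      unfolding abs_mult using e2 exp_minus_ge1[of "a * R"] aY by (intro mult_mono) auto
    moreover have "(a * h) * (a * (h + I) * exp a) + exp a * (a\<^sup>2 * h\<^sup>2) = a\<^sup>2 * exp a * (2 * h\<^sup>2 + h * I)"
      by (simp add: algebra_simps power2_eq_square)
    ultimately have "\<bar>(exp (- a * (Y + R)) + a * (Y + R)) - (exp (- a * Y) + a * Y)\<bar>
       \<le> a\<^sup>2 * exp a * (2 * h\<^sup>2 + h * I)"
      unfolding eq by linarith
    then show ?thesis by (simp add: R_def I_def)
  qed
qed

text \<open>The first summand bounds the reflection error: 2 h^2 + h (h mu) <= 3 h^2 because mu < 1.
  The second bounds exp (h phi a) - 1 - h phi a for h <= 1. The initial workload does not enter,
  which allows integration over \<pi>.\<close>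

definition step_const :: "real \<Rightarrow> real" where
  "step_const a = 3 * a\<^sup>2 * exp a + (phi a)\<^sup>2 * exp (phi a)"

lemma G_step:
  assumes v: "0 \<le> v" and t: "0 \<le> t" and h: "0 \<le> h" "h \<le> 1" and a: "0 < a"
  shows "\<bar>G v a (t + h) - G v a t - h * (phi a * F v a t - a * d1)\<bar> \<le> step_const a * h\<^sup>2"
proof -
  define I where "I \<omega> = J (t + h) \<omega> - J t \<omega>" for \<omega>
  define Y where "Y \<omega> = W v t \<omega> + (I \<omega> - h)" for \<omega>
  have intI: "integrable M I" and EI: "(\<integral>\<omega>. I \<omega> \<partial>M) = h * mu"
    using expectation_increment[OF t h(1)] by (simp_all add: I_def[abs_def])
  have Iexp: "integrable M (\<lambda>\<omega>. exp (- a * W v t \<omega>) * exp (- a * I \<omega>))"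
    using t h a unfolding I_def
    by (intro integrable_const_bound[where B = 1])
       (auto intro!: AE_I2 mult_le_one mult_nonneg_nonneg simp: W_nonneg J_mono)
  have gY: "exp (- a * Y \<omega>) + a * Y \<omega> = exp (- a * W v t \<omega>) * exp (- a * I \<omega>) * exp (a * h) + a * W v t \<omega> + a * I \<omega> - a * h" for \<omega>
    by (simp add: Y_def algebra_simps flip: exp_add)
  have intY: "integrable M (\<lambda>\<omega>. exp (- a * Y \<omega>) + a * Y \<omega>)"
    unfolding gY using Iexp intI integrable_W[OF t v] by auto
  have "(\<integral>\<omega>. exp (- a * Y \<omega>) + a * Y \<omega> \<partial>M)
     = (\<integral>\<omega>. exp (- a * W v t \<omega>) * exp (- a * I \<omega>) \<partial>M) * exp (a * h) + a * (\<integral>\<omega>. W v t \<omega> \<partial>M) + a * (\<integral>\<omega>. I \<omega> \<partial>M) - a * h"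
    unfolding gY using Iexp intI integrable_W[OF t v] prob_space by simp
  also have "(\<integral>\<omega>. exp (- a * W v t \<omega>) * exp (- a * I \<omega>) \<partial>M) = F v a t * exp (- (h * eta a))"
    unfolding I_def F_def using W_increment_uncorrelated[OF v t h(1), of a] a by simp
  \<comment> \<open>The unit outflow contributes exp (a h) and the jumps exp (- h eta a); together
    they give exp (h phi a).\<close>
  also have "F v a t * exp (- (h * eta a)) * exp (a * h) = F v a t * exp (h * phi a)"
    by (simp add: phi_def algebra_simps flip: exp_add)
  finally have EY: "(\<integral>\<omega>. exp (- a * Y \<omega>) + a * Y \<omega> \<partial>M) =
      F v a t * exp (h * phi a) + a * (\<integral>\<omega>. W v t \<omega> \<partial>M) - a * h * d1"
    by (simp add: EI d1_def algebra_simps)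
  have G: "G v a t = F v a t + a * (\<integral>\<omega>. W v t \<omega> \<partial>M)"
    unfolding G_def F_def using integrable_W[OF t v] integrable_exp_W[OF t, of a v] a by simp
  have intG: "integrable M (\<lambda>\<omega>. exp (- a * W v (t + h) \<omega>) + a * W v (t + h) \<omega>)"
    using integrable_W[of "t + h" v] integrable_exp_W[of "t + h" a v] a t h v by simp
  have "\<bar>G v a (t + h) - (\<integral>\<omega>. exp (- a * Y \<omega>) + a * Y \<omega> \<partial>M)\<bar>
     = \<bar>\<integral>\<omega>. (exp (- a * W v (t + h) \<omega>) + a * W v (t + h) \<omega>) - (exp (- a * Y \<omega>) + a * Y \<omega>) \<partial>M\<bar>"
    unfolding G_def using Bochner_Integration.integral_diff[OF intG intY] by simp
  also have "\<dots> \<le> (\<integral>\<omega>. a\<^sup>2 * exp a * (2 * h\<^sup>2 + h * I \<omega>) \<partial>M)"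
  proof (rule order_trans[OF integral_abs_bound integral_mono])
    show "\<bar>(exp (- a * W v (t + h) \<omega>) + a * W v (t + h) \<omega>) - (exp (- a * Y \<omega>) + a * Y \<omega>)\<bar>
       \<le> a\<^sup>2 * exp a * (2 * h\<^sup>2 + h * I \<omega>)" if "\<omega> \<in> space M" for \<omega>
      unfolding Y_def I_def using reflection_error[OF that t h a] by simp
  qed (use intG intY intI in auto)
  also have "\<dots> = a\<^sup>2 * exp a * (2 * h\<^sup>2 + h * (h * mu))"
    using intI prob_space by (simp add: EI)
  also have "\<dots> \<le> a\<^sup>2 * exp a * (3 * h\<^sup>2)"
  proof (intro mult_left_mono)
    have "h * (h * mu) \<le> h * (h * 1)" using h d1_pos by (intro mult_left_mono) (auto simp: d1_def)
    then show "2 * h\<^sup>2 + h * (h * mu) \<le> 3 * h\<^sup>2" by (simp add: power2_eq_square)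
  qed simp
  finally have 1: "\<bar>G v a (t + h) - (\<integral>\<omega>. exp (- a * Y \<omega>) + a * Y \<omega> \<partial>M)\<bar> \<le> a\<^sup>2 * exp a * (3 * h\<^sup>2)" .
  have "\<bar>exp (h * phi a) - 1 - h * phi a\<bar> \<le> (h * phi a)\<^sup>2 * exp (phi a)"
    using h phi_pos[OF a] by (intro abs_exp_minus_one_minus_le) (auto simp: mult_left_le_one_le)
  then have "F v a t * \<bar>exp (h * phi a) - 1 - h * phi a\<bar> \<le> 1 * ((h * phi a)\<^sup>2 * exp (phi a))"
    using F_bounds[OF t, of a v] a by (intro mult_mono) auto
  then have 2: "\<bar>F v a t * (exp (h * phi a) - 1 - h * phi a)\<bar> \<le> (h * phi a)\<^sup>2 * exp (phi a)"
    using F_bounds[OF t, of a v] a by (simp add: abs_mult)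
  have eq: "(\<integral>\<omega>. exp (- a * Y \<omega>) + a * Y \<omega> \<partial>M) - G v a t - h * (phi a * F v a t - a * d1)
     = F v a t * (exp (h * phi a) - 1 - h * phi a)"
    unfolding EY G by (simp add: algebra_simps)
  have "\<bar>G v a (t + h) - G v a t - h * (phi a * F v a t - a * d1)\<bar>
     \<le> a\<^sup>2 * exp a * (3 * h\<^sup>2) + (h * phi a)\<^sup>2 * exp (phi a)"
    using 1 2 eq by linarith
  also have "\<dots> = step_const a * h\<^sup>2" by (simp add: step_const_def algebra_simps power_mult_distrib)
  finally show ?thesis .
qed

text \<open>A step moves the workload by at most the new input plus h, and the new input has mean h
  mu <= h; hence the factor 2.\<close>

lemma F_lipschitz:
  assumes v: "0 \<le> v" and t: "0 \<le> t" and h: "0 \<le> h" and a: "0 \<le> a"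
  shows "\<bar>F v a (t + h) - F v a t\<bar> \<le> 2 * a * h"
proof -
  have "\<bar>F v a (t + h) - F v a t\<bar> = \<bar>\<integral>\<omega>. exp (- a * W v (t + h) \<omega>) - exp (- a * W v t \<omega>) \<partial>M\<bar>"
    unfolding F_def using t h a by (subst Bochner_Integration.integral_diff) (auto intro: integrable_exp_W[simplified])
  also have "\<dots> \<le> (\<integral>\<omega>. a * ((J (t + h) \<omega> - J t \<omega>) + h) \<partial>M)"
  proof (rule order_trans[OF integral_abs_bound integral_mono])
    show "integrable M (\<lambda>\<omega>. \<bar>exp (- a * W v (t + h) \<omega>) - exp (- a * W v t \<omega>)\<bar>)"
      using t h a by (intro integrable_abs Bochner_Integration.integrable_diff integrable_exp_W) auto
    show "integrable M (\<lambda>\<omega>. a * ((J (t + h) \<omega> - J t \<omega>) + h))"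
      using expectation_increment(1)[OF t h] by auto
    fix \<omega> assume \<omega>: "\<omega> \<in> space M"
    have "\<bar>exp (- W v (t + h) \<omega> * a) - exp (- W v t \<omega> * a)\<bar> \<le> \<bar>W v (t + h) \<omega> - W v t \<omega>\<bar> * (a * exp (- 0 * a))"
      using W_nonneg[OF \<omega>] t h a by (intro abs_exp_minus_diff_le) auto
    also have "\<dots> \<le> ((J (t + h) \<omega> - J t \<omega>) + h) * (a * exp (- 0 * a))"
      using W_step_abs[OF \<omega> t h] a by (intro mult_right_mono) auto
    finally show "\<bar>exp (- a * W v (t + h) \<omega>) - exp (- a * W v t \<omega>)\<bar> \<le> a * ((J (t + h) \<omega> - J t \<omega>) + h)"
      by (simp add: mult.commute)
  qed
  also have "\<dots> = a * (h * mu + h)"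
    using expectation_increment[OF t h] prob_space by simp
  also have "\<dots> \<le> a * (h * 1 + h)"
    using a h d1_pos by (intro mult_left_mono add_right_mono) (auto simp: d1_def)
  finally show ?thesis by simp
qed

lemma DERIV_G:
  assumes v: "0 \<le> v" and a: "0 < a" and t: "0 < t"
  shows "(G v a has_real_derivative phi a * F v a t - a * d1) (at t)"
proof (rule has_real_derivative_if_quadratic_error[where C = "step_const a" and D = "phi a * (2 * a)"])
  show "\<bar>G v a (t + h) - G v a t - h * (phi a * F v a t - a * d1)\<bar> \<le> step_const a * h\<^sup>2"
    if "0 \<le> t" "0 \<le> h" "h \<le> 1" for t h by (rule G_step[OF v that a])
  show "\<bar>phi a * F v a (t + h) - a * d1 - (phi a * F v a t - a * d1)\<bar> \<le> phi a * (2 * a) * h"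
    if "0 \<le> t" "0 \<le> h" for t h
  proof -
    have "phi a * \<bar>F v a (t + h) - F v a t\<bar> \<le> phi a * (2 * a * h)"
      using F_lipschitz[OF v that, of a] a phi_pos[OF a] by (intro mult_left_mono) auto
    moreover have "\<bar>phi a * F v a (t + h) - a * d1 - (phi a * F v a t - a * d1)\<bar> = phi a * \<bar>F v a (t + h) - F v a t\<bar>"
      using phi_pos[OF a] by (simp add: abs_mult flip: right_diff_distrib)
    ultimately show ?thesis by (simp add: mult_ac)
  qed
qed (rule t)

text \<open>This is the boundary term at time 0 of the integration by parts. The derivative is known
  only for t > 0, so continuity at 0 is taken from a single step out of time 0.\<close>

lemma G_0_right: 
  assumes v: "0 \<le> v" and a: "0 < a"
  shows "(G v a \<longlongrightarrow> exp (- a * v) + a * v) (at_right 0)"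
proof -
  have G0: "G v a 0 = exp (- a * v) + a * v"
    unfolding G_def using prob_space
    by (subst Bochner_Integration.integral_cong[OF refl, of _ _ "\<lambda>_. exp (- a * v) + a * v"]) (auto simp: W_0 v)
  define K where "K = phi a * F v a 0 - a * d1"
  have "((\<lambda>h. G v a h - G v a 0) \<longlongrightarrow> 0) (at_right 0)"
  proof (rule Lim_null_comparison)
    show "((\<lambda>h. step_const a * h\<^sup>2 + h * \<bar>K\<bar>) \<longlongrightarrow> 0) (at_right 0)"
      by (rule tendsto_eq_intros | simp)+
    show "\<forall>\<^sub>F h in at_right 0. norm (G v a h - G v a 0) \<le> step_const a * h\<^sup>2 + h * \<bar>K\<bar>"
    proof (rule eventually_mono[OF eventually_conj[OF eventually_at_right_less eventually_at_right_real[of 0 1]]])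
      fix h :: real assume h: "0 < h \<and> h \<in> {0<..<1}"
      then have "\<bar>G v a (0 + h) - G v a 0 - h * K\<bar> \<le> step_const a * h\<^sup>2"
        unfolding K_def by (intro G_step v a) auto
      moreover have "\<bar>h * K\<bar> = h * \<bar>K\<bar>" using h by (simp add: abs_mult)
      ultimately show "norm (G v a h - G v a 0) \<le> step_const a * h\<^sup>2 + h * \<bar>K\<bar>" by simp
    qed simp
  qed
  then show ?thesis by (simp add: G0 LIM_zero_iff)
qed

lemma G_bounds:
  assumes v: "0 \<le> v" and a: "0 < a" and t: "0 \<le> t"
  shows "0 \<le> G v a t" "G v a t \<le> (1 + a * v) + a * t"
proof -
  show "0 \<le> G v a t" unfolding G_def using a t by (intro integral_nonneg_AE AE_I2) (auto simp: W_nonneg)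
  have "G v a t \<le> (\<integral>\<omega>. 1 + a * (v + J t \<omega>) \<partial>M)"
    unfolding G_def
  proof (rule integral_mono)
    show "integrable M (\<lambda>\<omega>. exp (- a * W v t \<omega>) + a * W v t \<omega>)"
      using integrable_W[OF t v] integrable_exp_W[OF t, of a v] a by simp
    show "integrable M (\<lambda>\<omega>. 1 + a * (v + J t \<omega>))" using integrable_J[OF t] by simp
    show "exp (- a * W v t \<omega>) + a * W v t \<omega> \<le> 1 + a * (v + J t \<omega>)" if "\<omega> \<in> space M" for \<omega>
      using W_nonneg[OF that t] W_upper[OF that t v] a by (intro add_mono mult_left_mono) auto
  qed
  also have "\<dots> = 1 + a * (v + t * mu)" using integrable_J[OF t] expectation_J[OF t] prob_space by simp
  also have "\<dots> \<le> 1 + a * (v + t * 1)"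
    using a t d1_pos by (intro add_left_mono mult_left_mono) (auto simp: d1_def)
  finally show "G v a t \<le> (1 + a * v) + a * t" by (simp add: algebra_simps)
qed

end

section \<open>Integration by parts against Erlang densities\<close>

lemma erlang_limit_infinity:
  fixes A B \<xi> :: real
  assumes "0 < \<xi>"
  shows "((\<lambda>t. (A + B * t) * (\<xi> ^ Suc n * t ^ n * exp (- \<xi> * t) / fact n)) \<longlongrightarrow> 0) at_top"
proof -
  have *: "((\<lambda>t. t ^ k * exp (- \<xi> * t)) \<longlongrightarrow> 0) at_top" for k
  proof -
    have "((\<lambda>t. (\<xi> * t) ^ k / exp (\<xi> * t)) \<longlongrightarrow> 0) at_top"
      using assms by (intro filterlim_compose[OF tendsto_power_div_exp_0]
          filterlim_tendsto_pos_mult_at_top[OF tendsto_const _ filterlim_ident])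
    from tendsto_mult_left[OF this, of "1 / \<xi> ^ k"] show ?thesis
      using assms by (simp add: power_mult_distrib exp_minus field_simps)
  qed
  have "((\<lambda>t. (\<xi> ^ Suc n / fact n) * (A * (t ^ n * exp (- \<xi> * t)) + B * (t ^ Suc n * exp (- \<xi> * t)))) \<longlongrightarrow>
      (\<xi> ^ Suc n / fact n) * (A * 0 + B * 0)) at_top"
    by (intro tendsto_intros *)
  then show ?thesis by (simp add: algebra_simps add_divide_distrib)
qed

lemma integrable_erlang_linear:
  fixes f :: "real \<Rightarrow> real"
  assumes \<xi>: "0 < \<xi>" and f: "f \<in> borel_measurable borel" and bound: "\<And>t. 0 \<le> t \<Longrightarrow> \<bar>f t\<bar> \<le> A + B * t"
  shows "integrable lborel (\<lambda>t. erlang_density n \<xi> t * f t)"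
proof (rule Bochner_Integration.integrable_bound)
  have mom: "integrable lborel (\<lambda>t. erlang_density n \<xi> t * t ^ i)" for i
  proof (rule integrableI_nonneg)
    have "(\<integral>\<^sup>+t. ennreal (erlang_density n \<xi> t * t ^ i) \<partial>lborel) = fact (n + i) / (fact n * \<xi> ^ i)"
      using nn_integral_erlang_ith_moment[OF \<xi>, of n i] by simp
    then show "(\<integral>\<^sup>+t. ennreal (erlang_density n \<xi> t * t ^ i) \<partial>lborel) < \<infinity>" by simp
    show "AE t in lborel. 0 \<le> erlang_density n \<xi> t * t ^ i"
      using \<xi> by (intro AE_I2) (auto simp: erlang_density_def)
  qed measurable
  have "integrable lborel (\<lambda>t. A * (erlang_density n \<xi> t * t ^ 0) + B * (erlang_density n \<xi> t * t ^ 1))"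
    by (intro Bochner_Integration.integrable_add integrable_mult_right mom)
  then show "integrable lborel (\<lambda>t. erlang_density n \<xi> t * (A + B * t))" by (simp add: algebra_simps)
  show "AE t in lborel. norm (erlang_density n \<xi> t * f t) \<le> norm (erlang_density n \<xi> t * (A + B * t))"
  proof (rule AE_I2)
    fix t show "norm (erlang_density n \<xi> t * f t) \<le> norm (erlang_density n \<xi> t * (A + B * t))"
      using bound[of t] \<xi> by (cases "t < 0") (auto simp: erlang_density_def abs_mult intro!: divide_right_mono mult_left_mono)
  qed
qed (use f in measurable)

text \<open>Consecutive Erlang densities satisfy e_n' = \<xi> (e_(n-1) - e_n), with e_(-1) = 0.
  Integration by parts thus turns the derivative \<open>K\<close> into a difference of
  \<open>G\<close> at consecutive epochs, which telescopes in \<open>n\<close>. At time 0 only e_0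
  is nonzero, with value \<xi>; this produces \<open>g0\<close>.\<close>

lemma erlang_by_parts_step:
  fixes G K :: "real \<Rightarrow> real"
  assumes \<xi>: "0 < \<xi>"
    and G: "\<And>t. 0 < t \<Longrightarrow> (G has_real_derivative K t) (at t)" "G \<in> borel_measurable borel"
    and K: "\<And>t. 0 < t \<Longrightarrow> isCont K t" "K \<in> borel_measurable borel"
    and bounds: "\<And>t. 0 \<le> t \<Longrightarrow> \<bar>G t\<bar> \<le> A + B * t" "\<And>t. 0 \<le> t \<Longrightarrow> \<bar>K t\<bar> \<le> A + B * t"
    and G0: "(G \<longlongrightarrow> g0) (at_right 0)"
  shows "(\<integral>t. erlang_density n \<xi> t * K t \<partial>lborel) =
     \<xi> * ((\<integral>t. erlang_density n \<xi> t * G t \<partial>lborel) -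
          (if n = 0 then g0 else (\<integral>t. erlang_density (n - 1) \<xi> t * G t \<partial>lborel)))"
proof -
  \<comment> \<open>The density without its cut-off at 0, hence differentiable everywhere, in
    particular up to the boundary.\<close>
  define E where "E n t = \<xi> ^ Suc n * t ^ n * exp (- \<xi> * t) / fact n" for n t
  define E' where "E' t = \<xi> * ((if n = 0 then 0 else E (n - 1) t) - E n t)" for t
  have E: "erlang_density n \<xi> t = E n t" if "0 < t" for n t
    using that by (simp add: erlang_density_def E_def)
  have dE: "(E n has_real_derivative E' t) (at t)" for t
  proof (cases n)
    case 0
    then show ?thesis unfolding E_def[abs_def] E'_def by (auto intro!: derivative_eq_intros)
  next
    case (Suc m)
    define c where "c = \<xi> ^ Suc n / fact n"
    have c: "c * real n = \<xi> * (\<xi> ^ n / fact m)"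
    proof -
      have "real n / fact n = 1 / (fact m :: real)" by (simp add: Suc divide_simps)
      then have "\<xi> ^ Suc n * (real n / fact n) = \<xi> ^ Suc n * (1 / fact m)" by simp
      then show ?thesis by (simp add: c_def)
    qed
    have "((\<lambda>t. c * (t ^ n * exp (- \<xi> * t))) has_real_derivative
        c * (real n * t ^ m * exp (- \<xi> * t) - \<xi> * (t ^ n * exp (- \<xi> * t)))) (at t)"
    proof -
      have "n - Suc 0 = m" by (simp add: Suc)
      then show ?thesis by (auto intro!: derivative_eq_intros simp: algebra_simps)
    qed
    moreover have "c * (real n * t ^ m * exp (- \<xi> * t) - \<xi> * (t ^ n * exp (- \<xi> * t))) =
       (c * real n) * (t ^ m * exp (- \<xi> * t)) - \<xi> * (c * (t ^ n * exp (- \<xi> * t)))"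
      by (simp add: algebra_simps)
    moreover have "\<dots> = E' t" unfolding c E'_def E_def by (simp add: Suc c_def algebra_simps)
    ultimately show ?thesis unfolding E_def[abs_def] c_def by (simp add: mult.assoc)
  qed
  define f where "f t = K t * E n t + G t * E' t" for t
  have cE: "isCont (E m) t" "isCont E' t" for m t
    unfolding E_def[abs_def] E'_def[abs_def] by (cases "n = 0"; auto intro!: continuous_intros)+
  have intK: "integrable lborel (\<lambda>t. erlang_density n \<xi> t * K t)"
    by (rule integrable_erlang_linear[OF \<xi> K(2) bounds(2)])
  have intG: "integrable lborel (\<lambda>t. erlang_density m \<xi> t * G t)" for m
    by (rule integrable_erlang_linear[OF \<xi> G(2) bounds(1)])
  \<comment> \<open>This is \<open>f\<close> on the positive axis and 0 on the negative one, written
    through the densities so that each summand is integrable by the linear bounds.\<close>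
  define \<phi> where "\<phi> t = erlang_density n \<xi> t * K t + \<xi> * ((if n = 0 then 0 else erlang_density (n - 1) \<xi> t * G t)
      - erlang_density n \<xi> t * G t)" for t
  have int\<phi>: "integrable lborel \<phi>"
    unfolding \<phi>_def[abs_def] using intK intG by (cases "n = 0") auto
  have AE0: "AE t in lborel. t \<noteq> (0::real)" by (rule AE_lborel_singleton)
  have eq: "AE t in lborel. indicator (einterval 0 \<infinity>) t *\<^sub>R f t = \<phi> t"
    using AE0
  proof eventually_elim
    case (elim t)
    show ?case
    proof (cases "0 < t")
      case True
      then show ?thesis by (simp add: f_def \<phi>_def E E'_def einterval_def algebra_simps)
    next
      case False
      then have "t < 0" using elim by simp
      then show ?thesis by (simp add: \<phi>_def erlang_density_def einterval_def)
    qed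
  qed
  have f_meas: "f \<in> borel_measurable borel"
    unfolding f_def[abs_def] E'_def[abs_def] E_def[abs_def] using G(2) K(2) by (cases "n = 0") simp_all
  have "(LBINT t=0..\<infinity>. f t) = 0 - g0 * E n 0"
  proof (rule interval_integral_FTC_integrable[where F = "\<lambda>t. G t * E n t"])
    show "((\<lambda>t. G t * E n t) has_vector_derivative f t) (at t)" if "0 < ereal t" "ereal t < \<infinity>" for t
      using DERIV_mult[OF G(1) dE[of t]] that
      by (simp add: f_def has_real_derivative_iff_has_vector_derivative[symmetric] algebra_simps)
    show "isCont f t" if "0 < ereal t" "ereal t < \<infinity>" for t
      unfolding f_def[abs_def] using that cE K(1) G(1)[THEN DERIV_isCont] by (auto intro!: continuous_intros)
    show "set_integrable lborel (einterval 0 \<infinity>) f"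
      unfolding set_integrable_def
      by (rule integrable_cong_AE_imp[OF int\<phi>]) (use f_meas eq in \<open>auto elim: eventually_mono\<close>)
    have "((\<lambda>t. G t * E n t) \<longlongrightarrow> g0 * E n 0) (at_right 0)"
      using cE(1)[where m = n and t = 0] by (intro tendsto_intros G0) (simp add: isCont_def filterlim_at_split)
    then show "(((\<lambda>t. G t * E n t) \<circ> real_of_ereal) \<longlongrightarrow> g0 * E n 0) (at_right 0)"
      by (simp add: ereal_tendsto_simps zero_ereal_def)
    have "((\<lambda>t. G t * E n t) \<longlongrightarrow> 0) at_top"
    proof (rule Lim_null_comparison)
      show "((\<lambda>t. (A + B * t) * E n t) \<longlongrightarrow> 0) at_top"
        unfolding E_def by (rule erlang_limit_infinity[OF \<xi>])
      show "\<forall>\<^sub>F t in at_top. norm (G t * E n t) \<le> (A + B * t) * E n t"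
      proof (rule eventually_mono[OF eventually_ge_at_top[of 0]])
        fix t :: real assume "0 \<le> t"
        then show "norm (G t * E n t) \<le> (A + B * t) * E n t"
          using bounds(1)[of t] \<xi> by (auto simp: E_def abs_mult intro!: divide_right_mono mult_right_mono)
      qed
    qed
    then show "(((\<lambda>t. G t * E n t) \<circ> real_of_ereal) \<longlongrightarrow> 0) (at_left \<infinity>)"
      by (simp add: ereal_tendsto_simps)
  qed simp
  also have "(LBINT t=0..\<infinity>. f t) = (\<integral>t. \<phi> t \<partial>lborel)"
    unfolding interval_lebesgue_integral_def set_lebesgue_integral_def
    using f_meas int\<phi> eq by (auto intro!: integral_cong_AE)
  also have "\<dots> = (\<integral>t. erlang_density n \<xi> t * K t \<partial>lborel) +
     \<xi> * ((if n = 0 then 0 else (\<integral>t. erlang_density (n - 1) \<xi> t * G t \<partial>lborel))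
      - (\<integral>t. erlang_density n \<xi> t * G t \<partial>lborel))"
    unfolding \<phi>_def[abs_def] using intK intG by (cases "n = 0") simp_all
  finally show ?thesis by (cases "n = 0") (auto simp: E_def power_0_left algebra_simps)
qed

section \<open>The law of the sampled workload\<close>

text \<open>The vanishing part \<open>q\<close> may depend on the tolerance; in the uses it depends
  on a cut-off chosen for that tolerance.\<close>

lemma tendsto_if_bound_eps:
  fixes x :: "'b \<Rightarrow> real"
  assumes "\<And>e. e > 0 \<Longrightarrow> \<exists>q. (q \<longlongrightarrow> 0) Fl \<and> (\<forall>\<^sub>F n in Fl. \<bar>x n - l\<bar> \<le> e + q n)"
  shows "(x \<longlongrightarrow> l) Fl"
proof (rule tendstoI)
  fix e :: real assume "0 < e"
  then obtain q where q: "(q \<longlongrightarrow> 0) Fl" "\<forall>\<^sub>F n in Fl. \<bar>x n - l\<bar> \<le> e/2 + q n"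
    using assms[of "e/2"] by auto
  have "\<forall>\<^sub>F n in Fl. q n < e/2" using order_tendstoD(2)[OF q(1), of "e/2"] \<open>0 < e\<close> by simp
  with q(2) show "\<forall>\<^sub>F n in Fl. dist (x n) l < e"
    by eventually_elim (simp add: dist_real_def)
qed

text \<open>The epochs escape to infinity: the distribution function at T is 1 - exp (- \<xi> T)
  times a partial sum of the series of exp (\<xi> T).\<close>

lemma erlang_prob_le_tendsto:
  assumes \<xi>: "0 < \<xi>"
  shows "(\<lambda>n. measure (density lborel (erlang_density n \<xi>)) {..T}) \<longlonglongrightarrow> 0"
proof (cases "T < 0")
  case True
  then show ?thesis by (simp add: measure_def emeasure_erlang_density[OF \<xi>] erlang_CDF_def)
next
  case False
  have "(\<lambda>k. (\<xi> * T) ^ k /\<^sub>R fact k) sums exp (\<xi> * T)" by (rule exp_converges)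
  then have "(\<lambda>n. \<Sum>k\<le>n. (\<xi> * T) ^ k /\<^sub>R fact k) \<longlonglongrightarrow> exp (\<xi> * T)" by (simp add: sums_def_le)
  then have "(\<lambda>n. 1 - (\<Sum>k\<le>n. (\<xi> * T) ^ k /\<^sub>R fact k) * exp (- (\<xi> * T))) \<longlonglongrightarrow> 1 - exp (\<xi> * T) * exp (- (\<xi> * T))"
    by (intro tendsto_intros)
  also have "1 - exp (\<xi> * T) * exp (- (\<xi> * T)) = 0" by (simp flip: exp_add)
  also have "(\<lambda>n. 1 - (\<Sum>k\<le>n. (\<xi> * T) ^ k /\<^sub>R fact k) * exp (- (\<xi> * T))) = (\<lambda>n. erlang_CDF n \<xi> T)"
    using False by (simp add: erlang_CDF_def sum_distrib_right sum_distrib_left divide_inverse mult_ac)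
  finally have lim: "(\<lambda>n. erlang_CDF n \<xi> T) \<longlonglongrightarrow> 0" .
  have "measure (density lborel (erlang_density n \<xi>)) {..T} = max 0 (erlang_CDF n \<xi> T)" for n
    using emeasure_erlang_density[OF \<xi>, of n T] by (simp add: measure_def max_def enn2real_eq_0_iff ennreal_eq_0_iff)
  then show ?thesis using tendsto_max[OF tendsto_const[of 0] lim] by simp
qed

lemma erlang_integral_limit:
  assumes \<xi>: "0 < \<xi>" and h: "h \<in> borel_measurable borel" "\<And>t. \<bar>h t\<bar> \<le> B" "(h \<longlongrightarrow> l) at_top"
  shows "(\<lambda>n. \<integral>t. h t \<partial>density lborel (erlang_density n \<xi>)) \<longlonglongrightarrow> (l::real)"
proof (rule tendsto_if_bound_eps)
  fix e :: real assume "0 < e"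
  then obtain T where T: "\<And>t. T \<le> t \<Longrightarrow> \<bar>h t - l\<bar> < e"
    using tendstoD[OF h(3)] by (auto simp: eventually_at_top_linorder dist_real_def)
  define C where "C = B + \<bar>l\<bar>"
  have C: "\<bar>h t - l\<bar> \<le> C" for t using h(2)[of t] by (simp add: C_def)
  have bound: "\<bar>(\<integral>t. h t \<partial>density lborel (erlang_density n \<xi>)) - l\<bar>
     \<le> e + C * measure (density lborel (erlang_density n \<xi>)) {..T}" for n
  proof -
    interpret E: prob_space "density lborel (erlang_density n \<xi>)" by (rule prob_space_erlang_density[OF \<xi>])
    have int: "integrable (density lborel (erlang_density n \<xi>)) h"
      using h by (intro E.integrable_const_bound[where B = B]) auto
    have ind: "integrable (density lborel (erlang_density n \<xi>)) (indicat_real {..T})"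
      by (rule E.integrable_const_bound[where B = 1]) auto
    have "\<bar>(\<integral>t. h t \<partial>density lborel (erlang_density n \<xi>)) - l\<bar> = \<bar>\<integral>t. h t - l \<partial>density lborel (erlang_density n \<xi>)\<bar>"
      using int E.prob_space by simp
    also have "\<dots> \<le> (\<integral>t. e + C * indicator {..T} t \<partial>density lborel (erlang_density n \<xi>))"
    proof (rule order_trans[OF integral_abs_bound integral_mono])
      show "integrable (density lborel (erlang_density n \<xi>)) (\<lambda>t. e + C * indicator {..T} t)"
        using ind by simp
      show "\<bar>h t - l\<bar> \<le> e + C * indicator {..T} t" for t
        using T[of t] C[of t] \<open>0 < e\<close> by (cases "t \<le> T") (auto simp: less_imp_le)
    qed (use int in auto)
    also have "\<dots> = e + C * measure (density lborel (erlang_density n \<xi>)) {..T}"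
      using E.prob_space ind by simp
    finally show ?thesis .
  qed
  show "\<exists>q. q \<longlonglongrightarrow> 0 \<and> (\<forall>\<^sub>F n in sequentially. \<bar>(\<integral>t. h t \<partial>density lborel (erlang_density n \<xi>)) - l\<bar> \<le> e + q n)"
    using bound tendsto_mult_left[OF erlang_prob_le_tendsto[OF \<xi>, of T], of C]
    by (intro exI[of _ "\<lambda>n. C * measure (density lborel (erlang_density n \<xi>)) {..T}"]) auto
qed

context levy_storage
begin

text \<open>\<open>erlang_density n\<close> has shape n + 1, so this is the law at epoch n + 1: the
  index lags by one. The density has no mass on negative times, where \<open>max 0 t\<close> only
  makes the map total.\<close>

definition law :: "real \<Rightarrow> nat \<Rightarrow> real \<Rightarrow> real measure" where
  "law \<xi> n v = distr (density lborel (erlang_density n \<xi>) \<Otimes>\<^sub>M M) borel (\<lambda>(t, \<omega>). W v (max 0 t) \<omega>)"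

lemma sets_law [measurable_cong, simp]: "sets (law \<xi> n v) = sets borel" by (simp add: law_def)

lemma W_meas_time: "(\<lambda>(t, \<omega>). W v (max 0 t) \<omega>) \<in> borel_measurable (borel \<Otimes>\<^sub>M M)"
proof -
  have "(\<lambda>p. (v, p)) \<in> measurable (borel \<Otimes>\<^sub>M M) (borel \<Otimes>\<^sub>M (borel \<Otimes>\<^sub>M M))" by measurable
  from measurable_compose[OF this W_meas_M] show ?thesis by (simp add: case_prod_beta')
qed

lemma W_meas_time' [measurable]: "(\<lambda>(t, \<omega>). W v (max 0 t) \<omega>) \<in> borel_measurable (density lborel f \<Otimes>\<^sub>M M)"
proof -
  have "sets (density lborel f \<Otimes>\<^sub>M M) = sets (borel \<Otimes>\<^sub>M M)" by (intro sets_pair_measure_cong) auto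
  from measurable_cong_sets[OF this refl] W_meas_time show ?thesis by blast
qed

context
  fixes \<xi> :: real assumes \<xi>: "0 < \<xi>"
begin

lemma prob_space_law: "prob_space (law \<xi> n v)"
proof -
  interpret E: prob_space "density lborel (erlang_density n \<xi>)" by (rule prob_space_erlang_density[OF \<xi>])
  interpret P: pair_prob_space "density lborel (erlang_density n \<xi>)" M ..
  show ?thesis unfolding law_def by (rule P.prob_space_distr[OF W_meas_time'])
qed

lemma nn_integral_law:
  assumes f: "f \<in> borel_measurable borel"
  shows "(\<integral>\<^sup>+x. f x \<partial>law \<xi> n v) =
    (\<integral>\<^sup>+t. (\<integral>\<^sup>+\<omega>. f (W v (max 0 t) \<omega>) \<partial>M) \<partial>density lborel (erlang_density n \<xi>))"
proof -
  have "(\<integral>\<^sup>+x. f x \<partial>law \<xi> n v) = (\<integral>\<^sup>+p. f (case p of (t, \<omega>) \<Rightarrow> W v (max 0 t) \<omega>) \<partial>(density lborel (erlang_density n \<xi>) \<Otimes>\<^sub>M M))"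
    unfolding law_def by (rule nn_integral_distr) (use f in measurable)
  also have "\<dots> = (\<integral>\<^sup>+t. (\<integral>\<^sup>+\<omega>. f (case (t, \<omega>) of (t, \<omega>) \<Rightarrow> W v (max 0 t) \<omega>) \<partial>M) \<partial>density lborel (erlang_density n \<xi>))"
    by (rule nn_integral_fst[symmetric]) (rule measurable_compose[OF W_meas_time' f])
  finally show ?thesis by simp
qed

lemma AE_law_nonneg: "AE x in law \<xi> n v. 0 \<le> x"
  unfolding law_def
  by (subst AE_distr_iff) (auto intro!: AE_I2 W_nonneg simp: space_pair_measure)

lemma erlang_real_eq:
  assumes "h \<in> borel_measurable borel"
  shows "(\<integral>t. h t \<partial>density lborel (erlang_density n \<xi>)) = (\<integral>t. erlang_density n \<xi> t * h t \<partial>lborel)"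
  using assms \<xi> by (subst integral_density) (auto intro!: AE_I2)

text \<open>Tonelli is applied to nonnegative integrals. The linear bound on the mean makes the time
  integral against the Erlang density finite, so integrability of \<open>f\<close> comes out of the
  computation.\<close>

lemma law_expectation:
  fixes f :: "real \<Rightarrow> real"
  assumes f: "f \<in> borel_measurable borel" and nn: "\<And>x. 0 \<le> x \<Longrightarrow> 0 \<le> f x"
    and int: "\<And>t. 0 \<le> t \<Longrightarrow> integrable M (\<lambda>\<omega>. f (W v t \<omega>))"
    and bound: "\<And>t. 0 \<le> t \<Longrightarrow> (\<integral>\<omega>. f (W v t \<omega>) \<partial>M) \<le> A + B * t"
  shows "(\<lambda>t. \<integral>\<omega>. f (W v (max 0 t) \<omega>) \<partial>M) \<in> borel_measurable borel"
    and "integrable (law \<xi> n v) f"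
    and "(\<integral>x. f x \<partial>law \<xi> n v) = (\<integral>t. erlang_density n \<xi> t * (\<integral>\<omega>. f (W v (max 0 t) \<omega>) \<partial>M) \<partial>lborel)"
proof -
  let ?h = "\<lambda>t. \<integral>\<omega>. f (W v (max 0 t) \<omega>) \<partial>M"
  have "(\<lambda>(t, \<omega>). f (W v (max 0 t) \<omega>)) \<in> borel_measurable (borel \<Otimes>\<^sub>M M)"
    using measurable_compose[OF W_meas_time f] by (simp add: case_prod_beta')
  then show h: "?h \<in> borel_measurable borel" by (rule borel_measurable_lebesgue_integral)
  have hnn: "0 \<le> ?h t" for t by (intro integral_nonneg_AE AE_I2 nn W_nonneg) auto
  have inth: "integrable lborel (\<lambda>t. erlang_density n \<xi> t * ?h t)"
  proof (rule integrable_erlang_linear[OF \<xi> h])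
    show "\<bar>?h t\<bar> \<le> A + B * t" if "0 \<le> t" for t
      using hnn[of t] bound[OF that] that by simp
  qed
  have "(\<integral>\<^sup>+x. ennreal (f x) \<partial>law \<xi> n v) = (\<integral>\<^sup>+t. ennreal (?h t) \<partial>density lborel (erlang_density n \<xi>))"
    using f by (subst nn_integral_law) (auto intro!: nn_integral_cong nn_integral_eq_integral int AE_I2 nn W_nonneg)
  also have "\<dots> = (\<integral>\<^sup>+t. ennreal (erlang_density n \<xi> t * ?h t) \<partial>lborel)"
    using h \<xi> hnn by (subst nn_integral_density) (auto simp: ennreal_mult)
  also have "\<dots> = ennreal (\<integral>t. erlang_density n \<xi> t * ?h t \<partial>lborel)"
    using inth hnn \<xi> by (intro nn_integral_eq_integral) auto
  finally have eq: "(\<integral>\<^sup>+x. ennreal (f x) \<partial>law \<xi> n v) = ennreal (\<integral>t. erlang_density n \<xi> t * ?h t \<partial>lborel)" .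
  have ae: "AE x in law \<xi> n v. 0 \<le> f x" using AE_law_nonneg by eventually_elim (rule nn)
  show int_f: "integrable (law \<xi> n v) f"
    using f eq ae by (intro integrableI_nonneg) auto
  have "0 \<le> (\<integral>t. erlang_density n \<xi> t * ?h t \<partial>lborel)" using hnn \<xi> by (intro integral_nonneg_AE AE_I2) auto
  then show "(\<integral>x. f x \<partial>law \<xi> n v) = (\<integral>t. erlang_density n \<xi> t * ?h t \<partial>lborel)"
    using f eq ae by (intro integral_eq_nn_integral[THEN trans]) auto
qed

lemma isCont_F: 
  assumes v: "0 \<le> v" and a: "0 \<le> a" and t: "0 < t"
  shows "isCont (F v a) t"
proof -
  have "((\<lambda>y. F v a y - F v a t) \<longlongrightarrow> 0) (at t)"
  proof (rule Lim_null_comparison)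
    have "((\<lambda>y. 2 * a * \<bar>y - t\<bar>) \<longlongrightarrow> 2 * a * \<bar>t - t\<bar>) (at t)" by (intro tendsto_intros)
    then show "((\<lambda>y. 2 * a * \<bar>y - t\<bar>) \<longlongrightarrow> 0) (at t)" by simp
    have "\<forall>\<^sub>F y in nhds t. 0 < y" using t by (rule order_tendstoD(1)[OF filterlim_ident])
    then have "\<forall>\<^sub>F y in at t. 0 < y" unfolding eventually_at_filter by eventually_elim simp
    then show "\<forall>\<^sub>F y in at t. norm (F v a y - F v a t) \<le> 2 * a * \<bar>y - t\<bar>"
    proof eventually_elim
      case (elim y)
      then show ?case
        using F_lipschitz[OF v, of t "y - t" a] F_lipschitz[OF v, of y "t - y" a] t a
        by (cases "t \<le> y") (auto simp: abs_minus_commute)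
    qed
  qed
  then show ?thesis by (simp add: isCont_def LIM_zero_iff)
qed

text \<open>The by-parts formulas for n = 0, ..., N telescope: each subtracts the value at the
  preceding epoch, and the first one the initial value. There are N + 1 summands, one for each of
  the first N + 1 epochs.\<close>

lemma
  assumes v: "0 \<le> v" and a: "0 < a"
  shows law_integrable_exp: "integrable (law \<xi> n v) (\<lambda>x. exp (- a * x))"
    and law_integrable_id: "integrable (law \<xi> n v) (\<lambda>x. x)"
    and law_identity: "(\<Sum>n\<le>N. phi a * (\<integral>x. exp (- a * x) \<partial>law \<xi> n v) - a * d1) =
       \<xi> * ((\<integral>x. exp (- a * x) + a * x \<partial>law \<xi> N v) - (exp (- a * v) + a * v))"
proof -
  have Fb: "(\<integral>\<omega>. exp (- a * W v t \<omega>) \<partial>M) \<le> 1 + 0 * t" if "0 \<le> t" for t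
    using F_bounds(2)[OF that, of a v] a by (simp add: F_def)
  have aW: "integrable M (\<lambda>\<omega>. exp (- a * W v t \<omega>))" if "0 \<le> t" for t using that a by (intro integrable_exp_W) auto
  have e1: "(\<lambda>t. F v a (max 0 t)) \<in> borel_measurable borel"
    and e2: "integrable (law \<xi> n v) (\<lambda>x. exp (- a * x))"
    and e3: "(\<integral>x. exp (- a * x) \<partial>law \<xi> n v) = (\<integral>t. erlang_density n \<xi> t * F v a (max 0 t) \<partial>lborel)" for n
    unfolding F_def
    by (rule law_expectation[where f = "\<lambda>x. exp (- a * x)", OF _ _ aW Fb]; simp)+
  have Gb: "(\<integral>\<omega>. exp (- a * W v t \<omega>) + a * W v t \<omega> \<partial>M) \<le> (1 + a * v) + a * t" if "0 \<le> t" for t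
    using G_bounds(2)[OF v a that] by (simp add: G_def)
  have aG: "integrable M (\<lambda>\<omega>. exp (- a * W v t \<omega>) + a * W v t \<omega>)" if "0 \<le> t" for t
    using aW[OF that] integrable_W[OF that v] by simp
  have g1: "(\<lambda>t. G v a (max 0 t)) \<in> borel_measurable borel"
    and g2: "integrable (law \<xi> n v) (\<lambda>x. exp (- a * x) + a * x)"
    and g3: "(\<integral>x. exp (- a * x) + a * x \<partial>law \<xi> n v) = (\<integral>t. erlang_density n \<xi> t * G v a (max 0 t) \<partial>lborel)" for n
    unfolding G_def
    by (rule law_expectation[where f = "\<lambda>x. exp (- a * x) + a * x", OF _ _ aG Gb]; use a in simp)+
  show "integrable (law \<xi> n v) (\<lambda>x. exp (- a * x))" by (rule e2)
  have "integrable (law \<xi> n v) (\<lambda>x. ((exp (- a * x) + a * x) - exp (- a * x)) / a)"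
    by (intro integrable_divide Bochner_Integration.integrable_diff e2 g2)
  then show "integrable (law \<xi> n v) (\<lambda>x. x)" using a by simp
  \<comment> \<open>Cutting at time 0 gives functions measurable on the whole line without changing
    germs at positive times.\<close>
  define K where "K t = phi a * F v a (max 0 t) - a * d1" for t
  define Gm where "Gm t = G v a (max 0 t)" for t
  define A where "A = max (1 + a * v) (phi a + a * d1)"
  have step: "(\<integral>t. erlang_density n \<xi> t * K t \<partial>lborel) =
     \<xi> * ((\<integral>t. erlang_density n \<xi> t * Gm t \<partial>lborel) -
          (if n = 0 then exp (- a * v) + a * v else (\<integral>t. erlang_density (n - 1) \<xi> t * Gm t \<partial>lborel)))" for n
  proof (rule erlang_by_parts_step[OF \<xi>, where A = A and B = a])
    show "Gm \<in> borel_measurable borel" "K \<in> borel_measurable borel"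
      unfolding Gm_def[abs_def] K_def[abs_def] using g1 e1 by simp_all
    show "(Gm has_real_derivative K t) (at t)" if t: "0 < t" for t
    proof -
      have ev: "\<forall>\<^sub>F y in nhds t. Gm y = G v a y"
        using order_tendstoD(1)[OF filterlim_ident t] by eventually_elim (simp add: Gm_def)
      show ?thesis
        using DERIV_G[OF v a t] t by (subst DERIV_cong_ev[OF refl ev refl]) (simp add: K_def)
    qed
    show "isCont K t" if t: "0 < t" for t
    proof -
      have ev: "\<forall>\<^sub>F y in nhds t. K y = phi a * F v a y - a * d1"
        using order_tendstoD(1)[OF filterlim_ident t] by eventually_elim (simp add: K_def)
      show ?thesis
        using isCont_F[OF v _ t, of a] a by (subst isCont_cong[OF ev]) (auto intro!: continuous_intros)
    qed
    show "\<bar>Gm t\<bar> \<le> A + a * t" if "0 \<le> t" for t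
      using G_bounds[OF v a that] that by (simp add: Gm_def A_def max_def)
    show "\<bar>K t\<bar> \<le> A + a * t" if t: "0 \<le> t" for t
    proof -
      have "0 \<le> phi a * F v a t" "phi a * F v a t \<le> phi a * 1"
        using F_bounds[OF t, of a v] a phi_pos[OF a] by (auto intro!: mult_left_mono)
      moreover have "0 \<le> a * d1" "0 \<le> a * t" using a d1_pos t by auto
      ultimately show ?thesis using t by (simp add: K_def A_def abs_le_iff max_def)
    qed
    show "(Gm \<longlongrightarrow> exp (- a * v) + a * v) (at_right 0)"
      using G_0_right[OF v a]
      by (rule Lim_transform_eventually) (auto simp: Gm_def intro!: eventually_mono[OF eventually_at_right_less])
  qed
  have Kint: "(\<integral>t. erlang_density n \<xi> t * K t \<partial>lborel) = phi a * (\<integral>x. exp (- a * x) \<partial>law \<xi> n v) - a * d1" for n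
  proof -
    interpret E: prob_space "density lborel (erlang_density n \<xi>)" by (rule prob_space_erlang_density[OF \<xi>])
    have "(\<integral>t. erlang_density n \<xi> t * K t \<partial>lborel) = (\<integral>t. K t \<partial>density lborel (erlang_density n \<xi>))"
      unfolding K_def[abs_def] using e1 by (subst erlang_real_eq) auto
    also have "\<dots> = phi a * (\<integral>t. F v a (max 0 t) \<partial>density lborel (erlang_density n \<xi>)) - a * d1"
    proof -
      have "integrable (density lborel (erlang_density n \<xi>)) (\<lambda>t. F v a (max 0 t))"
        using e1 F_bounds[of "max 0 _" a v] a by (intro E.integrable_const_bound[where B = 1]) auto
      then show ?thesis unfolding K_def[abs_def] using E.prob_space by simp
    qed
    also have "(\<integral>t. F v a (max 0 t) \<partial>density lborel (erlang_density n \<xi>)) = (\<integral>x. exp (- a * x) \<partial>law \<xi> n v)"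
      unfolding e3 using e1 by (rule erlang_real_eq)
    finally show ?thesis .
  qed
  note step' = step[unfolded Kint Gm_def g3[symmetric]]
  show "(\<Sum>n\<le>N. phi a * (\<integral>x. exp (- a * x) \<partial>law \<xi> n v) - a * d1) =
       \<xi> * ((\<integral>x. exp (- a * x) + a * x \<partial>law \<xi> N v) - (exp (- a * v) + a * v))"
  proof (induction N)
    case 0
    then show ?case using step'[of 0] by simp
  next
    case (Suc N)
    then show ?case using step'[of "Suc N"] by (simp add: algebra_simps)
  qed
qed

end

end

section \<open>The stationary law\<close>

locale stationary_storage = levy_storage M \<nu> J for M :: "'a measure" and \<nu> J +
  fixes \<pi> :: "real measure"
  assumes stationary: "stationary_workload M (net_input J) \<pi>"
begin

lemma prob_pi: "prob_space \<pi>" and sets_pi [measurable_cong, simp]: "sets \<pi> = sets borel"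
  and AE_pi_nonneg: "AE u in \<pi>. 0 \<le> u"
  using stationary by (auto simp: stationary_workload_def)

sublocale pi: prob_space \<pi> by (rule prob_pi)
sublocale piM: pair_prob_space \<pi> M ..

lemma W_meas_pair [measurable]: "0 \<le> t \<Longrightarrow> (\<lambda>(u, \<omega>). W u t \<omega>) \<in> borel_measurable (\<pi> \<Otimes>\<^sub>M M)"
proof -
  assume t: "0 \<le> t"
  have "(\<lambda>(u, \<omega>). (u, t, \<omega>)) \<in> measurable (\<pi> \<Otimes>\<^sub>M M) (borel \<Otimes>\<^sub>M (borel \<Otimes>\<^sub>M M))" by measurable
  from measurable_compose[OF this W_meas_M] t show ?thesis by (simp add: case_prod_beta')
qed

lemma distr_W: "0 \<le> t \<Longrightarrow> distr (\<pi> \<Otimes>\<^sub>M M) borel (\<lambda>(u, \<omega>). W u t \<omega>) = \<pi>"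
proof -
  assume t: "0 \<le> t"
  have eq: "real_of_ereal (workload (net_input J) (\<lambda>_. ereal u) t \<omega>) = W u t \<omega>" for u \<omega>
    by (simp add: workload_def net_input_def W_def flip: ereal_max)
  have "\<forall>t\<ge>0. distr (\<pi> \<Otimes>\<^sub>M M) borel
      (\<lambda>(v, \<omega>). real_of_ereal (workload (net_input J) (\<lambda>_. ereal v) t \<omega>)) = \<pi>"
    using stationary unfolding stationary_workload_def by (elim conjE)
  from this[rule_format, OF t] show ?thesis unfolding eq .
qed

lemma nn_integral_W:
  assumes "0 \<le> t" "f \<in> borel_measurable borel"
  shows "(\<integral>\<^sup>+p. f (W (fst p) t (snd p)) \<partial>(\<pi> \<Otimes>\<^sub>M M)) = (\<integral>\<^sup>+x. f x \<partial>\<pi>)"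
  using assms by (subst distr_W[OF assms(1), symmetric], subst nn_integral_distr) (auto simp: case_prod_beta')

lemma integral_W:
  fixes f :: "real \<Rightarrow> real"
  assumes "0 \<le> t" "f \<in> borel_measurable borel"
  shows "(\<integral>p. f (W (fst p) t (snd p)) \<partial>(\<pi> \<Otimes>\<^sub>M M)) = (\<integral>x. f x \<partial>\<pi>)"
  using assms by (subst (2) distr_W[OF assms(1), symmetric], subst integral_distr) (auto simp: case_prod_beta')

lemma AE_pair_nonneg: "AE p in \<pi> \<Otimes>\<^sub>M M. 0 \<le> fst p \<and> snd p \<in> space M"
proof -
  have "AE p in \<pi> \<Otimes>\<^sub>M M. 0 \<le> fst p"
  proof (rule piM.AE_pair_measure)
    show "AE u in \<pi>. AE \<omega> in M. 0 \<le> fst (u, \<omega>)" using AE_pi_nonneg by eventually_elim simp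
  qed measurable
  then show ?thesis using AE_space by eventually_elim (auto simp: space_pair_measure)
qed

lemma integrable_snd:
  fixes f :: "'a \<Rightarrow> real"
  assumes "integrable M f"
  shows "integrable (\<pi> \<Otimes>\<^sub>M M) (\<lambda>p. f (snd p))" "(\<integral>p. f (snd p) \<partial>(\<pi> \<Otimes>\<^sub>M M)) = (\<integral>\<omega>. f \<omega> \<partial>M)"
proof -
  have d: "distr (\<pi> \<Otimes>\<^sub>M M) M snd = M"
  proof (rule measure_eqI)
    fix A assume "A \<in> sets (distr (\<pi> \<Otimes>\<^sub>M M) M snd)"
    then have A: "A \<in> sets M" by simp
    then have "snd -` A \<inter> space (\<pi> \<Otimes>\<^sub>M M) = space \<pi> \<times> A"
      using sets.sets_into_space[OF A] by (auto simp: space_pair_measure)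
    then show "emeasure (distr (\<pi> \<Otimes>\<^sub>M M) M snd) A = emeasure M A"
      using A by (simp add: emeasure_distr emeasure_pair_measure_Times[OF sets.top] pi.emeasure_space_1)
  qed simp
  show "integrable (\<pi> \<Otimes>\<^sub>M M) (\<lambda>p. f (snd p))"
    using assms by (subst (asm) d[symmetric], subst (asm) integrable_distr_eq) auto
  show "(\<integral>p. f (snd p) \<partial>(\<pi> \<Otimes>\<^sub>M M)) = (\<integral>\<omega>. f \<omega> \<partial>M)"
    using assms by (subst (2) d[symmetric], subst integral_distr) auto
qed

lemma integrable_pair_bounded:
  fixes f :: "real \<times> 'a \<Rightarrow> real"
  assumes "f \<in> borel_measurable (\<pi> \<Otimes>\<^sub>M M)" "\<And>p. \<bar>f p\<bar> \<le> B"
  shows "integrable (\<pi> \<Otimes>\<^sub>M M) f"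
  using assms by (intro piM.integrable_const_bound[where B = B]) auto

lemma W_meas_fst_snd [measurable]: "0 \<le> t \<Longrightarrow> (\<lambda>p. W (fst p) t (snd p)) \<in> borel_measurable (\<pi> \<Otimes>\<^sub>M M)"
  using W_meas_pair[of t] by (simp add: case_prod_beta')

text \<open>Stationarity gives mean \<open>0\<close> to the increment of \<open>g (W u h)\<close> over a time step although \<open>g\<close> itself
  need not be integrable under \<open>\<pi>\<close>: truncate \<open>g\<close> and use that the increment is integrable.\<close>

lemma stationary_increment:
  assumes a: "0 < a" and h: "0 \<le> h"
  defines "D \<equiv> \<lambda>p. (exp (- a * W (fst p) h (snd p)) + a * W (fst p) h (snd p)) - (exp (- a * fst p) + a * fst p)"
  shows "integrable (\<pi> \<Otimes>\<^sub>M M) D" "(\<integral>p. D p \<partial>(\<pi> \<Otimes>\<^sub>M M)) = 0"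
proof -
  define g where "g x = exp (- a * x) + a * x" for x
  have g_lip: "\<bar>g x - g y\<bar> \<le> 2 * a * \<bar>x - y\<bar>" if "0 \<le> x" "0 \<le> y" for x y
  proof -
    have "\<bar>exp (- x * a) - exp (- y * a)\<bar> \<le> \<bar>x - y\<bar> * (a * exp (- 0 * a))"
      using that a by (intro abs_exp_minus_diff_le) auto
    moreover have "\<bar>a * x - a * y\<bar> = a * \<bar>x - y\<bar>" using a by (simp add: abs_mult flip: right_diff_distrib)
    moreover have "g x - g y = (exp (- x * a) - exp (- y * a)) + (a * x - a * y)" by (simp add: g_def mult.commute)
    moreover have "\<bar>x - y\<bar> * (a * exp (- 0 * a)) = a * \<bar>x - y\<bar>" by simp
    ultimately show ?thesis by linarith
  qed
  have [measurable]: "g \<in> borel_measurable borel" unfolding g_def[abs_def] by measurable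
  have [measurable]: "(\<lambda>p. W (fst p) h (snd p)) \<in> borel_measurable (\<pi> \<Otimes>\<^sub>M M)" using h by measurable
  have D: "D p = g (W (fst p) h (snd p)) - g (fst p)" for p by (simp add: D_def g_def)
  have [measurable]: "D \<in> borel_measurable (\<pi> \<Otimes>\<^sub>M M)" unfolding D[abs_def] by measurable
  have bnd: "AE p in \<pi> \<Otimes>\<^sub>M M. \<bar>D p\<bar> \<le> 2 * a * (J h (snd p) + h)"
    using AE_pair_nonneg
  proof eventually_elim
    case (elim p)
    have "\<bar>W (fst p) h (snd p) - fst p\<bar> \<le> J h (snd p) + h"
      using W_step_abs[of "snd p" 0 h "fst p"] elim h by (simp add: W_0 J_0)
    then have "2 * a * \<bar>W (fst p) h (snd p) - fst p\<bar> \<le> 2 * a * (J h (snd p) + h)"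
      using a by (intro mult_left_mono) auto
    then show ?case using g_lip[of "W (fst p) h (snd p)" "fst p"] elim h W_nonneg[of "snd p" h "fst p"] by (simp add: D)
  qed
  have intw: "integrable (\<pi> \<Otimes>\<^sub>M M) (\<lambda>p. 2 * a * (J h (snd p) + h))"
    using integrable_snd(1)[OF integrable_J[OF h]] by simp
  show int: "integrable (\<pi> \<Otimes>\<^sub>M M) D"
    by (rule Bochner_Integration.integrable_bound[OF intw]) (use bnd in \<open>auto elim!: eventually_mono\<close>)
  have g_nonneg: "0 \<le> g x" if "0 \<le> x" for x using that a by (simp add: g_def)
  define gk where "gk k x = max 0 (min (g x) (real k))" for k x
  have [measurable]: "gk k \<in> borel_measurable borel" for k unfolding gk_def[abs_def] by measurable
  have gk_bound: "\<bar>gk k x\<bar> \<le> real k" for k x by (simp add: gk_def)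
  have "(\<lambda>k. \<integral>p. gk k (W (fst p) h (snd p)) - gk k (fst p) \<partial>(\<pi> \<Otimes>\<^sub>M M)) \<longlonglongrightarrow> (\<integral>p. D p \<partial>(\<pi> \<Otimes>\<^sub>M M))"
  proof (rule integral_dominated_convergence[OF _ _ intw])
    show "AE p in \<pi> \<Otimes>\<^sub>M M. (\<lambda>k. gk k (W (fst p) h (snd p)) - gk k (fst p)) \<longlonglongrightarrow> D p"
      using AE_pair_nonneg
    proof eventually_elim
      case (elim p)
      have lim: "(\<lambda>k. gk k x) \<longlonglongrightarrow> g x" if "0 \<le> x" for x
      proof (rule tendsto_eventually)
        have "\<forall>\<^sub>F k in sequentially. g x \<le> real k"
          using filterlim_real_sequentially by (simp add: filterlim_at_top)
        then show "\<forall>\<^sub>F k in sequentially. gk k x = g x"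
          by eventually_elim (use g_nonneg[OF that] in \<open>simp add: gk_def\<close>)
      qed
      show ?case unfolding D using elim h by (intro tendsto_diff lim W_nonneg) auto
    qed
    show "AE p in \<pi> \<Otimes>\<^sub>M M. norm (gk k (W (fst p) h (snd p)) - gk k (fst p)) \<le> 2 * a * (J h (snd p) + h)" for k
      using bnd
    proof eventually_elim
      case (elim p)
      have "\<bar>gk k x - gk k y\<bar> \<le> \<bar>g x - g y\<bar>" for x y by (auto simp: gk_def max_def min_def)
      then have "\<bar>gk k (W (fst p) h (snd p)) - gk k (fst p)\<bar> \<le> \<bar>D p\<bar>" by (simp add: D)
      then show ?case using elim by simp
    qed
  qed measurable
  moreover have "(\<integral>p. gk k (W (fst p) h (snd p)) - gk k (fst p) \<partial>(\<pi> \<Otimes>\<^sub>M M)) = 0" for k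
  proof -
    have "(\<integral>p. gk k (W (fst p) h (snd p)) - gk k (fst p) \<partial>(\<pi> \<Otimes>\<^sub>M M)) =
      (\<integral>p. gk k (W (fst p) h (snd p)) \<partial>(\<pi> \<Otimes>\<^sub>M M)) - (\<integral>p. gk k (fst p) \<partial>(\<pi> \<Otimes>\<^sub>M M))"
      by (intro Bochner_Integration.integral_diff integrable_pair_bounded[OF _ gk_bound]) measurable
    also have "(\<integral>p. gk k (W (fst p) h (snd p)) \<partial>(\<pi> \<Otimes>\<^sub>M M)) = (\<integral>x. gk k x \<partial>\<pi>)"
      by (rule integral_W[OF h]) measurable
    also have "(\<integral>p. gk k (fst p) \<partial>(\<pi> \<Otimes>\<^sub>M M)) = (\<integral>x. gk k x \<partial>distr (\<pi> \<Otimes>\<^sub>M M) \<pi> fst)"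
      by (rule integral_distr[symmetric]) measurable
    also have "\<dots> = (\<integral>x. gk k x \<partial>\<pi>)" by (simp add: distr_pair_fst)
    finally show ?thesis by simp
  qed
  ultimately show "(\<integral>p. D p \<partial>(\<pi> \<Otimes>\<^sub>M M)) = 0" by (simp add: LIMSEQ_const_iff)
qed

lemma integrable_exp_pi: "0 \<le> a \<Longrightarrow> integrable \<pi> (\<lambda>x. exp (- a * x))"
  using AE_pi_nonneg by (intro pi.integrable_const_bound[where B = 1]) (auto elim: eventually_mono)

text \<open>The step estimate with its uniform constant is integrated over the stationary start. The
  increment has mean 0, so h times the mean drift is O(h^2); dividing by h and letting h tend to 0
  makes the drift vanish.\<close>

lemma laplace_pi:
  assumes a: "0 < a"
  shows "phi a * (\<integral>x. exp (- a * x) \<partial>\<pi>) = a * d1"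
proof -
  define K where "K u = phi a * exp (- a * u) - a * d1" for u
  have intK: "integrable \<pi> K" unfolding K_def[abs_def] using integrable_exp_pi[of a] a by simp
  have bound: "h * \<bar>\<integral>u. K u \<partial>\<pi>\<bar> \<le> step_const a * h\<^sup>2" if h: "0 < h" "h \<le> 1" for h
  proof -
    define D where "D p = (exp (- a * W (fst p) h (snd p)) + a * W (fst p) h (snd p)) - (exp (- a * fst p) + a * fst p)"
      for p
    have D: "integrable (\<pi> \<Otimes>\<^sub>M M) D" "(\<integral>p. D p \<partial>(\<pi> \<Otimes>\<^sub>M M)) = 0"
      unfolding D_def[abs_def] using stationary_increment[OF a, of h] h by auto
    define E where "E u = (\<integral>\<omega>. D (u, \<omega>) \<partial>M)" for u
    have intE: "integrable \<pi> E" and E0: "(\<integral>u. E u \<partial>\<pi>) = 0"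
      unfolding E_def[abs_def] using piM.integrable_fst'[OF D(1)] piM.integral_fst'[OF D(1)] D(2) by auto
    have EK: "\<bar>E u - h * K u\<bar> \<le> step_const a * h\<^sup>2" if u: "0 \<le> u" for u
    proof -
      have int: "integrable M (\<lambda>\<omega>. exp (- a * W u h \<omega>) + a * W u h \<omega>)"
        using integrable_W[of h u] integrable_exp_W[of h a u] a h u by simp
      have "E u = G u a h - (exp (- a * u) + a * u)"
        unfolding E_def D_def G_def using int prob_space by simp
      also have "exp (- a * u) + a * u = G u a 0"
        unfolding G_def using prob_space u
        by (subst Bochner_Integration.integral_cong[OF refl, of _ _ "\<lambda>_. exp (- a * u) + a * u"]) (auto simp: W_0)
      finally have "E u = G u a h - G u a 0" .
      moreover have "F u a 0 = exp (- a * u)"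
        unfolding F_def using prob_space u
        by (subst Bochner_Integration.integral_cong[OF refl, of _ _ "\<lambda>_. exp (- a * u)"]) (auto simp: W_0)
      ultimately show ?thesis using G_step[OF u order_refl _ h(2) a] h by (simp add: K_def)
    qed
    have "h * (\<integral>u. K u \<partial>\<pi>) = (\<integral>u. h * K u - E u \<partial>\<pi>)" using intE intK E0 by simp
    then have "h * \<bar>\<integral>u. K u \<partial>\<pi>\<bar> = \<bar>\<integral>u. h * K u - E u \<partial>\<pi>\<bar>" by (metis abs_mult abs_of_pos h(1))
    also have "\<dots> \<le> (\<integral>u. step_const a * h\<^sup>2 \<partial>\<pi>)"
    proof (rule order_trans[OF integral_abs_bound integral_mono_AE])
      show "AE u in \<pi>. \<bar>h * K u - E u\<bar> \<le> step_const a * h\<^sup>2"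
        using AE_pi_nonneg by eventually_elim (use EK in \<open>auto simp: abs_minus_commute\<close>)
    qed (use intE intK in auto)
    finally show ?thesis using pi.prob_space by simp
  qed
  have "\<bar>\<integral>u. K u \<partial>\<pi>\<bar> \<le> 0"
  proof (rule tendsto_lowerbound)
    have "((\<lambda>h. step_const a * h) \<longlongrightarrow> step_const a * 0) (at_right 0)" by (intro tendsto_intros)
    then show "((\<lambda>h. step_const a * h) \<longlongrightarrow> 0) (at_right 0)" by simp
    show "\<forall>\<^sub>F h in at_right 0. \<bar>\<integral>u. K u \<partial>\<pi>\<bar> \<le> step_const a * h"
      using eventually_at_right_real[OF zero_less_one]
    proof eventually_elim
      case (elim h)
      then show ?case using bound[of h] by (auto simp: power2_eq_square)
    qed
  qed simp
  then have "(\<integral>u. K u \<partial>\<pi>) = 0" by simp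
  then show ?thesis
    unfolding K_def[abs_def] using integrable_exp_pi[of a] a pi.prob_space by simp
qed

text \<open>The workload from \<open>v\<close> and the one from a stationary start share the input.
  With \<open>v\<close> below a level \<open>K\<close>, they differ at t only if the stationary
  start exceeds \<open>K\<close> or the loss has not yet reached \<open>K\<close>.\<close>

lemma expectation_bounded_limit:
  fixes f :: "real \<Rightarrow> real"
  assumes f[measurable]: "f \<in> borel_measurable borel" and B: "\<And>x. \<bar>f x\<bar> \<le> B"
  shows "((\<lambda>t. \<integral>\<omega>. f (W v t \<omega>) \<partial>M) \<longlongrightarrow> (\<integral>x. f x \<partial>\<pi>)) at_top"
proof (rule tendsto_if_bound_eps)
  fix e :: real assume e: "0 < e"
  have B0: "0 \<le> B" using B[of 0] by linarith
  \<comment> \<open>Two values of \<open>f\<close> differ by at most 2 B, so a tail of mass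
    \<open>\<delta>\<close> costs at most \<open>e\<close>; the 1 covers B = 0.\<close>
  define \<delta> where "\<delta> = e / (2 * B + 1)"
  have \<delta>: "0 < \<delta>" "2 * B * \<delta> \<le> e" using e B0 by (simp_all add: \<delta>_def field_simps)
  have tail: "((\<lambda>K. pi.prob {K<..}) \<longlongrightarrow> 0) at_top"
  proof -
    have "((\<lambda>K. 1 - pi.prob {..K}) \<longlongrightarrow> 1 - 1) at_top"
      using real_distribution.cdf_lim_at_top_prob[of \<pi>] prob_pi
      by (intro tendsto_intros) (auto simp: real_distribution_def real_distribution_axioms_def cdf_def[abs_def] intro!: sets_eq_imp_space_eq[of _ borel, simplified])
    moreover have "1 - pi.prob {..K} = pi.prob {K<..}" for K
    proof -
      have "space \<pi> - {..K} = {K<..}" by (auto simp: sets_eq_imp_space_eq[OF sets_pi])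
      then show ?thesis using pi.prob_compl[of "{..K}"] by simp
    qed
    ultimately show ?thesis by simp
  qed
  have "\<forall>\<^sub>F K in at_top. pi.prob {K<..} < \<delta> \<and> v \<le> K"
    using order_tendstoD(2)[OF tail \<delta>(1)] eventually_ge_at_top[of v] by (rule eventually_conj)
  then obtain K where K: "pi.prob {K<..} < \<delta>" "v \<le> K"
    by (auto simp: eventually_at_top_linorder)
  have bound: "\<bar>(\<integral>\<omega>. f (W v t \<omega>) \<partial>M) - (\<integral>x. f x \<partial>\<pi>)\<bar> \<le> e + 2 * B * prob {\<omega> \<in> space M. L t \<omega> < K}"
    if t: "0 \<le> t" for t
  proof -
    let ?A = "{\<omega> \<in> space M. L t \<omega> < K}"
    have [measurable]: "?A \<in> sets M" using t by measurable
    have [measurable]: "(\<lambda>p. W (fst p) t (snd p)) \<in> borel_measurable (\<pi> \<Otimes>\<^sub>M M)" "W v t \<in> borel_measurable M"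
      using t by measurable
    have i1: "integrable M (\<lambda>\<omega>. f (W v t \<omega>))"
      by (rule integrable_const_bound[where B = B]) (use B in auto)
    have i2: "integrable (\<pi> \<Otimes>\<^sub>M M) (\<lambda>p. f (W (fst p) t (snd p)))"
      by (rule integrable_pair_bounded) (use B in auto)
    have i3: "integrable M (indicat_real ?A)" "integrable \<pi> (indicat_real {K<..})"
      by (auto intro!: integrable_real_indicator simp: less_top[symmetric])
    have i4: "integrable (\<pi> \<Otimes>\<^sub>M M) (\<lambda>p. indicat_real {K<..} (fst p))" 
      by (rule integrable_pair_bounded[where B = 1]) (auto simp: indicator_def)
    have e4: "(\<integral>p. indicat_real {K<..} (fst p) \<partial>(\<pi> \<Otimes>\<^sub>M M)) = pi.prob {K<..}"
    proof -
      have "(\<integral>p. indicat_real {K<..} (fst p) \<partial>(\<pi> \<Otimes>\<^sub>M M)) = (\<integral>x. indicat_real {K<..} x \<partial>distr (\<pi> \<Otimes>\<^sub>M M) \<pi> fst)"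
        by (rule integral_distr[symmetric]) measurable
      then show ?thesis by (simp add: distr_pair_fst)
    qed
    have "(\<integral>\<omega>. f (W v t \<omega>) \<partial>M) - (\<integral>x. f x \<partial>\<pi>) =
        (\<integral>p. f (W v t (snd p)) - f (W (fst p) t (snd p)) \<partial>(\<pi> \<Otimes>\<^sub>M M))"
      using integrable_snd[OF i1] i2 integral_W[OF t f] by simp
    also have "\<bar>\<dots>\<bar> \<le> (\<integral>p. 2 * B * (indicat_real {K<..} (fst p) + indicat_real ?A (snd p)) \<partial>(\<pi> \<Otimes>\<^sub>M M))"
    proof (rule order_trans[OF integral_abs_bound integral_mono_AE])
      show "AE p in \<pi> \<Otimes>\<^sub>M M. \<bar>f (W v t (snd p)) - f (W (fst p) t (snd p))\<bar>
          \<le> 2 * B * (indicat_real {K<..} (fst p) + indicat_real ?A (snd p))"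
        using AE_pair_nonneg
      proof eventually_elim
        case (elim p)
        show ?case
        proof (cases "fst p \<le> K \<and> K \<le> L t (snd p)")
          case True
          then have "W v t (snd p) = W (fst p) t (snd p)" using K by (intro W_coupled) auto
          then show ?thesis using B0 by simp
        next
          case False
          then have "1 \<le> indicat_real {K<..} (fst p) + indicat_real ?A (snd p)"
            using elim by (auto simp: indicator_def)
          then have "2 * B * 1 \<le> 2 * B * (indicat_real {K<..} (fst p) + indicat_real ?A (snd p))"
            using B0 by (intro mult_left_mono) auto
          moreover have "\<bar>f (W v t (snd p)) - f (W (fst p) t (snd p))\<bar> \<le> 2 * B"
            using B[of "W v t (snd p)"] B[of "W (fst p) t (snd p)"] by linarith
          ultimately show ?thesis by linarith
        qed
      qed
    qed (use i2 i4 integrable_snd(1)[OF i1] integrable_snd(1)[OF i3(1)] in auto)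
    also have "\<dots> = 2 * B * (pi.prob {K<..} + prob ?A)"
      using i4 e4 integrable_snd[OF i3(1)] by simp
    also have "\<dots> \<le> 2 * B * \<delta> + 2 * B * prob ?A"
      using K(1) B0 by (simp add: distrib_left mult_left_mono)
    finally show ?thesis using \<delta>(2) by linarith
  qed
  show "\<exists>q. (q \<longlongrightarrow> 0) at_top \<and> (\<forall>\<^sub>F t in at_top. \<bar>(\<integral>\<omega>. f (W v t \<omega>) \<partial>M) - (\<integral>x. f x \<partial>\<pi>)\<bar> \<le> e + q t)"
    using tendsto_mult_left[OF prob_L_less[of K], of "2 * B"] bound
    by (intro exI[of _ "\<lambda>t. 2 * B * prob {\<omega> \<in> space M. L t \<omega> < K}"])
       (auto intro!: eventually_mono[OF eventually_ge_at_top[of 0]])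
qed

end

text \<open>The left side is the distribution function of the Gamma law of shape 2, whose density y
  exp (- y) is at most y.\<close>

lemma gamma_gap_le:
  fixes y :: real
  assumes "0 \<le> y"
  shows "1 - exp (- y) - y * exp (- y) \<le> y\<^sup>2 / 2"
proof -
  have "0\<^sup>2 / 2 - (1 - exp (- 0) - 0 * exp (- 0)) \<le> y\<^sup>2 / 2 - (1 - exp (- y) - y * exp (- y))"
  proof (rule DERIV_nonneg_imp_nondecreasing[OF assms])
    fix x :: real assume "0 \<le> x" "x \<le> y"
    then show "\<exists>d. ((\<lambda>y. y\<^sup>2 / 2 - (1 - exp (- y) - y * exp (- y))) has_real_derivative d) (at x) \<and> 0 \<le> d"
      by (intro exI[of _ "x * (1 - exp (- x))"]) (auto intro!: derivative_eq_intros mult_left_le simp: algebra_simps)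
  qed
  then show ?thesis by simp
qed

section \<open>Convergence of the sampled laws, including infinite moments\<close>

context stationary_storage
begin

context
  fixes \<xi> :: real assumes \<xi>: "0 < \<xi>"
begin

lemma law_bounded_limit:
  fixes f :: "real \<Rightarrow> real"
  assumes f[measurable]: "f \<in> borel_measurable borel" and B: "\<And>x. 0 \<le> f x" "\<And>x. f x \<le> B"
  shows "(\<lambda>n. \<integral>x. f x \<partial>law \<xi> n v) \<longlonglongrightarrow> (\<integral>x. f x \<partial>\<pi>)"
proof -
  have int: "integrable M (\<lambda>\<omega>. f (W v t \<omega>))" if "0 \<le> t" for t
    using B that by (intro integrable_const_bound[where B = B]) auto
  have bound: "(\<integral>\<omega>. f (W v t \<omega>) \<partial>M) \<le> B + 0 * t" if "0 \<le> t" for t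
    using integral_mono[OF int[OF that] integrable_const, of B] B prob_space by simp
  note e = law_expectation[OF \<xi> f B(1) int bound]
  have nn: "0 \<le> (\<integral>\<omega>. f (W v (max 0 t) \<omega>) \<partial>M)" for t using B by simp
  have "(\<lambda>n. \<integral>t. (\<integral>\<omega>. f (W v (max 0 t) \<omega>) \<partial>M) \<partial>density lborel (erlang_density n \<xi>)) \<longlonglongrightarrow> (\<integral>x. f x \<partial>\<pi>)"
  proof (rule erlang_integral_limit[OF \<xi> e(1), where B = B])
    show "\<bar>\<integral>\<omega>. f (W v (max 0 t) \<omega>) \<partial>M\<bar> \<le> B" for t
      using nn[of t] bound[of "max 0 t"] by simp
    have "((\<lambda>t. \<integral>\<omega>. f (W v t \<omega>) \<partial>M) \<longlongrightarrow> (\<integral>x. f x \<partial>\<pi>)) at_top"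
      using B by (intro expectation_bounded_limit[where B = B]) (auto simp: abs_le_iff intro: order_trans)
    then show "((\<lambda>t. \<integral>\<omega>. f (W v (max 0 t) \<omega>) \<partial>M) \<longlongrightarrow> (\<integral>x. f x \<partial>\<pi>)) at_top"
      by (rule Lim_transform_eventually) (auto intro!: eventually_mono[OF eventually_ge_at_top[of 0]])
  qed
  then show ?thesis
    by (simp add: e(3) erlang_real_eq[OF \<xi> e(1)])
qed

text \<open>The functional at W + v is split by \<open>add\<close>: weight 1 + e goes to the
  stationary workload, and the cost of \<open>v\<close> is charged only where the loss at the epoch
  is below \<open>v\<close>. \<open>q n\<close> is the probability of that event; it does not depend
  on \<open>e\<close>, so \<open>e\<close> can be fixed before n grows.\<close>

lemma law_nn_integral_le:
  fixes f :: "real \<Rightarrow> real"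
  assumes f[measurable]: "f \<in> borel_measurable borel" and nn: "\<And>x. 0 \<le> x \<Longrightarrow> 0 \<le> f x"
    and mono: "\<And>x y. 0 \<le> x \<Longrightarrow> x \<le> y \<Longrightarrow> f x \<le> f y"
    and add: "\<And>x y e. 0 \<le> x \<Longrightarrow> 0 \<le> y \<Longrightarrow> 0 < e \<Longrightarrow> f (x + y) \<le> (1 + e) * f x + (1 + 1 / e) * f y"
    and v: "0 \<le> v"
  shows "\<exists>q. q \<longlonglongrightarrow> 0 \<and> (\<forall>e>0. \<forall>n. (\<integral>\<^sup>+x. f x \<partial>law \<xi> n v) \<le>
     ennreal (1 + e) * (\<integral>\<^sup>+x. f x \<partial>\<pi>) + ennreal ((1 + 1 / e) * f v * q n))"
proof -
  define q where "q n = (\<integral>t. prob {\<omega> \<in> space M. L (max 0 t) \<omega> < v} \<partial>density lborel (erlang_density n \<xi>))" for n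
  have joint: "{p \<in> space (borel \<Otimes>\<^sub>M M). L (max 0 (fst p)) (snd p) < v} \<in> sets (borel \<Otimes>\<^sub>M M)"
    using L_meas_joint[OF refl J_meas] by (auto simp: case_prod_beta')
  have meas: "(\<lambda>t. prob {\<omega> \<in> space M. L (max 0 t) \<omega> < v}) \<in> borel_measurable borel"
  proof -
    have "(\<lambda>t. enn2real (emeasure M (Pair t -` {p \<in> space (borel \<Otimes>\<^sub>M M). L (max 0 (fst p)) (snd p) < v}))) \<in> borel_measurable borel"
      using measurable_emeasure_Pair[OF joint] by simp
    also have "(\<lambda>t. enn2real (emeasure M (Pair t -` {p \<in> space (borel \<Otimes>\<^sub>M M). L (max 0 (fst p)) (snd p) < v}))) =
      (\<lambda>t. prob {\<omega> \<in> space M. L (max 0 t) \<omega> < v})"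
      by (intro ext arg_cong[where f = enn2real]) (auto simp: measure_def space_pair_measure intro!: arg_cong[where f = "\<lambda>A. enn2real (emeasure M A)"])
    finally show ?thesis .
  qed
  have "q \<longlonglongrightarrow> 0"
    unfolding q_def
  proof (rule erlang_integral_limit[OF \<xi> meas, where B = 1])
    show "((\<lambda>t. prob {\<omega> \<in> space M. L (max 0 t) \<omega> < v}) \<longlongrightarrow> 0) at_top"
      using prob_L_less by (rule Lim_transform_eventually) (auto intro!: eventually_mono[OF eventually_ge_at_top[of 0]])
  qed auto
  moreover have "(\<integral>\<^sup>+x. f x \<partial>law \<xi> n v) \<le>
     ennreal (1 + e) * (\<integral>\<^sup>+x. f x \<partial>\<pi>) + ennreal ((1 + 1 / e) * f v * q n)" if e: "0 < e" for e n
  proof -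
    let ?m = "\<integral>\<^sup>+x. ennreal (f x) \<partial>\<pi>"
    have step: "(\<integral>\<^sup>+\<omega>. f (W v t \<omega>) \<partial>M) \<le> ennreal (1 + e) * ?m + ennreal ((1 + 1 / e) * f v) * emeasure M {\<omega> \<in> space M. L t \<omega> < v}"
      if t: "0 \<le> t" for t
    proof -
      let ?A = "{\<omega> \<in> space M. L t \<omega> < v}"
      have [measurable]: "?A \<in> sets M" using t by measurable
      have [measurable]: "(\<lambda>p. W (fst p) t (snd p)) \<in> borel_measurable (\<pi> \<Otimes>\<^sub>M M)" "W v t \<in> borel_measurable M"
        using t by measurable
      have nn_snd: "(\<integral>\<^sup>+p. g (snd p) \<partial>(\<pi> \<Otimes>\<^sub>M M)) = (\<integral>\<^sup>+\<omega>. g \<omega> \<partial>M)" if "g \<in> borel_measurable M" for g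
        using nn_integral_fst[of "\<lambda>p. g (snd p)" \<pi>] that by (simp add: pi.emeasure_space_1)
      have "(\<integral>\<^sup>+\<omega>. f (W v t \<omega>) \<partial>M) = (\<integral>\<^sup>+p. f (W v t (snd p)) \<partial>(\<pi> \<Otimes>\<^sub>M M))"
        by (rule nn_snd[symmetric]) measurable
      also have "\<dots> \<le> (\<integral>\<^sup>+p. ennreal (1 + e) * f (W (fst p) t (snd p)) + ennreal ((1 + 1 / e) * f v) * indicator ?A (snd p) \<partial>(\<pi> \<Otimes>\<^sub>M M))"
      proof (rule nn_integral_mono_AE, use AE_pair_nonneg in eventually_elim)
        case (elim p)
        have W0: "0 \<le> W (fst p) t (snd p)" "0 \<le> W v t (snd p)" using elim t by (auto intro: W_nonneg)
        show ?case
        proof (cases "snd p \<in> ?A")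
          case True
          then have "W v t (snd p) \<le> W (fst p) t (snd p) + v" using W_diff_le[of "snd p" t v "fst p"] elim t v by simp
          then have "f (W v t (snd p)) \<le> f (W (fst p) t (snd p) + v)" using W0 by (intro mono)
          also have "\<dots> \<le> (1 + e) * f (W (fst p) t (snd p)) + (1 + 1 / e) * f v" using W0 v e by (intro add)
          finally have "ennreal (f (W v t (snd p))) \<le> ennreal ((1 + e) * f (W (fst p) t (snd p)) + (1 + 1 / e) * f v)"
            by (rule ennreal_leI)
          then show ?thesis using True e nn[OF W0(1)] nn[OF v] by (simp add: ennreal_mult)
        next
          case False
          then have "W v t (snd p) \<le> W (fst p) t (snd p)" using W_diff_le[of "snd p" t v "fst p"] elim t v by simp
          then have "f (W v t (snd p)) \<le> f (W (fst p) t (snd p))" using W0 by (intro mono)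
          also have "\<dots> \<le> (1 + e) * f (W (fst p) t (snd p))" using e nn[OF W0(1)] by (simp add: algebra_simps)
          finally have "ennreal (f (W v t (snd p))) \<le> ennreal ((1 + e) * f (W (fst p) t (snd p)))"
            by (rule ennreal_leI)
          then show ?thesis using False e nn[OF W0(1)] by (simp add: ennreal_mult)
        qed
      qed
      also have "\<dots> = ennreal (1 + e) * (\<integral>\<^sup>+p. f (W (fst p) t (snd p)) \<partial>(\<pi> \<Otimes>\<^sub>M M)) +
          ennreal ((1 + 1 / e) * f v) * (\<integral>\<^sup>+p. indicator ?A (snd p) \<partial>(\<pi> \<Otimes>\<^sub>M M))"
        by (subst nn_integral_add) (simp_all add: nn_integral_cmult)
      also have "(\<integral>\<^sup>+p. f (W (fst p) t (snd p)) \<partial>(\<pi> \<Otimes>\<^sub>M M)) = ?m"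
        using nn_integral_W[OF t, of "\<lambda>x. ennreal (f x)"] by simp
      also have "(\<integral>\<^sup>+p. indicator ?A (snd p) \<partial>(\<pi> \<Otimes>\<^sub>M M)) = emeasure M ?A"
        by (subst nn_snd) auto
      finally show ?thesis .
    qed
    interpret E: prob_space "density lborel (erlang_density n \<xi>)" by (rule prob_space_erlang_density[OF \<xi>])
    have "(\<integral>\<^sup>+x. f x \<partial>law \<xi> n v) = (\<integral>\<^sup>+t. (\<integral>\<^sup>+\<omega>. f (W v (max 0 t) \<omega>) \<partial>M) \<partial>density lborel (erlang_density n \<xi>))"
      by (rule nn_integral_law[OF \<xi>]) measurable
    also have "\<dots> \<le> (\<integral>\<^sup>+t. ennreal (1 + e) * ?m + ennreal ((1 + 1 / e) * f v) * ennreal (prob {\<omega> \<in> space M. L (max 0 t) \<omega> < v})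
        \<partial>density lborel (erlang_density n \<xi>))"
      by (intro nn_integral_mono) (use step in \<open>auto simp: emeasure_eq_measure\<close>)
    also have "\<dots> = ennreal (1 + e) * ?m + ennreal ((1 + 1 / e) * f v) * (\<integral>\<^sup>+t. ennreal (prob {\<omega> \<in> space M. L (max 0 t) \<omega> < v})
        \<partial>density lborel (erlang_density n \<xi>))"
      using meas E.emeasure_space_1 by (subst nn_integral_add) (simp_all add: nn_integral_cmult)
    also have "(\<integral>\<^sup>+t. ennreal (prob {\<omega> \<in> space M. L (max 0 t) \<omega> < v}) \<partial>density lborel (erlang_density n \<xi>)) = ennreal (q n)"
      unfolding q_def using meas by (intro nn_integral_eq_integral E.integrable_const_bound[where B = 1]) auto
    also have "ennreal ((1 + 1 / e) * f v) * ennreal (q n) = ennreal ((1 + 1 / e) * f v * q n)"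
      using e nn[OF v] by (intro ennreal_mult[symmetric]) (auto simp: q_def)
    finally show ?thesis .
  qed
  ultimately show ?thesis by blast
qed

text \<open>Lower bound: truncate \<open>f\<close> and use convergence of bounded expectations.
  Upper bound: the comparison above, needed only when the stationary integral is finite. Hence the
  limit holds also when it is infinite.\<close>

lemma law_nn_limit:
  fixes f :: "real \<Rightarrow> real"
  assumes f[measurable]: "f \<in> borel_measurable borel" and nn: "\<And>x. 0 \<le> x \<Longrightarrow> 0 \<le> f x"
    and mono: "\<And>x y. 0 \<le> x \<Longrightarrow> x \<le> y \<Longrightarrow> f x \<le> f y"
    and add: "\<And>x y e. 0 \<le> x \<Longrightarrow> 0 \<le> y \<Longrightarrow> 0 < e \<Longrightarrow> f (x + y) \<le> (1 + e) * f x + (1 + 1 / e) * f y"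
    and v: "0 \<le> v"
  shows "(\<lambda>n. \<integral>\<^sup>+x. f x \<partial>law \<xi> n v) \<longlonglongrightarrow> (\<integral>\<^sup>+x. f x \<partial>\<pi>)"
proof (rule order_tendstoI)
  fix c assume c: "c < (\<integral>\<^sup>+x. f x \<partial>\<pi>)"
  define fk where "fk k x = max 0 (min (f x) (real k))" for k x
  have [measurable]: "fk k \<in> borel_measurable borel" for k unfolding fk_def[abs_def] by measurable
  have fk: "0 \<le> fk k x" "fk k x \<le> real k" "0 \<le> x \<Longrightarrow> fk k x \<le> f x" for k x using nn by (auto simp: fk_def)
  have "(\<lambda>k. \<integral>\<^sup>+x. ennreal (fk k x) \<partial>\<pi>) \<longlonglongrightarrow> (\<integral>\<^sup>+x. f x \<partial>\<pi>)"
  proof (rule nn_integral_LIMSEQ)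
    show "incseq (\<lambda>k x. ennreal (fk k x))"
      by (auto simp: incseq_def le_fun_def fk_def intro!: ennreal_leI)
    show "(\<lambda>k. ennreal (fk k x)) \<longlonglongrightarrow> ennreal (f x)" for x
    proof (rule tendsto_eventually)
      have "\<forall>\<^sub>F k in sequentially. f x \<le> real k"
        using filterlim_real_sequentially by (simp add: filterlim_at_top)
      then show "\<forall>\<^sub>F k in sequentially. ennreal (fk k x) = ennreal (f x)"
        by eventually_elim (auto simp: fk_def max_def ennreal_neg)
    qed
  qed measurable
  from order_tendstoD(1)[OF this c] obtain k where k: "c < (\<integral>\<^sup>+x. ennreal (fk k x) \<partial>\<pi>)"
    by (auto simp: eventually_sequentially)
  have lim: "(\<lambda>n. ennreal (\<integral>x. fk k x \<partial>law \<xi> n v)) \<longlonglongrightarrow> ennreal (\<integral>x. fk k x \<partial>\<pi>)"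
    by (intro tendsto_ennrealI law_bounded_limit) (use fk in auto)
  have eq: "ennreal (\<integral>x. fk k x \<partial>\<pi>) = (\<integral>\<^sup>+x. ennreal (fk k x) \<partial>\<pi>)"
    by (intro nn_integral_eq_integral[symmetric] pi.integrable_const_bound[where B = "real k"]) (use fk in auto)
  have le: "ennreal (\<integral>x. fk k x \<partial>law \<xi> n v) \<le> (\<integral>\<^sup>+x. f x \<partial>law \<xi> n v)" for n
  proof -
    interpret l: prob_space "law \<xi> n v" by (rule prob_space_law[OF \<xi>])
    have "ennreal (\<integral>x. fk k x \<partial>law \<xi> n v) = (\<integral>\<^sup>+x. ennreal (fk k x) \<partial>law \<xi> n v)"
      by (intro nn_integral_eq_integral[symmetric] l.integrable_const_bound[where B = "real k"]) (use fk in auto)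
    also have "\<dots> \<le> (\<integral>\<^sup>+x. f x \<partial>law \<xi> n v)"
      by (intro nn_integral_mono_AE eventually_mono[OF AE_law_nonneg[OF \<xi>]] ennreal_leI fk)
    finally show ?thesis .
  qed
  show "\<forall>\<^sub>F n in sequentially. c < (\<integral>\<^sup>+x. f x \<partial>law \<xi> n v)"
    using order_tendstoD(1)[OF lim k[folded eq]] by (rule eventually_mono) (rule less_le_trans[OF _ le])
next
  fix c assume c: "(\<integral>\<^sup>+x. f x \<partial>\<pi>) < c"
  define m where "m = enn2real (\<integral>\<^sup>+x. f x \<partial>\<pi>)"
  have m: "(\<integral>\<^sup>+x. f x \<partial>\<pi>) = ennreal m" "0 \<le> m"
    unfolding m_def using c by (auto simp: less_top[symmetric] intro!: ennreal_enn2real[symmetric])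
  obtain r where r: "m < r" "ennreal r \<le> c"
  proof (cases c)
    case (real r)
    then show ?thesis using c m that[of r] by (simp add: ennreal_less_iff)
  next
    case top
    then show ?thesis using that[of "m + 1"] by simp
  qed
  \<comment> \<open>Chosen so that e (m + 1) is half of r - m; this leaves room below
    \<open>r\<close>, and the 1 covers m = 0.\<close>
  define e where "e = (r - m) / (2 * (m + 1))"
  have e: "0 < e" "(1 + e) * m < r"
  proof -
    show "0 < e" using r m(2) by (simp add: e_def)
    have "e * (2 * (m + 1)) = r - m" using m(2) by (simp add: e_def)
    then have "e * m = (r - m) / 2 - e" by (simp add: algebra_simps)
    then show "(1 + e) * m < r" using \<open>0 < e\<close> r by (simp add: algebra_simps)
  qed
  obtain q where q: "q \<longlonglongrightarrow> 0" "\<And>e n. 0 < e \<Longrightarrow> (\<integral>\<^sup>+x. f x \<partial>law \<xi> n v) \<le>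
     ennreal (1 + e) * (\<integral>\<^sup>+x. f x \<partial>\<pi>) + ennreal ((1 + 1 / e) * f v * q n)"
    using law_nn_integral_le[OF f nn mono add v] by blast
  have "(\<lambda>n. (1 + e) * m + max 0 ((1 + 1 / e) * f v * q n)) \<longlonglongrightarrow> (1 + e) * m + max 0 ((1 + 1 / e) * f v * 0)"
    by (intro tendsto_intros q)
  then have "\<forall>\<^sub>F n in sequentially. (1 + e) * m + max 0 ((1 + 1 / e) * f v * q n) < r"
    using e by (intro order_tendstoD(2)[of _ "(1 + e) * m"]) auto
  then show "\<forall>\<^sub>F n in sequentially. (\<integral>\<^sup>+x. f x \<partial>law \<xi> n v) < c"
  proof eventually_elim
    case (elim n)
    have "(\<integral>\<^sup>+x. f x \<partial>law \<xi> n v) \<le> ennreal (1 + e) * ennreal m + ennreal ((1 + 1 / e) * f v * q n)"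
      using q(2)[OF e(1), of n] by (simp only: m)
    also have "\<dots> = ennreal ((1 + e) * m) + ennreal (max 0 ((1 + 1 / e) * f v * q n))"
    proof -
      have "ennreal (1 + e) * ennreal m = ennreal ((1 + e) * m)"
        using e m(2) by (intro ennreal_mult[symmetric]) auto
      moreover have "ennreal x = ennreal (max 0 x)" for x by (simp add: max_def ennreal_neg)
      ultimately show ?thesis by metis
    qed
    also have "\<dots> = ennreal ((1 + e) * m + max 0 ((1 + 1 / e) * f v * q n))"
      using e m(2) by (intro ennreal_plus[symmetric]) auto
    also have "\<dots> < ennreal r" using elim r(1) m(2) by (intro ennreal_lessI) auto
    finally show ?case using r(2) by (rule less_le_trans)
  qed
qed

lemma law_mean_limit: "0 \<le> v \<Longrightarrow> (\<lambda>n. \<integral>\<^sup>+x. ennreal x \<partial>law \<xi> n v) \<longlonglongrightarrow> (\<integral>\<^sup>+x. ennreal x \<partial>\<pi>)"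
  by (rule law_nn_limit[where f = "\<lambda>x. x"]) (auto simp: algebra_simps)

lemma law_square_limit: "0 \<le> v \<Longrightarrow> (\<lambda>n. \<integral>\<^sup>+x. ennreal (x\<^sup>2) \<partial>law \<xi> n v) \<longlonglongrightarrow> (\<integral>\<^sup>+x. ennreal (x\<^sup>2) \<partial>\<pi>)"
proof (rule law_nn_limit[where f = "\<lambda>x. x\<^sup>2"])
  fix x y e :: real assume "0 < e"
  have "0 \<le> (e * x - y)\<^sup>2 / e" using \<open>0 < e\<close> by simp
  also have "\<dots> = e * x\<^sup>2 - 2 * x * y + (1 / e) * y\<^sup>2" using \<open>0 < e\<close> by (simp add: power2_eq_square field_simps)
  finally show "(x + y)\<^sup>2 \<le> (1 + e) * x\<^sup>2 + (1 + 1 / e) * y\<^sup>2" by (simp add: power2_sum algebra_simps)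
qed (auto intro: power_mono)

end

end

section \<open>Moments and limits\<close>

text \<open>Used both for \<pi> and for every law of the sampled workload, so that their moments are
  extracted from Laplace transforms by the same limits.\<close>

locale nonneg_law = prob_space N for N :: "real measure" +
  assumes sets_N [measurable_cong, simp]: "sets N = sets borel" and AE_nonneg: "AE x in N. 0 \<le> x"
begin

definition lt :: "real \<Rightarrow> real" where "lt a = (\<integral>x. exp (- a * x) \<partial>N)"
definition lt1 :: "real \<Rightarrow> real" where "lt1 a = (\<integral>x. x * exp (- a * x) \<partial>N)"

lemma integrable_lt: "0 \<le> a \<Longrightarrow> integrable N (\<lambda>x. exp (- a * x))"
  using AE_nonneg by (intro integrable_const_bound[where B = 1]) (auto elim: eventually_mono)

lemma integrable_lt1: "0 < a \<Longrightarrow> integrable N (\<lambda>x. x * exp (- a * x))"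
proof (rule integrable_const_bound[where B = "1 / a"])
  assume a: "0 < a"
  show "AE x in N. norm (x * exp (- a * x)) \<le> 1 / a"
    using AE_nonneg
  proof eventually_elim
    case (elim x)
    have "x * exp (- a * x) \<le> (1 / a) * exp (a * x) * exp (- a * x)"
      using power_le_exp[OF a elim, of 1] by (intro mult_right_mono) auto
    also have "\<dots> = 1 / a" by (simp flip: exp_add)
    finally show ?case using elim by simp
  qed
qed simp

lemma DERIV_lt: "0 < a \<Longrightarrow> (lt has_real_derivative - lt1 a) (at a)"
proof -
  assume a: "0 < a"
  have "((\<lambda>a. \<integral>x. 0 + 1 * exp (- a * x) \<partial>N) has_real_derivative - (\<integral>x. 1 * (x * exp (- a * x)) \<partial>N)) (at a)"
    by (rule has_real_derivative_laplace) (use a AE_nonneg integrable_lt integrable_lt1 in auto)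
  then show ?thesis by (simp add: lt_def[abs_def] lt1_def)
qed

lemma lt_le_1: "0 \<le> a \<Longrightarrow> lt a \<le> 1"
proof -
  assume a: "0 \<le> a"
  have "lt a \<le> (\<integral>x. 1 \<partial>N)"
    unfolding lt_def using a AE_nonneg
    by (intro integral_mono_AE integrable_lt) (auto elim: eventually_mono)
  then show ?thesis using prob_space by simp
qed

lemma mean_limit: "((\<lambda>a. ennreal ((1 - lt a) / a)) \<longlongrightarrow> (\<integral>\<^sup>+x. ennreal x \<partial>N)) (at_right 0)"
proof -
  have eq: "(\<integral>\<^sup>+x. ennreal ((1 - exp (- a * x)) / a) \<partial>N) = ennreal ((1 - lt a) / a)" if a: "0 < a" for a
  proof -
    have int: "integrable N (\<lambda>x. (1 - exp (- a * x)) / a)" using integrable_lt[of a] a by simp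
    have nn: "AE x in N. 0 \<le> (1 - exp (- a * x)) / a"
      using AE_nonneg by eventually_elim (use a in auto)
    have "(\<integral>x. (1 - exp (- a * x)) / a \<partial>N) = (1 - lt a) / a"
      unfolding lt_def using integrable_lt[of a] a prob_space by simp
    then show ?thesis using nn_integral_eq_integral[OF int nn] by metis
  qed
  have "((\<lambda>a. \<integral>\<^sup>+x. ennreal ((1 - exp (- a * x)) / a) \<partial>N) \<longlongrightarrow> (\<integral>\<^sup>+x. ennreal x \<partial>N)) (at_right 0)"
    by (rule nn_integral_exp_minus_limit1) (use AE_nonneg in auto)
  then show ?thesis
    by (rule Lim_transform_eventually) (rule eventually_mono[OF eventually_at_right_less eq])
qed

lemma mean_limit_real:
  assumes int: "integrable N (\<lambda>x. x)"
  shows "((\<lambda>a. (1 - lt a) / a) \<longlongrightarrow> (\<integral>x. x \<partial>N)) (at_right 0)"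
proof (rule tendsto_ennrealD)
  show "((\<lambda>a. ennreal ((1 - lt a) / a)) \<longlongrightarrow> ennreal (\<integral>x. x \<partial>N)) (at_right 0)"
    using mean_limit nn_integral_eq_integral[OF int AE_nonneg] by simp
  show "\<forall>\<^sub>F a in at_right 0. 0 \<le> (1 - lt a) / a"
    by (rule eventually_mono[OF eventually_at_right_less]) (simp add: lt_le_1)
  show "0 \<le> (\<integral>x. x \<partial>N)" by (rule integral_nonneg_AE[OF AE_nonneg])
qed

lemma second_moment_limit:
  assumes int: "integrable N (\<lambda>x. x)"
  shows "((\<lambda>a. ennreal ((lt a - 1 + a * (\<integral>x. x \<partial>N)) / a\<^sup>2)) \<longlongrightarrow> (\<integral>\<^sup>+x. ennreal (x\<^sup>2 / 2) \<partial>N)) (at_right 0)"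
    and "\<And>a. 0 < a \<Longrightarrow> 0 \<le> (lt a - 1 + a * (\<integral>x. x \<partial>N)) / a\<^sup>2"
proof -
  have eq: "(\<integral>\<^sup>+x. ennreal ((exp (- a * x) - 1 + a * x) / a\<^sup>2) \<partial>N) = ennreal ((lt a - 1 + a * (\<integral>x. x \<partial>N)) / a\<^sup>2)"
    and nn2: "0 \<le> (lt a - 1 + a * (\<integral>x. x \<partial>N)) / a\<^sup>2"
    if a: "0 < a" for a
  proof -
    have i: "integrable N (\<lambda>x. (exp (- a * x) - 1 + a * x) / a\<^sup>2)" using integrable_lt[of a] a int by simp
    have nn: "AE x in N. 0 \<le> (exp (- a * x) - 1 + a * x) / a\<^sup>2"
    proof (rule AE_I2)
      fix x show "0 \<le> (exp (- a * x) - 1 + a * x) / a\<^sup>2" using exp_minus_ge1[of "a * x"] by simp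
    qed
    have e: "(\<integral>x. (exp (- a * x) - 1 + a * x) / a\<^sup>2 \<partial>N) = (lt a - 1 + a * (\<integral>x. x \<partial>N)) / a\<^sup>2"
      unfolding lt_def using integrable_lt[of a] a int prob_space by simp
    show "(\<integral>\<^sup>+x. ennreal ((exp (- a * x) - 1 + a * x) / a\<^sup>2) \<partial>N) = ennreal ((lt a - 1 + a * (\<integral>x. x \<partial>N)) / a\<^sup>2)"
      using nn_integral_eq_integral[OF i nn] e by metis
    show "0 \<le> (lt a - 1 + a * (\<integral>x. x \<partial>N)) / a\<^sup>2" using integral_nonneg_AE[OF nn] e by metis
  qed
  have "((\<lambda>a. \<integral>\<^sup>+x. ennreal ((exp (- a * x) - 1 + a * x) / a\<^sup>2) \<partial>N) \<longlongrightarrow> (\<integral>\<^sup>+x. ennreal (x\<^sup>2 / 2) \<partial>N)) (at_right 0)"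
    by (rule nn_integral_exp_minus_limit2) (use AE_nonneg in auto)
  then show "((\<lambda>a. ennreal ((lt a - 1 + a * (\<integral>x. x \<partial>N)) / a\<^sup>2)) \<longlongrightarrow> (\<integral>\<^sup>+x. ennreal (x\<^sup>2 / 2) \<partial>N)) (at_right 0)"
    by (rule Lim_transform_eventually) (rule eventually_mono[OF eventually_at_right_less eq])
  show "\<And>a. 0 < a \<Longrightarrow> 0 \<le> (lt a - 1 + a * (\<integral>x. x \<partial>N)) / a\<^sup>2" by (rule nn2)
qed

text \<open>This difference of the two second order quotients decides the sign of an infinite limit.\<close>

lemma gap_moment_limit:
  assumes int: "integrable N (\<lambda>x. x)"
  shows "((\<lambda>a. ennreal ((1 - lt a - a * lt1 a) / a\<^sup>2)) \<longlongrightarrow> (\<integral>\<^sup>+x. ennreal (x\<^sup>2 / 2) \<partial>N)) (at_right 0)"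
    and "\<And>a. 0 < a \<Longrightarrow> 0 \<le> (1 - lt a - a * lt1 a) / a\<^sup>2"
proof -
  let ?h = "\<lambda>a x. (1 - exp (- a * x) - a * (x * exp (- a * x))) / a\<^sup>2"
  have pt: "0 \<le> ?h a x" "?h a x \<le> x\<^sup>2 / 2" if "0 < a" "0 \<le> x" for a x :: real
  proof -
    show "0 \<le> ?h a x" using exp_gap[of "a * x"] that by (cases "x = 0") (auto simp: mult.assoc)
    have "1 - exp (- a * x) - a * (x * exp (- a * x)) \<le> (a * x)\<^sup>2 / 2"
      using gamma_gap_le[of "a * x"] that by (simp add: mult.assoc)
    then show "?h a x \<le> x\<^sup>2 / 2" using that by (simp add: divide_le_eq power_mult_distrib mult_ac)
  qed
  have eq: "(\<integral>\<^sup>+x. ennreal (?h a x) \<partial>N) = ennreal ((1 - lt a - a * lt1 a) / a\<^sup>2)"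
    and nn2: "0 \<le> (1 - lt a - a * lt1 a) / a\<^sup>2"
    if a: "0 < a" for a
  proof -
    have i: "integrable N (?h a)" using integrable_lt[of a] integrable_lt1[of a] a by simp
    have nn: "AE x in N. 0 \<le> ?h a x" using AE_nonneg by eventually_elim (rule pt[OF a])
    have e: "(\<integral>x. ?h a x \<partial>N) = (1 - lt a - a * lt1 a) / a\<^sup>2"
      unfolding lt_def lt1_def using integrable_lt[of a] integrable_lt1[of a] a prob_space by simp
    show "(\<integral>\<^sup>+x. ennreal (?h a x) \<partial>N) = ennreal ((1 - lt a - a * lt1 a) / a\<^sup>2)"
      using nn_integral_eq_integral[OF i nn] e by metis
    show "0 \<le> (1 - lt a - a * lt1 a) / a\<^sup>2" using integral_nonneg_AE[OF nn] e by metis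
  qed
  have "((\<lambda>a. \<integral>\<^sup>+x. ennreal (?h a x) \<partial>N) \<longlongrightarrow> (\<integral>\<^sup>+x. ennreal (x\<^sup>2 / 2) \<partial>N)) (at_right 0)"
  proof (rule nn_integral_tendsto_at_right_0)
    show "AE x in N. ennreal (?h a x) \<le> ennreal (x\<^sup>2 / 2)" if "0 < a" for a
      using AE_nonneg by eventually_elim (intro ennreal_leI pt that)
    show "AE x in N. ((\<lambda>a. ennreal (?h a x)) \<longlongrightarrow> ennreal (x\<^sup>2 / 2)) (at_right 0)"
      using AE_nonneg
    proof eventually_elim
      case (elim x)
      \<comment> \<open>The gap quotient is x times the first order quotient minus the second order
        one, and both limits are known.\<close>
      have "((\<lambda>a. x * ((1 - exp (- a * x)) / a) - (exp (- a * x) - 1 + a * x) / a\<^sup>2) \<longlongrightarrow> x * x - x\<^sup>2 / 2) (at_right 0)"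
        by (intro tendsto_intros exp_minus_limits elim)
      also have "x * x - x\<^sup>2 / 2 = x\<^sup>2 / 2" by (simp add: power2_eq_square)
      finally have "((\<lambda>a. ?h a x) \<longlongrightarrow> x\<^sup>2 / 2) (at_right 0)"
        by (rule Lim_transform_eventually)
          (auto intro!: eventually_mono[OF eventually_at_right_less] simp: field_simps power2_eq_square)
      then show ?case by (rule tendsto_ennrealI)
    qed
  qed measurable
  then show "((\<lambda>a. ennreal ((1 - lt a - a * lt1 a) / a\<^sup>2)) \<longlongrightarrow> (\<integral>\<^sup>+x. ennreal (x\<^sup>2 / 2) \<partial>N)) (at_right 0)"
    by (rule Lim_transform_eventually) (rule eventually_mono[OF eventually_at_right_less eq])
  show "\<And>a. 0 < a \<Longrightarrow> 0 \<le> (1 - lt a - a * lt1 a) / a\<^sup>2" by (rule nn2)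
qed

end

lemma nn_integral_half_square: "(\<integral>\<^sup>+x. ennreal (x\<^sup>2 / 2) \<partial>N) = (\<integral>\<^sup>+x. ennreal (x\<^sup>2) \<partial>N) / 2"
  if [measurable_cong]: "sets N = sets borel" for N :: "real measure"
  by (subst nn_integral_divide[symmetric]) (auto simp: divide_ennreal intro!: nn_integral_cong simp flip: ennreal_numeral)

text \<open>Partial sums have this shape, with \<open>m\<close> a mean whose limit may be infinite.
  The real part has a finite limit, so no difference of infinities occurs for either sign of
  \<open>c\<close>.\<close>

lemma tendsto_ereal_affine:
  fixes R m :: "'b \<Rightarrow> real" and \<mu> :: ennreal
  assumes "(R \<longlongrightarrow> r) Fl" "((\<lambda>n. ennreal (m n)) \<longlongrightarrow> \<mu>) Fl" "\<forall>\<^sub>F n in Fl. 0 \<le> m n"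
  shows "((\<lambda>n. ereal (R n + c * m n)) \<longlongrightarrow> ereal r + ereal c * enn2ereal \<mu>) Fl"
proof -
  have "((\<lambda>n. enn2ereal (ennreal (m n))) \<longlongrightarrow> enn2ereal \<mu>) Fl" by (rule tendsto_enn2erealI[OF assms(2)])
  then have m: "((\<lambda>n. ereal (m n)) \<longlongrightarrow> enn2ereal \<mu>) Fl"
    by (rule Lim_transform_eventually) (use assms(3) in \<open>auto elim!: eventually_mono simp: enn2ereal_ennreal\<close>)
  have "((\<lambda>n. ereal (R n) + ereal c * ereal (m n)) \<longlongrightarrow> ereal r + ereal c * enn2ereal \<mu>) Fl"
    by (rule tendsto_add_ereal_general2) (use assms(1) tendsto_cmult_ereal[OF _ m, of "ereal c"] in auto)
  then show ?thesis by simp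
qed

text \<open>Distributivity can fail in the extended reals; here the first summand is finite and the
  factor positive.\<close>

lemma ereal_affine_scale:
  assumes "0 < x" "0 \<le> Y"
  shows "ereal x * (ereal A + ereal B * Y) = ereal (x * A) + ereal (x * B) * Y"
  using assms by (cases Y; cases "B = 0"; cases "0 < B") (auto simp: algebra_simps zero_less_mult_iff mult_less_0_iff)

section \<open>Moments of the stationary workload\<close>

context stationary_storage
begin

sublocale pil: nonneg_law \<pi>
  by unfold_locales (auto intro: AE_pi_nonneg)

lemma lt_pi: "0 < a \<Longrightarrow> pil.lt a = a * d1 / phi a"
  using laplace_pi[of a] phi_pos[of a] by (simp add: pil.lt_def field_simps)

text \<open>The derivative in \<open>a\<close> of the identity phi(a) E exp (-a V) = a
  phi'(0).\<close>

lemma lt1_pi: "0 < a \<Longrightarrow> phi a * pil.lt1 a = (1 - lap 1 a) * pil.lt a - d1"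
proof -
  assume a: "0 < a"
  have "((\<lambda>a. phi a * pil.lt a) has_real_derivative (1 - lap 1 a) * pil.lt a + (- pil.lt1 a) * phi a) (at a)"
    by (rule DERIV_mult[OF DERIV_phi[OF a] pil.DERIV_lt[OF a]])
  moreover have "((\<lambda>a. phi a * pil.lt a) has_real_derivative d1) (at a)"
  proof -
    have "\<forall>\<^sub>F y in nhds a. phi y * pil.lt y = y * d1"
      using order_tendstoD(1)[OF filterlim_ident a] by eventually_elim (use laplace_pi in \<open>simp add: pil.lt_def\<close>)
    then show ?thesis by (subst DERIV_cong_ev[OF refl _ refl]) (auto intro!: derivative_eq_intros)
  qed
  ultimately show ?thesis using DERIV_unique by (fastforce simp: algebra_simps)
qed

lemma mean_pi: "(\<integral>\<^sup>+x. ennreal x \<partial>\<pi>) = nmom 2 / ennreal (2 * d1)"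
proof -
  have eq: "(1 - pil.lt a) / a = ((phi a - a * d1) / a\<^sup>2) / (phi a / a)" if "0 < a" for a
    using that phi_pos[OF that] by (simp add: lt_pi[OF that] field_simps power2_eq_square)
  show ?thesis
  proof (cases "nmom 2 = \<infinity>")
    case False
    then have fin: "nmom 2 < \<infinity>" by (simp add: less_top)
    have "((\<lambda>a. ((phi a - a * d1) / a\<^sup>2) / (phi a / a)) \<longlongrightarrow> (m2 / 2) / d1) (at_right 0)"
      using d1_pos by (intro tendsto_divide phi_limit2_real[OF fin] phi_limit) auto
    then have "((\<lambda>a. (1 - pil.lt a) / a) \<longlongrightarrow> (m2 / 2) / d1) (at_right 0)"
      by (rule Lim_transform_eventually) (auto intro!: eventually_mono[OF eventually_at_right_less] simp: eq)
    then have "((\<lambda>a. ennreal ((1 - pil.lt a) / a)) \<longlongrightarrow> ennreal ((m2 / 2) / d1)) (at_right 0)" by (rule tendsto_ennrealI)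
    with pil.mean_limit have "(\<integral>\<^sup>+x. ennreal x \<partial>\<pi>) = ennreal ((m2 / 2) / d1)"
      by (rule tendsto_unique[rotated]) simp
    also have "\<dots> = ennreal m2 / ennreal (2 * d1)" using d1_pos m2_nonneg[OF fin] by (simp add: divide_ennreal)
    finally show ?thesis by (simp add: ennreal_m2[OF fin])
  next
    case True
    have "((\<lambda>a. ennreal ((1 - pil.lt a) / a)) \<longlongrightarrow> \<infinity>) (at_right 0)"
    proof (rule tendsto_sandwich[OF _ _ _ tendsto_const])
      show "((\<lambda>a. ennreal ((phi a - a * d1) / a\<^sup>2)) \<longlongrightarrow> \<infinity>) (at_right 0)"
        using phi_limit2 by (simp add: True ennreal_top_divide)
      show "\<forall>\<^sub>F a in at_right 0. ennreal ((phi a - a * d1) / a\<^sup>2) \<le> ennreal ((1 - pil.lt a) / a)"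
      proof (rule eventually_mono[OF eventually_at_right_less])
        fix a :: real assume a: "0 < a"
        have "0 \<le> (phi a - a * d1) / a\<^sup>2" using phi_bounds(1)[of a] a by simp
        moreover have "0 < phi a / a" "phi a / a \<le> 1" using phi_bounds(2)[of a] phi_pos[OF a] a by auto
        ultimately have "(phi a - a * d1) / a\<^sup>2 * (phi a / a) \<le> (phi a - a * d1) / a\<^sup>2"
          by (intro mult_left_le) auto
        then have "(phi a - a * d1) / a\<^sup>2 \<le> ((phi a - a * d1) / a\<^sup>2) / (phi a / a)"
          using \<open>0 < phi a / a\<close> by (subst pos_le_divide_eq)
        then show "ennreal ((phi a - a * d1) / a\<^sup>2) \<le> ennreal ((1 - pil.lt a) / a)"
          unfolding eq[OF a] by (rule ennreal_leI)
      qed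
    qed simp
    with pil.mean_limit have "(\<integral>\<^sup>+x. ennreal x \<partial>\<pi>) = \<infinity>"
      by (rule tendsto_unique[rotated]) simp
    then show ?thesis by (simp add: True ennreal_top_divide)
  qed
qed

text \<open>This is the stationary mean only if \<open>nmom 2\<close> is finite; otherwise
  \<open>m2\<close> is the default 0 of \<open>enn2real\<close>.\<close>

definition mean :: real where "mean = m2 / (2 * d1)"

context
  assumes fin2: "nmom 2 < \<infinity>"
begin

lemma integrable_id_pi: "integrable \<pi> (\<lambda>x. x)" and mean_eq: "(\<integral>x. x \<partial>\<pi>) = mean"
proof -
  have "(\<integral>\<^sup>+x. ennreal x \<partial>\<pi>) = ennreal mean"
    using d1_pos m2_nonneg[OF fin2] by (simp add: mean_pi mean_def divide_ennreal[symmetric] ennreal_m2[OF fin2])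
  moreover have "0 \<le> mean" using d1_pos m2_nonneg[OF fin2] by (simp add: mean_def)
  ultimately show i: "integrable \<pi> (\<lambda>x. x)" and "(\<integral>x. x \<partial>\<pi>) = mean"
    using AE_pi_nonneg by (auto intro!: integrableI_nonneg integral_eq_nn_integral[THEN trans])
qed

text \<open>Minus the derivative in \<open>a\<close> of (E exp (-a V) - 1 + a E V - (exp (-a v) - 1
  + a v)) / phi a, a form of \<open>k2\<close> whose numerators vanish to first order at 0. It is
  the real value of \<open>k3_pos\<close> when the second moment of \<nu> is finite.\<close>

definition K :: "real \<Rightarrow> real \<Rightarrow> real" where
  "K v a = v * (1 - exp (- a * v)) / phi a - (1 - lap 1 a) / (phi a)\<^sup>2 * (exp (- a * v) - 1 + a * v)
     + (pil.lt1 a - mean) / phi a + (1 - lap 1 a) / (phi a)\<^sup>2 * (pil.lt a - 1 + a * mean)"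

text \<open>The stationary second moment may be infinite, so the two stationary terms of
  \<open>K\<close> may diverge separately. They are regrouped into a vanishing error
  \<open>g\<close> and the single term \<open>T\<close>, which has a fixed sign and carries all of
  the second moment.\<close>

lemma K_limit:
  assumes v: "0 \<le> v"
  shows "((\<lambda>a. ereal (K v a)) \<longlongrightarrow> ereal (v\<^sup>2 / (2 * d1)) + ereal (- 1 / (2 * d1)) * enn2ereal (\<integral>\<^sup>+x. ennreal (x\<^sup>2) \<partial>\<pi>)) (at_right 0)"
proof -
  define T where "T a = (1 - pil.lt a - a * pil.lt1 a) / a\<^sup>2" for a
  define Q where "Q a = (pil.lt a - 1 + a * mean) / a\<^sup>2" for a
  define V where "V a = v * ((1 - exp (- a * v)) / a) / (phi a / a)
      - (1 - lap 1 a) * ((exp (- a * v) - 1 + a * v) / a\<^sup>2) / (phi a / a)\<^sup>2" for a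
  \<comment> \<open>The gap phi'(a) - phi(a)/a divided by \<open>a\<close> is at most
    \<open>m2\<close> by \<open>gap_le\<close>, and a Q tends to 0 by finiteness of the mean even if
    \<open>Q\<close> itself diverges.\<close>
  define g where "g a = ((eta a / a - lap 1 a) / a) * (a * Q a)" for a
  have eq: "V a + (1 / (phi a / a))\<^sup>2 * g a + - (1 / (phi a / a)) * T a = K v a" if a: "0 < a" for a
  proof -
    define p where "p = phi a"
    have p: "p \<noteq> 0" using phi_pos[OF a] by (simp add: p_def)
    have eta: "eta a = a - p" by (simp add: p_def phi_def)
    show ?thesis
      unfolding V_def K_def g_def T_def Q_def p_def[symmetric] eta using a p
      by (simp add: field_simps power2_eq_square)
  qed
  have lap: "((\<lambda>a. 1 - lap 1 a) \<longlongrightarrow> d1) (at_right 0)"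
    unfolding d1_def by (intro tendsto_intros lap1_limit)
  have inv: "((\<lambda>a. 1 / (phi a / a)) \<longlongrightarrow> 1 / d1) (at_right 0)"
    using d1_pos by (intro tendsto_intros phi_limit) auto
  have "(V \<longlongrightarrow> v * v / d1 - d1 * (v\<^sup>2 / 2) / d1\<^sup>2) (at_right 0)"
    unfolding V_def[abs_def] using d1_pos
    by (intro tendsto_intros exp_minus_limits v phi_limit lap) auto
  also have "v * v / d1 - d1 * (v\<^sup>2 / 2) / d1\<^sup>2 = v\<^sup>2 / (2 * d1)"
    using d1_pos by (simp add: field_simps power2_eq_square)
  finally have V: "(V \<longlongrightarrow> v\<^sup>2 / (2 * d1)) (at_right 0)" .
  have "((\<lambda>a. mean - (1 - pil.lt a) / a) \<longlongrightarrow> mean - mean) (at_right 0)"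
    using pil.mean_limit_real[OF integrable_id_pi] by (intro tendsto_intros) (simp add: mean_eq)
  then have "((\<lambda>a. mean - (1 - pil.lt a) / a) \<longlongrightarrow> 0) (at_right 0)" by simp
  then have aQ: "((\<lambda>a. a * Q a) \<longlongrightarrow> 0) (at_right 0)"
    by (rule Lim_transform_eventually)
      (auto intro!: eventually_mono[OF eventually_at_right_less] simp: Q_def field_simps power2_eq_square)
  have "(g \<longlongrightarrow> 0) (at_right 0)"
  proof (rule Lim_null_comparison)
    show "((\<lambda>a. m2 * \<bar>a * Q a\<bar>) \<longlongrightarrow> 0) (at_right 0)"
      using tendsto_mult_left[OF tendsto_rabs[OF aQ], of m2] by simp
    show "\<forall>\<^sub>F a in at_right 0. norm (g a) \<le> m2 * \<bar>a * Q a\<bar>"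
    proof (rule eventually_mono[OF eventually_at_right_less])
      fix a :: real assume a: "0 < a"
      have "0 \<le> (eta a / a - lap 1 a) / a" using gap_nonneg[OF a] a by simp
      moreover have "(eta a / a - lap 1 a) / a \<le> m2"
        using gap_le[OF fin2 a] a by (simp add: divide_le_eq mult.commute)
      ultimately show "norm (g a) \<le> m2 * \<bar>a * Q a\<bar>"
        unfolding g_def real_norm_def abs_mult[of "(eta a / a - lap 1 a) / a"] by (intro mult_right_mono) auto
    qed
  qed
  then have R: "((\<lambda>a. V a + (1 / (phi a / a))\<^sup>2 * g a) \<longlongrightarrow> v\<^sup>2 / (2 * d1) + (1 / d1)\<^sup>2 * 0) (at_right 0)"
    by (intro tendsto_intros V inv)
  have Tlim: "((\<lambda>a. ereal (T a)) \<longlongrightarrow> enn2ereal (\<integral>\<^sup>+x. ennreal (x\<^sup>2 / 2) \<partial>\<pi>)) (at_right 0)"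
  proof -
    have "((\<lambda>a. ereal (0 + 1 * T a)) \<longlongrightarrow> ereal 0 + ereal 1 * enn2ereal (\<integral>\<^sup>+x. ennreal (x\<^sup>2 / 2) \<partial>\<pi>)) (at_right 0)"
      by (rule tendsto_ereal_affine)
        (auto simp: T_def intro!: pil.gap_moment_limit integrable_id_pi eventually_mono[OF eventually_at_right_less]
          pil.gap_moment_limit(2)[OF integrable_id_pi, simplified])
    then show ?thesis by (simp add: zero_ereal_def[symmetric] one_ereal_def[symmetric])
  qed
  have "((\<lambda>a. ereal (- (1 / (phi a / a))) * ereal (T a)) \<longlongrightarrow> ereal (- (1 / d1)) * enn2ereal (\<integral>\<^sup>+x. ennreal (x\<^sup>2 / 2) \<partial>\<pi>)) (at_right 0)"
    using d1_pos tendsto_minus[OF inv] by (intro tendsto_mult_ereal Tlim) auto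
  with R have "((\<lambda>a. ereal (V a + (1 / (phi a / a))\<^sup>2 * g a) + ereal (- (1 / (phi a / a))) * ereal (T a)) \<longlongrightarrow>
     ereal (v\<^sup>2 / (2 * d1) + (1 / d1)\<^sup>2 * 0) + ereal (- (1 / d1)) * enn2ereal (\<integral>\<^sup>+x. ennreal (x\<^sup>2 / 2) \<partial>\<pi>)) (at_right 0)"
    by (intro tendsto_add_ereal_general2) auto
  also have "ereal (v\<^sup>2 / (2 * d1) + (1 / d1)\<^sup>2 * 0) + ereal (- (1 / d1)) * enn2ereal (\<integral>\<^sup>+x. ennreal (x\<^sup>2 / 2) \<partial>\<pi>)
     = ereal (v\<^sup>2 / (2 * d1)) + ereal (- 1 / (2 * d1)) * enn2ereal (\<integral>\<^sup>+x. ennreal (x\<^sup>2) \<partial>\<pi>)"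
  proof (cases "\<integral>\<^sup>+x. ennreal (x\<^sup>2) \<partial>\<pi>")
    case (real s)
    then have "(\<integral>\<^sup>+x. ennreal (x\<^sup>2 / 2) \<partial>\<pi>) = ennreal (s / 2)"
      unfolding nn_integral_half_square[OF sets_pi] using divide_ennreal[of s 2] by simp
    then show ?thesis using real by (simp add: enn2ereal_ennreal)
  next
    case top
    then have "(\<integral>\<^sup>+x. ennreal (x\<^sup>2 / 2) \<partial>\<pi>) = top"
      unfolding nn_integral_half_square[OF sets_pi] by (simp add: ennreal_top_divide)
    then show ?thesis using top d1_pos by simp
  qed
  finally show ?thesis
    by (rule Lim_transform_eventually) (rule eventually_mono[OF eventually_at_right_less], use eq in simp)
qed

text \<open>The transform a d1 / phi a is expanded with the third order remainder
  \<open>\<rho>\<close> of \<open>phi\<close>; the quotient by a^2 then converges to half the second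
  moment.\<close>

lemma second_moment_pi:
  assumes fin3: "nmom 3 < \<infinity>"
  shows "(\<integral>\<^sup>+x. ennreal (x\<^sup>2) \<partial>\<pi>) = ennreal (m2\<^sup>2 / (2 * d1\<^sup>2) + m3 / (3 * d1))"
proof -
  define \<rho> where "\<rho> a = (a * d1 + a\<^sup>2 * m2 / 2 - phi a) / a ^ 3" for a
  define s where "s = m2\<^sup>2 / (2 * d1\<^sup>2) + m3 / (3 * d1)"
  have \<rho>: "(\<rho> \<longlongrightarrow> m3 / 6) (at_right 0)" unfolding \<rho>_def[abs_def] by (rule phi_limit3[OF fin2 fin3])
  have "((\<lambda>a. (\<rho> a + m2 * mean / 2 - a * \<rho> a * mean) / (phi a / a)) \<longlongrightarrow> (m3 / 6 + m2 * mean / 2 - 0 * (m3 / 6) * mean) / d1) (at_right 0)"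
    using d1_pos by (intro tendsto_intros \<rho> phi_limit) auto
  also have "(m3 / 6 + m2 * mean / 2 - 0 * (m3 / 6) * mean) / d1 = s / 2"
    using d1_pos by (simp add: s_def mean_def field_simps power2_eq_square)
  finally have "((\<lambda>a. (pil.lt a - 1 + a * mean) / a\<^sup>2) \<longlongrightarrow> s / 2) (at_right 0)"
  proof (rule Lim_transform_eventually[OF _ eventually_mono[OF eventually_at_right_less]])
    fix a :: real assume a: "0 < a"
    define p where "p = phi a"
    have p: "p \<noteq> 0" using phi_pos[OF a] by (simp add: p_def)
    have p_eq: "p = a * d1 + a\<^sup>2 * m2 / 2 - a ^ 3 * \<rho> a" using a by (simp add: \<rho>_def p_def)
    have m2_eq: "m2 = 2 * d1 * mean" using d1_pos by (simp add: mean_def)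
    \<comment> \<open>The terms of order a and a^2 cancel, the latter because m2 = 2 d1
      mean.\<close>
    have num: "a * d1 - p + a * p * mean = a ^ 3 * (\<rho> a + m2 * mean / 2 - a * \<rho> a * mean)"
      unfolding p_eq m2_eq by (simp add: algebra_simps power2_eq_square power3_eq_cube)
    have "(pil.lt a - 1 + a * mean) / a\<^sup>2 = (a * d1 - p + a * p * mean) / (p * a\<^sup>2)"
      using a p by (simp add: lt_pi p_def field_simps)
    also have "\<dots> = (\<rho> a + m2 * mean / 2 - a * \<rho> a * mean) / (p / a)"
      unfolding num using a p by (simp add: field_simps power2_eq_square power3_eq_cube)
    finally show "(\<rho> a + m2 * mean / 2 - a * \<rho> a * mean) / (phi a / a) = (pil.lt a - 1 + a * mean) / a\<^sup>2"
      by (simp add: p_def)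
  qed
  then have lim1: "((\<lambda>a. ennreal ((pil.lt a - 1 + a * mean) / a\<^sup>2)) \<longlongrightarrow> ennreal (s / 2)) (at_right 0)" by (rule tendsto_ennrealI)
  have lim2: "((\<lambda>a. ennreal ((pil.lt a - 1 + a * mean) / a\<^sup>2)) \<longlongrightarrow> (\<integral>\<^sup>+x. ennreal (x\<^sup>2 / 2) \<partial>\<pi>)) (at_right 0)"
    using pil.second_moment_limit(1)[OF integrable_id_pi] by (simp add: mean_eq)
  have half: "(\<integral>\<^sup>+x. ennreal (x\<^sup>2) \<partial>\<pi>) / 2 = ennreal (s / 2)"
    unfolding nn_integral_half_square[OF sets_pi, symmetric] by (rule tendsto_unique[OF _ lim2 lim1]) simp
  have s0: "0 \<le> s" using d1_pos by (simp add: s_def m3_def)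
  show ?thesis
  proof (cases "\<integral>\<^sup>+x. ennreal (x\<^sup>2) \<partial>\<pi>")
    case (real r)
    then have "ennreal (r / 2) = ennreal (s / 2)" using half divide_ennreal[of r 2] by simp
    then show ?thesis using real s0 by (simp add: s_def)
  next
    case top
    then show ?thesis using half by (simp add: ennreal_top_divide)
  qed
qed

end

end

section \<open>Partial sums and their limits\<close>

context stationary_storage
begin

context
  fixes \<xi> v :: real assumes \<xi>: "0 < \<xi>" and v: "0 \<le> v"
begin

lemma nonneg_law_law: "nonneg_law (law \<xi> n v)"
  by (intro nonneg_law.intro nonneg_law_axioms.intro prob_space_law[OF \<xi>] AE_law_nonneg[OF \<xi>]) simp

lemma law_identity':
  assumes a: "0 < a"
  shows "(\<Sum>n\<le>N. phi a * (\<integral>x. exp (- a * x) \<partial>law \<xi> n v) - a * d1) =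
     \<xi> * ((\<integral>x. exp (- a * x) \<partial>law \<xi> N v) + a * (\<integral>x. x \<partial>law \<xi> N v) - (exp (- a * v) + a * v))"
  using law_identity[OF \<xi> v a, of N] law_integrable_exp[OF \<xi> v a, of N] law_integrable_id[OF \<xi> v a, of N]
  by simp

lemma sum_exp:
  assumes a: "0 < a"
  shows "(\<Sum>n\<le>N. (\<integral>x. exp (- a * x) \<partial>law \<xi> n v) - (\<integral>x. exp (- a * x) \<partial>\<pi>)) =
     \<xi> / phi a * ((\<integral>x. exp (- a * x) \<partial>law \<xi> N v) + a * (\<integral>x. x \<partial>law \<xi> N v) - (exp (- a * v) + a * v))"
proof -
  have "phi a * (\<Sum>n\<le>N. (\<integral>x. exp (- a * x) \<partial>law \<xi> n v) - (\<integral>x. exp (- a * x) \<partial>\<pi>)) =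
    (\<Sum>n\<le>N. phi a * (\<integral>x. exp (- a * x) \<partial>law \<xi> n v) - a * d1)"
    unfolding sum_distrib_left right_diff_distrib laplace_pi[OF a] by simp
  then show ?thesis unfolding law_identity'[OF a] using phi_pos[OF a] by (simp add: field_simps)
qed

lemma sum_xexp:
  assumes a: "0 < a"
  shows "(\<Sum>n\<le>N. (\<integral>x. x * exp (- a * x) \<partial>law \<xi> n v) - (\<integral>x. x * exp (- a * x) \<partial>\<pi>)) =
     \<xi> / phi a * ((\<integral>x. x * exp (- a * x) \<partial>law \<xi> N v) - (\<integral>x. x \<partial>law \<xi> N v) + v * (1 - exp (- a * v)))
     + (1 - lap 1 a) / phi a * (\<Sum>n\<le>N. (\<integral>x. exp (- a * x) \<partial>law \<xi> n v) - (\<integral>x. exp (- a * x) \<partial>\<pi>))"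
proof -
  interpret l: nonneg_law "law \<xi> n v" for n by (rule nonneg_law_law)
  define m where "m = (\<integral>x. x \<partial>law \<xi> N v)"
  have id: "(\<Sum>n\<le>N. phi b * l.lt n b - b * d1) = \<xi> * (l.lt N b + b * m - (exp (- b * v) + b * v))" if "0 < b" for b
    using law_identity'[OF that, of N] by (simp add: l.lt_def m_def)
  have "((\<lambda>b. \<Sum>n\<le>N. phi b * l.lt n b - b * d1) has_real_derivative
      (\<Sum>n\<le>N. (1 - lap 1 a) * l.lt n a + phi a * (- l.lt1 n a) - d1)) (at a)"
    by (auto intro!: derivative_eq_intros DERIV_phi[OF a] l.DERIV_lt[OF a] simp: mult.commute[of _ "phi a"])
  moreover have "((\<lambda>b. \<Sum>n\<le>N. phi b * l.lt n b - b * d1) has_real_derivative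
      \<xi> * (- l.lt1 N a + m - (- v * exp (- a * v) + v))) (at a)"
  proof -
    have "((\<lambda>b. \<xi> * (l.lt N b + b * m - (exp (- b * v) + b * v))) has_real_derivative
      \<xi> * (- l.lt1 N a + m - (- v * exp (- a * v) + v))) (at a)"
      by (auto intro!: derivative_eq_intros l.DERIV_lt[OF a])
    moreover have "\<forall>\<^sub>F b in nhds a. (\<Sum>n\<le>N. phi b * l.lt n b - b * d1) = \<xi> * (l.lt N b + b * m - (exp (- b * v) + b * v))"
      using order_tendstoD(1)[OF filterlim_ident a] by eventually_elim (rule id)
    ultimately show ?thesis by (subst DERIV_cong_ev[OF refl _ refl])
  qed
  ultimately have "(\<Sum>n\<le>N. (1 - lap 1 a) * l.lt n a + phi a * (- l.lt1 n a) - d1) =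
     \<xi> * (- l.lt1 N a + m - (- v * exp (- a * v) + v))" by (rule DERIV_unique)
  \<comment> \<open>\<open>lt1_pi\<close> expresses \<open>d1\<close> through the stationary
    transforms, so that every summand becomes a difference from its stationary value.\<close>
  moreover have "(1 - lap 1 a) * l.lt n a + phi a * (- l.lt1 n a) - d1 =
     (1 - lap 1 a) * (l.lt n a - pil.lt a) - phi a * (l.lt1 n a - pil.lt1 a)" for n
    using lt1_pi[OF a] by (simp add: algebra_simps)
  ultimately have "(1 - lap 1 a) * (\<Sum>n\<le>N. l.lt n a - pil.lt a) - phi a * (\<Sum>n\<le>N. l.lt1 n a - pil.lt1 a) =
     \<xi> * (- l.lt1 N a + m - (- v * exp (- a * v) + v))"
    by (simp only: sum_subtractf[of "\<lambda>n. (1 - lap 1 a) * (l.lt n a - pil.lt a)"] sum_distrib_left[symmetric])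
  then have "phi a * (\<Sum>n\<le>N. l.lt1 n a - pil.lt1 a) =
    \<xi> * (l.lt1 N a - m + v * (1 - exp (- a * v))) + (1 - lap 1 a) * (\<Sum>n\<le>N. l.lt n a - pil.lt a)"
    by (simp add: algebra_simps)
  then have "(\<Sum>n\<le>N. l.lt1 n a - pil.lt1 a) =
    (\<xi> * (l.lt1 N a - m + v * (1 - exp (- a * v))) + (1 - lap 1 a) * (\<Sum>n\<le>N. l.lt n a - pil.lt a)) / phi a"
    using phi_pos[OF a] by (simp add: eq_divide_eq mult.commute)
  then show ?thesis
    unfolding l.lt_def l.lt1_def pil.lt_def pil.lt1_def m_def by (simp add: add_divide_distrib)
qed

lemma law_mean_nn: "(\<integral>\<^sup>+x. ennreal x \<partial>law \<xi> n v) = ennreal (\<integral>x. x \<partial>law \<xi> n v)" "0 \<le> (\<integral>x. x \<partial>law \<xi> n v)"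
proof -
  interpret l: nonneg_law "law \<xi> n v" by (rule nonneg_law_law)
  show "(\<integral>\<^sup>+x. ennreal x \<partial>law \<xi> n v) = ennreal (\<integral>x. x \<partial>law \<xi> n v)"
    by (rule nn_integral_eq_integral[OF law_integrable_id[OF \<xi> v zero_less_one] l.AE_nonneg])
  show "0 \<le> (\<integral>x. x \<partial>law \<xi> n v)" by (rule integral_nonneg_AE[OF l.AE_nonneg])
qed

lemma law_mean_tendsto: "(\<lambda>n. ennreal (\<integral>x. x \<partial>law \<xi> n v)) \<longlonglongrightarrow> nmom 2 / ennreal (2 * d1)"
  using law_mean_limit[OF \<xi> v] by (simp add: law_mean_nn mean_pi)

text \<open>Outside \<open>[0, \<infinity>)\<close> the integrands are cut off; the laws do not charge that region.\<close>

lemma law_exp_tendsto: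
  assumes a: "0 < a"
  shows "(\<lambda>n. \<integral>x. exp (- a * x) \<partial>law \<xi> n v) \<longlonglongrightarrow> (\<integral>x. exp (- a * x) \<partial>\<pi>)"
    and "(\<lambda>n. \<integral>x. x * exp (- a * x) \<partial>law \<xi> n v) \<longlonglongrightarrow> (\<integral>x. x * exp (- a * x) \<partial>\<pi>)"
proof -
  interpret l: nonneg_law "law \<xi> n v" for n by (rule nonneg_law_law)
  have cut: "(\<lambda>n. \<integral>x. f x \<partial>law \<xi> n v) \<longlonglongrightarrow> (\<integral>x. f x \<partial>\<pi>)"
    if f[measurable]: "f \<in> borel_measurable borel" and b: "\<And>x. 0 \<le> x \<Longrightarrow> 0 \<le> f x \<and> f x \<le> B" for f :: "real \<Rightarrow> real" and B
  proof -
    have "(\<lambda>n. \<integral>x. f (max 0 x) \<partial>law \<xi> n v) \<longlonglongrightarrow> (\<integral>x. f (max 0 x) \<partial>\<pi>)"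
      by (rule law_bounded_limit[OF \<xi>, where B = B]) (use b in auto)
    moreover have "(\<integral>x. f (max 0 x) \<partial>law \<xi> n v) = (\<integral>x. f x \<partial>law \<xi> n v)" for n
    proof (rule integral_cong_AE)
      show "AE x in law \<xi> n v. f (max 0 x) = f x" using l.AE_nonneg[of n] by eventually_elim simp
    qed measurable
    moreover have "(\<integral>x. f (max 0 x) \<partial>\<pi>) = (\<integral>x. f x \<partial>\<pi>)"
    proof (rule integral_cong_AE)
      show "AE x in \<pi>. f (max 0 x) = f x" using AE_pi_nonneg by eventually_elim simp
    qed measurable
    ultimately show ?thesis by simp
  qed
  show "(\<lambda>n. \<integral>x. exp (- a * x) \<partial>law \<xi> n v) \<longlonglongrightarrow> (\<integral>x. exp (- a * x) \<partial>\<pi>)"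
    by (rule cut[of _ 1]) (use a in auto)
  show "(\<lambda>n. \<integral>x. x * exp (- a * x) \<partial>law \<xi> n v) \<longlonglongrightarrow> (\<integral>x. x * exp (- a * x) \<partial>\<pi>)"
  proof (rule cut[of _ "1 / a"])
    fix x :: real assume x: "0 \<le> x"
    have "x * exp (- a * x) \<le> (1 / a) * exp (a * x) * exp (- a * x)"
      using power_le_exp[OF a x, of 1] by (intro mult_right_mono) auto
    also have "\<dots> = 1 / a" by (simp flip: exp_add)
    finally show "0 \<le> x * exp (- a * x) \<and> x * exp (- a * x) \<le> 1 / a" using x by simp
  qed measurable
qed

lemma enn2ereal_mean: "enn2ereal (nmom 2 / ennreal (2 * d1)) = enn2ereal (nmom 2) / ereal (2 * d1)"
proof (cases "nmom 2")
  case (real r)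
  then show ?thesis using d1_pos by (simp add: divide_ennreal enn2ereal_ennreal)
next
  case top
  then show ?thesis using d1_pos by (simp add: ennreal_top_divide)
qed

text \<open>\<open>a\<close> tends to 0 at a fixed \<open>N\<close>. The order a^2 of the identity
  links the sum of means to the second moment of the last law, and the finite limit shows that
  moment to be finite even when the stationary one is not.\<close>

lemma sum_mean:
  assumes fin2: "nmom 2 < \<infinity>"
  shows "\<exists>s. 0 \<le> s \<and> (\<integral>\<^sup>+x. ennreal (x\<^sup>2) \<partial>law \<xi> N v) = ennreal s \<and>
    (\<Sum>n\<le>N. (\<integral>x. x \<partial>law \<xi> n v) - mean) = \<xi> / (2 * d1) * (v\<^sup>2 - s)"
proof -
  interpret l: nonneg_law "law \<xi> n v" for n by (rule nonneg_law_law)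
  have int: "integrable (law \<xi> n v) (\<lambda>x. x)" for n by (rule law_integrable_id[OF \<xi> v zero_less_one])
  define m where "m n = (\<integral>x. x \<partial>law \<xi> n v)" for n
  define q where "q a = (l.lt N a - 1 + a * m N) / a\<^sup>2" for a
  \<comment> \<open>The identity divided by a^2, with each summand regrouped into (phi a - a d1) /
    a^2 and a product of first order quotients, since these converge separately.\<close>
  have eq: "(1 / \<xi>) * (\<Sum>n\<le>N. - ((phi a / a) * ((1 - l.lt n a) / a)) + (phi a - a * d1) / a\<^sup>2)
     + (exp (- a * v) - 1 + a * v) / a\<^sup>2 = q a" if a: "0 < a" for a
  proof -
    have "(\<Sum>n\<le>N. phi a * l.lt n a - a * d1) = \<xi> * (l.lt N a + a * m N - (exp (- a * v) + a * v))"
      using law_identity'[OF a, of N] by (simp add: l.lt_def m_def)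
    then have sum: "(\<Sum>n\<le>N. phi a * l.lt n a - a * d1) = \<xi> * ((l.lt N a - 1 + a * m N) - (exp (- a * v) - 1 + a * v))"
      by simp
    have "(\<Sum>n\<le>N. (phi a * l.lt n a - a * d1) / a\<^sup>2) = \<xi> * (q a - (exp (- a * v) - 1 + a * v) / a\<^sup>2)"
      unfolding sum_divide_distrib[symmetric] q_def sum
      by (simp only: diff_divide_distrib[symmetric] times_divide_eq_right)
    moreover have "(phi a * l.lt n a - a * d1) / a\<^sup>2 = - ((phi a / a) * ((1 - l.lt n a) / a)) + (phi a - a * d1) / a\<^sup>2" for n
      using a by (simp add: field_simps power2_eq_square)
    ultimately have "(\<Sum>n\<le>N. - ((phi a / a) * ((1 - l.lt n a) / a)) + (phi a - a * d1) / a\<^sup>2)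
       = \<xi> * (q a - (exp (- a * v) - 1 + a * v) / a\<^sup>2)" by simp
    then show ?thesis using \<xi> by simp
  qed
  define S where "S = (1 / \<xi>) * (\<Sum>n\<le>N. - (d1 * m n) + m2 / 2) + v\<^sup>2 / 2"
  have "((\<lambda>a. (1 / \<xi>) * (\<Sum>n\<le>N. - ((phi a / a) * ((1 - l.lt n a) / a)) + (phi a - a * d1) / a\<^sup>2)
     + (exp (- a * v) - 1 + a * v) / a\<^sup>2) \<longlongrightarrow> S) (at_right 0)"
    unfolding S_def m_def
    by (intro tendsto_intros phi_limit l.mean_limit_real int phi_limit2_real fin2 exp_minus_limits v)
  then have qS: "(q \<longlongrightarrow> S) (at_right 0)"
    by (rule Lim_transform_eventually) (rule eventually_mono[OF eventually_at_right_less eq])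
  have nn: "\<And>a. 0 < a \<Longrightarrow> 0 \<le> q a" unfolding q_def m_def by (rule l.second_moment_limit(2)[OF int])
  have S0: "0 \<le> S"
    by (rule tendsto_lowerbound[OF qS]) (auto intro!: eventually_mono[OF eventually_at_right_less] nn)
  have lim2: "((\<lambda>a. ennreal (q a)) \<longlongrightarrow> (\<integral>\<^sup>+x. ennreal (x\<^sup>2 / 2) \<partial>law \<xi> N v)) (at_right 0)"
    unfolding q_def m_def by (rule l.second_moment_limit(1)[OF int])
  have half: "(\<integral>\<^sup>+x. ennreal (x\<^sup>2) \<partial>law \<xi> N v) / 2 = ennreal S"
    unfolding nn_integral_half_square[OF sets_law, symmetric]
    by (rule tendsto_unique[OF _ lim2 tendsto_ennrealI[OF qS]]) simp
  have sq: "(\<integral>\<^sup>+x. ennreal (x\<^sup>2) \<partial>law \<xi> N v) = ennreal (2 * S)"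
  proof (cases "\<integral>\<^sup>+x. ennreal (x\<^sup>2) \<partial>law \<xi> N v")
    case (real r)
    then have "ennreal (r / 2) = ennreal S" using half divide_ennreal[of r 2] by simp
    then show ?thesis using real S0 by simp
  next
    case top
    then show ?thesis using half by (simp add: ennreal_top_divide)
  qed
  have "(\<Sum>n\<le>N. - (d1 * m n) + m2 / 2) = - d1 * (\<Sum>n\<le>N. m n - mean)"
    unfolding sum_distrib_left using d1_pos by (intro sum.cong) (auto simp: mean_def field_simps)
  then have "S = - (d1 / \<xi>) * (\<Sum>n\<le>N. m n - mean) + v\<^sup>2 / 2" by (simp add: S_def)
  then have "(\<Sum>n\<le>N. m n - mean) = \<xi> / (2 * d1) * (v\<^sup>2 - 2 * S)"
    using \<xi> d1_pos by (simp add: field_simps)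
  then show ?thesis using S0 sq by (intro exI[of _ "2 * S"]) (simp add: m_def)
qed

context
  fixes \<phi> :: "real \<Rightarrow> real" assumes \<phi>: "\<And>a. 0 \<le> a \<Longrightarrow> \<phi> a = phi a"
begin

lemma \<phi>': "\<And>a. 0 \<le> a \<Longrightarrow> \<phi> a = a - eta a" by (simp add: \<phi> phi_def)

lemma deriv0_eqs:
  "deriv0 1 \<phi> = 1 - enn2ereal (nmom 1)"
  "deriv0 2 \<phi> = enn2ereal (nmom 2)"
  "deriv0 3 \<phi> = - enn2ereal (nmom 3)"
  by (rule deriv0_phi; simp add: \<phi>')+

lemma deriv_eq: "0 < a \<Longrightarrow> deriv \<phi> a = 1 - lap 1 a"
  by (rule deriv_phi) (simp_all add: \<phi>')

lemma d1_eq: "real_of_ereal (deriv0 1 \<phi>) = d1"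
  unfolding deriv0_eqs(1) ennreal_mu[symmetric]
  by (simp add: enn2ereal_ennreal mu_nonneg d1_def one_ereal_def)

text \<open>In \<open>sum_exp\<close> only the last law depends on \<open>N\<close>. Its transform
  converges to the stationary one, and its mean, with a constant factor, to a possibly infinite
  limit.\<close>

lemma limit_exp:
  assumes a: "0 < a"
  shows "(\<lambda>N. ereal (\<Sum>n<N. (\<integral>x. exp (- a * x) \<partial>law \<xi> n v) - (\<integral>x. exp (- a * x) \<partial>\<pi>)))
     \<longlonglongrightarrow> ereal \<xi> * k2 \<phi> v a"
proof (rule LIMSEQ_imp_Suc)
  define E where "E = exp (- a * v) + a * v"
  have p: "phi a > 0" by (rule phi_pos[OF a])
  have "(\<lambda>N. \<xi> / phi a * ((\<integral>x. exp (- a * x) \<partial>law \<xi> N v) - E)) \<longlonglongrightarrow> \<xi> / phi a * ((\<integral>x. exp (- a * x) \<partial>\<pi>) - E)"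
    by (intro tendsto_intros law_exp_tendsto a)
  from tendsto_ereal_affine[OF this law_mean_tendsto, of "\<xi> / phi a * a"]
  have "(\<lambda>N. ereal (\<xi> / phi a * ((\<integral>x. exp (- a * x) \<partial>law \<xi> N v) - E) + \<xi> / phi a * a * (\<integral>x. x \<partial>law \<xi> N v)))
    \<longlonglongrightarrow> ereal (\<xi> / phi a * ((\<integral>x. exp (- a * x) \<partial>\<pi>) - E)) + ereal (\<xi> / phi a * a) * enn2ereal (nmom 2 / ennreal (2 * d1))"
    by (simp add: law_mean_nn)
  also have "(\<lambda>N. ereal (\<xi> / phi a * ((\<integral>x. exp (- a * x) \<partial>law \<xi> N v) - E) + \<xi> / phi a * a * (\<integral>x. x \<partial>law \<xi> N v)))
    = (\<lambda>N. ereal (\<Sum>n<Suc N. (\<integral>x. exp (- a * x) \<partial>law \<xi> n v) - (\<integral>x. exp (- a * x) \<partial>\<pi>)))"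
    unfolding lessThan_Suc_atMost sum_exp[OF a] E_def by (simp add: algebra_simps)
  also have "ereal (\<xi> / phi a * ((\<integral>x. exp (- a * x) \<partial>\<pi>) - E)) + ereal (\<xi> / phi a * a) * enn2ereal (nmom 2 / ennreal (2 * d1))
    = ereal \<xi> * k2 \<phi> v a"
  proof -
    have "k2 \<phi> v a = ereal (- (E / phi a) + a / (phi a)\<^sup>2 * d1) + ereal (a / phi a) * (enn2ereal (nmom 2) / ereal (2 * d1))"
      unfolding k2_def Let_def d1_eq deriv0_eqs(2) using a by (simp add: \<phi> E_def)
    then have "ereal \<xi> * k2 \<phi> v a = ereal (\<xi> * (- (E / phi a) + a / (phi a)\<^sup>2 * d1)) + ereal (\<xi> * (a / phi a)) * enn2ereal (nmom 2 / ennreal (2 * d1))"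
      by (simp only: enn2ereal_mean[symmetric]) (rule ereal_affine_scale[OF \<xi>], simp)
    moreover have "\<xi> / phi a * ((\<integral>x. exp (- a * x) \<partial>\<pi>) - E) = \<xi> * (- (E / phi a) + a / (phi a)\<^sup>2 * d1)"
      unfolding lt_pi[OF a, unfolded pil.lt_def] using p by (simp add: field_simps power2_eq_square)
    ultimately show ?thesis by simp
  qed
  finally show "(\<lambda>N. ereal (\<Sum>n<Suc N. (\<integral>x. exp (- a * x) \<partial>law \<xi> n v) - (\<integral>x. exp (- a * x) \<partial>\<pi>)))
     \<longlonglongrightarrow> ereal \<xi> * k2 \<phi> v a" .
qed

lemma k3_pos_eq:
  assumes a: "0 < a"
  shows "k3_pos \<phi> v a = ereal ((1 - lap 1 a) / (phi a)\<^sup>2 * (- a * v - exp (- a * v)) + v / phi a * (1 - exp (- a * v))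
       - d1 / (phi a)\<^sup>2 * (1 - 2 * a * (1 - lap 1 a) / phi a))
     + ereal (- (1 / phi a * (1 - a * (1 - lap 1 a) / phi a))) * enn2ereal (nmom 2 / ennreal (2 * d1))"
proof -
  have eq: "x - ereal q * y = x + ereal (- q) * y" for x q y
    by (simp add: minus_ereal_def flip: uminus_ereal.simps(1))
  show ?thesis
    unfolding k3_pos_def Let_def d1_eq deriv0_eqs(2) enn2ereal_mean eq \<phi>[OF less_imp_le[OF a]] deriv_eq[OF a] ..
qed

lemma limit_xexp:
  assumes a: "0 < a"
  shows "(\<lambda>N. ereal (\<Sum>n<N. (\<integral>x. x * exp (- a * x) \<partial>law \<xi> n v) - (\<integral>x. x * exp (- a * x) \<partial>\<pi>)))
     \<longlonglongrightarrow> ereal \<xi> * k3_pos \<phi> v a"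
proof (rule LIMSEQ_imp_Suc)
  define E where "E = exp (- a * v) + a * v"
  define c where "c = 1 - lap 1 a"
  define p where "p = phi a"
  have p: "p > 0" unfolding p_def by (rule phi_pos[OF a])
  define R where "R N = \<xi> / p * ((\<integral>x. x * exp (- a * x) \<partial>law \<xi> N v) + v * (1 - exp (- a * v)))
     + c / p * (\<xi> / p * ((\<integral>x. exp (- a * x) \<partial>law \<xi> N v) - E))" for N
  define r where "r = \<xi> / p * ((\<integral>x. x * exp (- a * x) \<partial>\<pi>) + v * (1 - exp (- a * v)))
     + c / p * (\<xi> / p * ((\<integral>x. exp (- a * x) \<partial>\<pi>) - E))"
  \<comment> \<open>The mean of the last law enters twice, directly in \<open>sum_xexp\<close> and
    through the inner sum; \<open>C\<close> is the total coefficient.\<close>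
  define C where "C = - (\<xi> / p * (1 - a * c / p))"
  have "R \<longlonglongrightarrow> r" unfolding R_def r_def by (intro tendsto_intros law_exp_tendsto a)
  from tendsto_ereal_affine[OF this law_mean_tendsto, of C]
  have "(\<lambda>N. ereal (R N + C * (\<integral>x. x \<partial>law \<xi> N v))) \<longlonglongrightarrow> ereal r + ereal C * enn2ereal (nmom 2 / ennreal (2 * d1))"
    by (simp add: law_mean_nn)
  also have "(\<lambda>N. ereal (R N + C * (\<integral>x. x \<partial>law \<xi> N v))) =
    (\<lambda>N. ereal (\<Sum>n<Suc N. (\<integral>x. x * exp (- a * x) \<partial>law \<xi> n v) - (\<integral>x. x * exp (- a * x) \<partial>\<pi>)))"
    unfolding lessThan_Suc_atMost sum_xexp[OF a] sum_exp[OF a] R_def C_def p_def[symmetric] c_def[symmetric]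
    using p by (simp add: E_def algebra_simps)
  also have "ereal r + ereal C * enn2ereal (nmom 2 / ennreal (2 * d1)) = ereal \<xi> * k3_pos \<phi> v a"
  proof -
    have L: "(\<integral>x. exp (- a * x) \<partial>\<pi>) = a * d1 / p" using lt_pi[OF a] by (simp add: pil.lt_def p_def)
    have L1: "(\<integral>x. x * exp (- a * x) \<partial>\<pi>) = (c * (a * d1 / p) - d1) / p"
      using lt1_pi[OF a] p unfolding lt_pi[OF a] pil.lt1_def p_def[symmetric] c_def[symmetric]
      by (simp add: eq_divide_eq mult.commute)
    have "ereal \<xi> * k3_pos \<phi> v a =
      ereal (\<xi> * (c / p\<^sup>2 * (- a * v - exp (- a * v)) + v / p * (1 - exp (- a * v)) - d1 / p\<^sup>2 * (1 - 2 * a * c / p)))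
      + ereal (\<xi> * - (1 / p * (1 - a * c / p))) * enn2ereal (nmom 2 / ennreal (2 * d1))"
      unfolding k3_pos_eq[OF a] p_def[symmetric] c_def[symmetric] by (rule ereal_affine_scale[OF \<xi>]) simp
    moreover have "r = \<xi> * (c / p\<^sup>2 * (- a * v - exp (- a * v)) + v / p * (1 - exp (- a * v)) - d1 / p\<^sup>2 * (1 - 2 * a * c / p))"
      unfolding r_def L L1 E_def using p by (simp add: field_simps power2_eq_square)
    moreover have "C = \<xi> * - (1 / p * (1 - a * c / p))" by (simp add: C_def)
    ultimately show ?thesis by simp
  qed
  finally show "(\<lambda>N. ereal (\<Sum>n<Suc N. (\<integral>x. x * exp (- a * x) \<partial>law \<xi> n v) - (\<integral>x. x * exp (- a * x) \<partial>\<pi>)))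
     \<longlonglongrightarrow> ereal \<xi> * k3_pos \<phi> v a" .
qed

context
  assumes fin2: "nmom 2 < \<infinity>"
begin

lemma k3_pos_K: "0 < a \<Longrightarrow> k3_pos \<phi> v a = ereal (K v a)"
proof -
  assume a: "0 < a"
  define p where "p = phi a"
  define c where "c = 1 - lap 1 a"
  have p: "p > 0" unfolding p_def by (rule phi_pos[OF a])
  have L1: "pil.lt1 a = (c * (a * d1 / p) - d1) / p"
    using lt1_pi[OF a] p unfolding lt_pi[OF a] p_def[symmetric] c_def[symmetric]
    by (simp add: eq_divide_eq mult.commute)
  have mean: "enn2ereal (nmom 2 / ennreal (2 * d1)) = ereal mean"
    using d1_pos m2_nonneg[OF fin2] by (simp add: mean_def divide_ennreal enn2ereal_ennreal flip: ennreal_m2[OF fin2])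
  show ?thesis
    unfolding k3_pos_eq[OF a] K_def[OF fin2] mean L1 lt_pi[OF a] p_def[symmetric] c_def[symmetric]
    using p by (simp add: field_simps power2_eq_square)
qed

lemma limit_mean_aux:
  "(\<lambda>N. ereal (\<Sum>n<N. (\<integral>x. x \<partial>law \<xi> n v) - (\<integral>x. x \<partial>\<pi>))) \<longlonglongrightarrow>
     ereal (\<xi> * (v\<^sup>2 / (2 * d1))) + ereal (\<xi> * (- 1 / (2 * d1))) * enn2ereal (\<integral>\<^sup>+x. ennreal (x\<^sup>2) \<partial>\<pi>)"
proof (rule LIMSEQ_imp_Suc)
  obtain s where s: "\<And>N. 0 \<le> s N" "\<And>N. (\<integral>\<^sup>+x. ennreal (x\<^sup>2) \<partial>law \<xi> N v) = ennreal (s N)"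
    "\<And>N. (\<Sum>n\<le>N. (\<integral>x. x \<partial>law \<xi> n v) - mean) = \<xi> / (2 * d1) * (v\<^sup>2 - s N)"
    using sum_mean[OF fin2] by metis
  have "(\<lambda>N. ereal (\<xi> * (v\<^sup>2 / (2 * d1)) + \<xi> * (- 1 / (2 * d1)) * s N)) \<longlonglongrightarrow>
     ereal (\<xi> * (v\<^sup>2 / (2 * d1))) + ereal (\<xi> * (- 1 / (2 * d1))) * enn2ereal (\<integral>\<^sup>+x. ennreal (x\<^sup>2) \<partial>\<pi>)"
    by (rule tendsto_ereal_affine) (use law_square_limit[OF \<xi> v] s in auto)
  also have "(\<lambda>N. ereal (\<xi> * (v\<^sup>2 / (2 * d1)) + \<xi> * (- 1 / (2 * d1)) * s N)) =
    (\<lambda>N. ereal (\<Sum>n<Suc N. (\<integral>x. x \<partial>law \<xi> n v) - (\<integral>x. x \<partial>\<pi>)))"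
    unfolding lessThan_Suc_atMost mean_eq[OF fin2] s(3) by (simp add: right_diff_distrib)
  finally show "(\<lambda>N. ereal (\<Sum>n<Suc N. (\<integral>x. x \<partial>law \<xi> n v) - (\<integral>x. x \<partial>\<pi>))) \<longlonglongrightarrow>
     ereal (\<xi> * (v\<^sup>2 / (2 * d1))) + ereal (\<xi> * (- 1 / (2 * d1))) * enn2ereal (\<integral>\<^sup>+x. ennreal (x\<^sup>2) \<partial>\<pi>)" .
qed

text \<open>Two limits meet without being interchanged: \<open>K_limit\<close> lets \<open>a\<close>
  tend to 0 in the closed formula, \<open>limit_mean_aux\<close> lets \<open>N\<close> grow in the
  sum of means, and both give the same affine function of the stationary second moment.\<close>

lemma limit_mean:
  "(\<lambda>N. ereal (\<Sum>n<N. (\<integral>x. x \<partial>law \<xi> n v) - (\<integral>x. x \<partial>\<pi>))) \<longlonglongrightarrow> ereal \<xi> * Lim (at_right 0) (k3_pos \<phi> v)"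
proof -
  have "(k3_pos \<phi> v \<longlongrightarrow> ereal (v\<^sup>2 / (2 * d1)) + ereal (- 1 / (2 * d1)) * enn2ereal (\<integral>\<^sup>+x. ennreal (x\<^sup>2) \<partial>\<pi>)) (at_right 0)"
    using K_limit[OF fin2 v]
    by (rule Lim_transform_eventually) (rule eventually_mono[OF eventually_at_right_less], simp add: k3_pos_K)
  then have "Lim (at_right 0) (k3_pos \<phi> v) =
     ereal (v\<^sup>2 / (2 * d1)) + ereal (- 1 / (2 * d1)) * enn2ereal (\<integral>\<^sup>+x. ennreal (x\<^sup>2) \<partial>\<pi>)"
    by (intro tendsto_Lim) auto
  then have "ereal \<xi> * Lim (at_right 0) (k3_pos \<phi> v) =
     ereal (\<xi> * (v\<^sup>2 / (2 * d1))) + ereal (\<xi> * (- 1 / (2 * d1))) * enn2ereal (\<integral>\<^sup>+x. ennreal (x\<^sup>2) \<partial>\<pi>)"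
    by (simp only:) (rule ereal_affine_scale[OF \<xi>], simp)
  then show ?thesis using limit_mean_aux by simp
qed

end

lemma limit_mean_real:
  assumes fin3: "nmom 3 < \<infinity>"
  shows "(\<lambda>N. \<Sum>n<N. (\<integral>x. x \<partial>law \<xi> n v) - (\<integral>x. x \<partial>\<pi>)) \<longlonglongrightarrow> \<xi> * k1 \<phi> v"
proof -
  have fin2: "nmom 2 < \<infinity>" by (rule fin3_imp_fin2[OF fin3])
  define s where "s = m2\<^sup>2 / (2 * d1\<^sup>2) + m3 / (3 * d1)"
  have s0: "0 \<le> s" using d1_pos by (simp add: s_def m3_def)
  have "enn2ereal (\<integral>\<^sup>+x. ennreal (x\<^sup>2) \<partial>\<pi>) = ereal s"
    using second_moment_pi[OF fin2 fin3] s0 by (simp add: s_def enn2ereal_ennreal)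
  with limit_mean_aux[OF fin2] have lim: "(\<lambda>N. \<Sum>n<N. (\<integral>x. x \<partial>law \<xi> n v) - (\<integral>x. x \<partial>\<pi>)) \<longlonglongrightarrow>
     \<xi> * (v\<^sup>2 / (2 * d1)) + \<xi> * (- 1 / (2 * d1)) * s" by simp
  have m2': "real_of_ereal (deriv0 2 \<phi>) = m2"
    unfolding deriv0_eqs(2) m2_def enn2real_def ..
  have m3': "real_of_ereal (deriv0 3 \<phi>) = - m3"
    unfolding deriv0_eqs(3) m3_def enn2real_def by simp
  have "\<xi> * (v\<^sup>2 / (2 * d1)) + \<xi> * (- 1 / (2 * d1)) * s = \<xi> * k1 \<phi> v"
    unfolding k1_def Let_def d1_eq m2' m3' s_def using d1_pos
    by (simp add: field_simps power2_eq_square power3_eq_cube)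
  with lim show ?thesis by simp
qed

end

end

end

section \<open>Conditioning on the initial workload\<close>

context levy_storage
begin

context
  fixes \<xi> :: real and V0 :: "'a \<Rightarrow> ereal" and S :: "nat \<Rightarrow> 'a \<Rightarrow> real"
  assumes \<xi>: "0 < \<xi>" and epochs: "poisson_epochs M \<xi> S"
    and V0_meas: "V0 \<in> borel_measurable M" and V0_nonneg: "\<And>\<omega>. \<omega> \<in> space M \<Longrightarrow> 0 \<le> V0 \<omega>"
    and indep: "indep_inputs M V0 J S"
    and V0_finite: "measure M {\<omega> \<in> space M. V0 \<omega> < \<infinity>} = 1"
begin

lemma S_0: "\<omega> \<in> space M \<Longrightarrow> S 0 \<omega> = 0"
  and S_nonneg: "\<omega> \<in> space M \<Longrightarrow> 0 \<le> S n \<omega>"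
  and S_indep: "indep_vars (\<lambda>_. borel) (\<lambda>n \<omega>. S (Suc n) \<omega> - S n \<omega>) UNIV"
  and S_exp: "distributed M lborel (\<lambda>\<omega>. S (Suc n) \<omega> - S n \<omega>) (exponential_density \<xi>)"
  using epochs strict_mono_mono[THEN monoD, of "\<lambda>n. S n \<omega>" 0 n] unfolding poisson_epochs_def by auto

lemma distributed_S: "distributed M lborel (S (Suc k)) (erlang_density k \<xi>)"
proof -
  have "distributed M lborel (\<lambda>\<omega>. \<Sum>i\<in>{..<Suc k}. S (Suc i) \<omega> - S i \<omega>) (erlang_density (card {..<Suc k} - 1) \<xi>)"
    by (rule exponential_distributed_sum[OF _ _ \<xi> S_exp]) (auto intro: indep_vars_subset[OF S_indep])
  then have d: "distributed M lborel (\<lambda>\<omega>. S (Suc k) \<omega> - S 0 \<omega>) (erlang_density k \<xi>)"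
  proof -
    have "(\<Sum>i<Suc k. S (Suc i) \<omega> - S i \<omega>) = S (Suc k) \<omega> - S 0 \<omega>" for \<omega>
      by (rule sum_lessThan_telescope)
    then show "distributed M lborel (\<lambda>\<omega>. \<Sum>i\<in>{..<Suc k}. S (Suc i) \<omega> - S i \<omega>) (erlang_density (card {..<Suc k} - 1) \<xi>)
      \<Longrightarrow> ?thesis" by (simp only: card_lessThan diff_Suc_1)
  qed
  have meas: "(\<lambda>\<omega>. S (Suc k) \<omega> - S 0 \<omega>) \<in> measurable M lborel \<longleftrightarrow> S (Suc k) \<in> measurable M lborel"
    by (rule measurable_cong) (simp add: S_0)
  have "distr M lborel (\<lambda>\<omega>. S (Suc k) \<omega> - S 0 \<omega>) = distr M lborel (S (Suc k))"
    by (rule distr_cong) (auto simp: S_0)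
  with d meas show ?thesis unfolding distributed_def by simp
qed

lemma S_meas: "S (Suc k) \<in> borel_measurable M"
  using distributed_measurable[OF distributed_S] by simp

lemma nn_integral_S:
  assumes "h \<in> borel_measurable borel"
  shows "(\<integral>\<^sup>+\<omega>. h (S (Suc k) \<omega>) \<partial>M) = (\<integral>\<^sup>+t. h t \<partial>density lborel (erlang_density k \<xi>))"
proof -
  have "(\<integral>\<^sup>+\<omega>. h (S (Suc k) \<omega>) \<partial>M) = (\<integral>\<^sup>+t. h t \<partial>distr M lborel (S (Suc k)))"
    using assms S_meas by (subst nn_integral_distr) auto
  then show ?thesis by (simp add: distributed_distr_eq_density[OF distributed_S])
qed

definition FV :: "'a measure" where "FV = vimage_algebra (space M) V0 borel"
definition FJ :: "'a measure" where
  "FJ = vimage_algebra (space M) (\<lambda>\<omega>. \<lambda>t\<in>{0..}. J t \<omega>) (Pi\<^sub>M {0..} (\<lambda>_. borel))"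
definition FS :: "'a measure" where "FS = vimage_algebra (space M) (\<lambda>\<omega> n. S n \<omega>) (Pi\<^sub>M UNIV (\<lambda>_. borel))"

lemma spaces [simp]: "space FV = space M" "space FJ = space M" "space FS = space M"
  by (simp_all add: FV_def FJ_def FS_def)

lemma indep_sets_F: "indep_sets (\<lambda>i. sets ([FV, FJ, FS] ! i)) {..<3}"
proof -
  have "indep_sets (\<lambda>i. [sets FV, sets FJ, sets FS] ! i) {..<3}"
    using indep unfolding indep_inputs_def FV_def FJ_def FS_def .
  then show ?thesis
    by (rule indep_sets_cong[THEN iffD1, rotated 2]) (auto simp: less_Suc_eq numeral_3_eq_3)
qed

lemma sets_F: "sets FV \<subseteq> sets M" "sets FJ \<subseteq> sets M" "sets FS \<subseteq> sets M"
proof -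
  have "sets ([FV, FJ, FS] ! i) \<subseteq> events" if "i < 3" for i
    using indep_sets_F that unfolding indep_sets_def by auto
  from this[of 0] this[of 1] this[of 2] show "sets FV \<subseteq> sets M" "sets FJ \<subseteq> sets M" "sets FS \<subseteq> sets M"
    by (simp_all add: numeral_2_eq_2)
qed

text \<open>The identity map, read as a map into the sigma-algebras generated by the three inputs, turns
  their independence into an identity between a joint law and a product measure. The first component
  is doubled only because \<open>indep_var\<close> wants both variables to have the same type.\<close>

lemma joint_law:
  "distr M ((FV \<Otimes>\<^sub>M FV) \<Otimes>\<^sub>M (FS \<Otimes>\<^sub>M FJ)) (\<lambda>\<omega>. ((\<omega>, \<omega>), \<omega>, \<omega>)) =
   distr M (FV \<Otimes>\<^sub>M FV) (\<lambda>\<omega>. (\<omega>, \<omega>)) \<Otimes>\<^sub>M (distr M FS (\<lambda>\<omega>. \<omega>) \<Otimes>\<^sub>M distr M FJ (\<lambda>\<omega>. \<omega>))"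
proof -
  let ?M = "\<lambda>i. [FV, FJ, FS] ! i"
  have sp: "space (?M i) = space M" if "i < 3" for i using that by (auto simp: less_Suc_eq numeral_3_eq_3)
  have sub: "sets (?M i) \<subseteq> sets M" if "i < 3" for i
    using that sets_F by (auto simp: less_Suc_eq numeral_3_eq_3)
  have iv: "indep_vars ?M (\<lambda>i \<omega>. \<omega>) {..<3}"
    unfolding indep_vars_def2
  proof (intro conjI ballI)
    fix i :: nat assume i: "i \<in> {..<3}"
    show "(\<lambda>\<omega>. \<omega>) \<in> measurable M (?M i)"
      using sub[of i] sp[of i] sets.sets_into_space[of _ "?M i"] i
      by (intro measurableI) (auto simp: Int_absorb2 vimage_def)
  next
    have "{(\<lambda>\<omega>. \<omega>) -` A \<inter> space M |A. A \<in> sets (?M i)} = sets (?M i)" if "i \<in> {..<3}" for i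
    proof -
      have "A \<inter> space M = A" if "A \<in> sets (?M i)" for A
        using sets.sets_into_space[OF that] sp[of i] \<open>i \<in> {..<3}\<close> by auto
      then show ?thesis by (auto simp: vimage_def)
    qed
    then show "indep_sets (\<lambda>i. {(\<lambda>\<omega>. \<omega>) -` A \<inter> space M |A. A \<in> sets (?M i)}) {..<3}"
      using indep_sets_F by (rule indep_sets_cong[THEN iffD2, OF refl])
  qed
  have c0: "(\<lambda>d. d 0) \<in> measurable (PiM {0} ?M) FV"
    using measurable_component_singleton[of 0 "{0}" ?M] by simp
  have c1: "(\<lambda>d. d 1) \<in> measurable (PiM K ?M) FJ" if "1 \<in> K" for K
    using measurable_component_singleton[OF that, of ?M] by simp
  have c2: "(\<lambda>d. d 2) \<in> measurable (PiM K ?M) FS" if "2 \<in> K" for K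
    using measurable_component_singleton[OF that, of ?M] by (simp add: numeral_2_eq_2)
  \<comment> \<open>The epochs are placed before the input so that time becomes the outer
    integration, as in \<open>law\<close>.\<close>
  have c21: "(\<lambda>d. (d 2, d 1)) \<in> measurable (PiM {1, 2} ?M) (FS \<Otimes>\<^sub>M FJ)"
    by (intro measurable_Pair c2 c1) auto
  have "indep_var (PiM {0} ?M) (\<lambda>\<omega>. restrict (\<lambda>i. \<omega>) {0}) (PiM {1, 2} ?M) (\<lambda>\<omega>. restrict (\<lambda>i. \<omega>) {1, 2})"
    by (rule indep_var_restrict[OF iv]) auto
  from indep_var_compose[OF this measurable_Pair[OF c0 c0] c21]
  have 1: "indep_var (FV \<Otimes>\<^sub>M FV) (\<lambda>\<omega>. (\<omega>, \<omega>)) (FS \<Otimes>\<^sub>M FJ) (\<lambda>\<omega>. (\<omega>, \<omega>))" by (simp add: comp_def)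
  have "indep_var (PiM {2} ?M) (\<lambda>\<omega>. restrict (\<lambda>i. \<omega>) {2}) (PiM {1} ?M) (\<lambda>\<omega>. restrict (\<lambda>i. \<omega>) {1})"
    by (rule indep_var_restrict[OF iv]) auto
  from indep_var_compose[OF this c2 c1]
  have 2: "indep_var FS (\<lambda>\<omega>. \<omega>) FJ (\<lambda>\<omega>. \<omega>)" by (simp add: comp_def)
  show ?thesis
    using 1 2 unfolding indep_var_distribution_eq by simp
qed

lemma ident_meas: "(\<lambda>\<omega>. \<omega>) \<in> measurable M FV" "(\<lambda>\<omega>. \<omega>) \<in> measurable M FJ" "(\<lambda>\<omega>. \<omega>) \<in> measurable M FS"
  using sets_F sets.sets_into_space[of _ FV] sets.sets_into_space[of _ FJ] sets.sets_into_space[of _ FS]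
  by (auto intro!: measurableI simp: vimage_def Int_absorb2 Int_commute Collect_conj_eq)

lemma J_meas_FJ: "0 \<le> t \<Longrightarrow> J t \<in> borel_measurable FJ"
proof -
  assume t: "0 \<le> t"
  have "(\<lambda>\<omega>. \<lambda>t\<in>{0..}. J t \<omega>) \<in> measurable FJ (Pi\<^sub>M {0..} (\<lambda>_. borel))"
    unfolding FJ_def by (rule measurable_vimage_algebra1) (auto simp: space_PiM)
  from measurable_compose[OF this measurable_component_singleton[of t]] t show ?thesis by simp
qed

lemma S_meas_FS: "S n \<in> borel_measurable FS"
proof -
  have "(\<lambda>\<omega> n. S n \<omega>) \<in> measurable FS (Pi\<^sub>M UNIV (\<lambda>_. borel))"
    unfolding FS_def by (rule measurable_vimage_algebra1) (auto simp: space_PiM)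
  from measurable_compose[OF this measurable_component_singleton[of n]] show ?thesis by simp
qed

lemma V0_meas_FV: "V0 \<in> borel_measurable FV"
  unfolding FV_def by (rule measurable_vimage_algebra1) auto

abbreviation v0 :: "'a \<Rightarrow> real" where "v0 \<omega> \<equiv> real_of_ereal (V0 \<omega>)"

abbreviation V :: "nat \<Rightarrow> 'a \<Rightarrow> real" where
  "V n \<omega> \<equiv> real_of_ereal (workload (net_input J) V0 (S n \<omega>) \<omega>)"

text \<open>\<open>real_of_ereal\<close> sends an infinite workload to 0. Keeping this null case
  explicit makes the identity, and with it nonnegativity and measurability, valid
  everywhere.\<close>

lemma V_eq: "\<omega> \<in> space M \<Longrightarrow> V n \<omega> = (if V0 \<omega> = \<infinity> then 0 else W (v0 \<omega>) (max 0 (S n \<omega>)) \<omega>)"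
  using V0_nonneg[of \<omega>] S_nonneg[of \<omega> n]
  by (cases "V0 \<omega>") (auto simp: workload_def net_input_def W_def simp flip: ereal_max)

lemma V_nonneg: "\<omega> \<in> space M \<Longrightarrow> 0 \<le> V n \<omega>"
  by (auto simp: V_eq intro: W_nonneg)

lemma V_meas: "V (Suc k) \<in> borel_measurable M"
proof -
  have [measurable]: "V0 \<in> borel_measurable M" "S (Suc k) \<in> borel_measurable M" by (rule V0_meas, rule S_meas)
  have "(\<lambda>\<omega>. (v0 \<omega>, S (Suc k) \<omega>, \<omega>)) \<in> measurable M (borel \<Otimes>\<^sub>M (borel \<Otimes>\<^sub>M M))" by measurable
  from measurable_compose[OF this W_meas_M]
  have [measurable]: "(\<lambda>\<omega>. W (v0 \<omega>) (max 0 (S (Suc k) \<omega>)) \<omega>) \<in> borel_measurable M" by simp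
  have "(\<lambda>\<omega>. if V0 \<omega> = \<infinity> then 0 else W (v0 \<omega>) (max 0 (S (Suc k) \<omega>)) \<omega>) \<in> borel_measurable M" by measurable
  then show ?thesis by (rule measurable_cong[THEN iffD1, rotated]) (simp add: V_eq)
qed

lemma AE_V0_finite: "AE \<omega> in M. V0 \<omega> < \<infinity>"
proof -
  have "AE \<omega> in M. \<omega> \<in> {\<omega> \<in> space M. V0 \<omega> < \<infinity>}" by (rule AE_prob_1[OF V0_finite])
  then show ?thesis by eventually_elim simp
qed

lemma law_meas: "f \<in> borel_measurable borel \<Longrightarrow> (\<lambda>v. \<integral>\<^sup>+x. f x \<partial>law \<xi> k v) \<in> borel_measurable borel"
proof -
  assume f: "f \<in> borel_measurable borel"
  interpret E: prob_space "density lborel (erlang_density k \<xi>)" by (rule prob_space_erlang_density[OF \<xi>])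
  have "(\<lambda>p. (fst (fst p), snd (fst p), snd p)) \<in> measurable ((borel \<Otimes>\<^sub>M borel) \<Otimes>\<^sub>M M) (borel \<Otimes>\<^sub>M (borel \<Otimes>\<^sub>M M))"
    by measurable
  from measurable_compose[OF measurable_compose[OF this W_meas_M] f]
  have "(\<lambda>(q, \<omega>). f (W (fst q) (max 0 (snd q)) \<omega>)) \<in> borel_measurable ((borel \<Otimes>\<^sub>M borel) \<Otimes>\<^sub>M M)"
    by (simp add: case_prod_beta')
  then have "(\<lambda>q. \<integral>\<^sup>+\<omega>. f (W (fst q) (max 0 (snd q)) \<omega>) \<partial>M) \<in> borel_measurable (borel \<Otimes>\<^sub>M borel)"
    by (rule borel_measurable_nn_integral)
  then have "(\<lambda>(v, t). \<integral>\<^sup>+\<omega>. f (W v (max 0 t) \<omega>) \<partial>M) \<in> borel_measurable (borel \<Otimes>\<^sub>M density lborel (erlang_density k \<xi>))"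
    using sets_pair_measure_cong[of borel borel borel "density lborel (erlang_density k \<xi>)"]
    by (subst measurable_cong_sets[of _ "borel \<Otimes>\<^sub>M borel"]) (auto simp: case_prod_beta')
  then have "(\<lambda>v. \<integral>\<^sup>+t. (\<integral>\<^sup>+\<omega>. f (W v (max 0 t) \<omega>) \<partial>M) \<partial>density lborel (erlang_density k \<xi>)) \<in> borel_measurable borel"
    by (rule E.borel_measurable_nn_integral)
  then show ?thesis by (simp add: nn_integral_law[OF \<xi> f])
qed

text \<open>By \<open>joint_law\<close> the outcome may be replaced by independent copies for the
  start, the epochs and the input. Tonelli then freezes the start, and integrating out input and
  epoch reproduces \<open>law\<close>. The indicator of \<open>A\<close> depends on the start alone,
  so this is the defining identity of conditional expectation.\<close>

lemma nn_integral_V: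
  assumes f: "f \<in> borel_measurable borel" and A: "A \<in> sets FV"
  shows "(\<integral>\<^sup>+\<omega>\<in>A. f (V (Suc k) \<omega>) \<partial>M) = (\<integral>\<^sup>+\<omega>\<in>A. (\<integral>\<^sup>+x. f x \<partial>law \<xi> k (v0 \<omega>)) \<partial>M)"
proof -
  let ?g = "\<lambda>(x, z, y). f (W (v0 (fst x)) (max 0 (S (Suc k) z)) y) * indicator A (fst x)"
  let ?FV = "FV \<Otimes>\<^sub>M FV" and ?PV = "distr M (FV \<Otimes>\<^sub>M FV) (\<lambda>\<omega>. (\<omega>, \<omega>))"
  have g: "?g \<in> borel_measurable (?FV \<Otimes>\<^sub>M (FS \<Otimes>\<^sub>M FJ))"
  proof -
    have [measurable]: "V0 \<in> borel_measurable FV" "S (Suc k) \<in> borel_measurable FS" "A \<in> sets FV"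
      by (rule V0_meas_FV, rule S_meas_FS, rule A)
    have "(\<lambda>(x, z, y). (v0 (fst x), S (Suc k) z, y)) \<in> measurable (?FV \<Otimes>\<^sub>M (FS \<Otimes>\<^sub>M FJ)) (borel \<Otimes>\<^sub>M (borel \<Otimes>\<^sub>M FJ))"
      by measurable
    from measurable_compose[OF measurable_compose[OF this W_meas_joint[OF _ J_meas_FJ]] f]
    have [measurable]: "(\<lambda>(x, z, y). f (W (v0 (fst x)) (max 0 (S (Suc k) z)) y)) \<in> borel_measurable (?FV \<Otimes>\<^sub>M (FS \<Otimes>\<^sub>M FJ))"
      by (simp add: case_prod_beta')
    have "(\<lambda>p. (\<lambda>(x, z, y). f (W (v0 (fst x)) (max 0 (S (Suc k) z)) y)) p * indicator A (fst (fst p))) \<in> borel_measurable (?FV \<Otimes>\<^sub>M (FS \<Otimes>\<^sub>M FJ))"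
      by measurable
    then show ?thesis by (simp add: case_prod_beta')
  qed
  have dbl: "(\<lambda>\<omega>. (\<omega>, \<omega>)) \<in> measurable M ?FV" by (intro measurable_Pair ident_meas)
  interpret pJ: prob_space "distr M FJ (\<lambda>\<omega>. \<omega>)" by (rule prob_space_distr[OF ident_meas(2)])
  interpret pS: prob_space "distr M FS (\<lambda>\<omega>. \<omega>)" by (rule prob_space_distr[OF ident_meas(3)])
  interpret pSJ: pair_prob_space "distr M FS (\<lambda>\<omega>. \<omega>)" "distr M FJ (\<lambda>\<omega>. \<omega>)" ..
  have trip: "(\<lambda>\<omega>. ((\<omega>, \<omega>), \<omega>, \<omega>)) \<in> measurable M (?FV \<Otimes>\<^sub>M (FS \<Otimes>\<^sub>M FJ))"
    by (intro measurable_Pair ident_meas)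
  have eval: "(\<integral>\<^sup>+z. (\<integral>\<^sup>+y. ?g (x, z, y) \<partial>distr M FJ (\<lambda>\<omega>. \<omega>)) \<partial>distr M FS (\<lambda>\<omega>. \<omega>)) =
      (\<integral>\<^sup>+x. f x \<partial>law \<xi> k (v0 (fst x))) * indicator A (fst x)" for x
  proof -
    define h where "h t = (\<integral>\<^sup>+\<omega>. f (W (v0 (fst x)) (max 0 t) \<omega>) \<partial>M)" for t
    have h: "h \<in> borel_measurable borel"
    proof -
      have "(\<lambda>(t, \<omega>). f (W (v0 (fst x)) (max 0 t) \<omega>)) \<in> borel_measurable (borel \<Otimes>\<^sub>M M)"
        using measurable_compose[OF W_meas_time f] by (simp add: case_prod_beta')
      then show ?thesis unfolding h_def[abs_def] by (rule borel_measurable_nn_integral)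
    qed
    have inner: "(\<integral>\<^sup>+y. ?g (x, z, y) \<partial>distr M FJ (\<lambda>\<omega>. \<omega>)) = h (S (Suc k) z) * indicator A (fst x)" for z
    proof -
      have "W (v0 (fst x)) (max 0 t) \<in> borel_measurable FJ" for t
        unfolding W_def[abs_def]
        by (intro borel_measurable_add borel_measurable_diff borel_measurable_max borel_measurable_const
            J_meas_FJ L_measN[OF _ J_meas_FJ]) auto
      from measurable_compose[OF this f]
      have m: "(\<lambda>y. f (W (v0 (fst x)) (max 0 (S (Suc k) z)) y)) \<in> borel_measurable FJ" .
      then have "(\<integral>\<^sup>+y. ?g (x, z, y) \<partial>distr M FJ (\<lambda>\<omega>. \<omega>)) = (\<integral>\<^sup>+y. f (W (v0 (fst x)) (max 0 (S (Suc k) z)) y) * indicator A (fst x) \<partial>M)"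
        by (subst nn_integral_distr[OF ident_meas(2)]) auto
      also have "\<dots> = h (S (Suc k) z) * indicator A (fst x)"
        unfolding h_def using measurable_compose[OF ident_meas(2) m] by (intro nn_integral_multc) simp
      finally show ?thesis .
    qed
    have "(\<integral>\<^sup>+z. h (S (Suc k) z) * indicator A (fst x) \<partial>distr M FS (\<lambda>\<omega>. \<omega>)) = (\<integral>\<^sup>+z. h (S (Suc k) z) * indicator A (fst x) \<partial>M)"
      using measurable_compose[OF S_meas_FS h] by (subst nn_integral_distr[OF ident_meas(3)]) auto
    also have "\<dots> = (\<integral>\<^sup>+z. h (S (Suc k) z) \<partial>M) * indicator A (fst x)"
      using measurable_compose[OF S_meas h] by (intro nn_integral_multc) simp
    also have "(\<integral>\<^sup>+z. h (S (Suc k) z) \<partial>M) = (\<integral>\<^sup>+x. f x \<partial>law \<xi> k (v0 (fst x)))"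
      using nn_integral_S[OF h, of k] by (simp only: nn_integral_law[OF \<xi> f] h_def)
    finally show ?thesis unfolding inner .
  qed
  \<comment> \<open>On the diagonal, where all copies agree, the integrand is the sampled workload
    outside the null set of infinite starts.\<close>
  have "(\<integral>\<^sup>+\<omega>\<in>A. f (V (Suc k) \<omega>) \<partial>M) = (\<integral>\<^sup>+\<omega>. ?g ((\<omega>, \<omega>), \<omega>, \<omega>) \<partial>M)"
    by (rule nn_integral_cong_AE, use AE_V0_finite AE_space in eventually_elim) (auto simp: V_eq)
  also have "\<dots> = (\<integral>\<^sup>+p. ?g p \<partial>distr M (?FV \<Otimes>\<^sub>M (FS \<Otimes>\<^sub>M FJ)) (\<lambda>\<omega>. ((\<omega>, \<omega>), \<omega>, \<omega>)))"
    by (rule nn_integral_distr[OF trip, symmetric]) (simp add: g)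
  also have "\<dots> = (\<integral>\<^sup>+x. (\<integral>\<^sup>+q. ?g (x, q) \<partial>(distr M FS (\<lambda>\<omega>. \<omega>) \<Otimes>\<^sub>M distr M FJ (\<lambda>\<omega>. \<omega>))) \<partial>?PV)"
    unfolding joint_law
    by (rule pSJ.nn_integral_fst[symmetric]) (use g in \<open>simp cong: measurable_cong_sets sets_pair_measure_cong\<close>)
  also have "\<dots> = (\<integral>\<^sup>+x. (\<integral>\<^sup>+z. (\<integral>\<^sup>+y. ?g (x, z, y) \<partial>distr M FJ (\<lambda>\<omega>. \<omega>)) \<partial>distr M FS (\<lambda>\<omega>. \<omega>)) \<partial>?PV)"
  proof (rule nn_integral_cong)
    fix x assume "x \<in> space (?PV)"
    then have "Pair x \<in> measurable (FS \<Otimes>\<^sub>M FJ) (?FV \<Otimes>\<^sub>M (FS \<Otimes>\<^sub>M FJ))" by simp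
    from measurable_compose[OF this g]
    have "(\<lambda>q. ?g (x, q)) \<in> borel_measurable (distr M FS (\<lambda>\<omega>. \<omega>) \<Otimes>\<^sub>M distr M FJ (\<lambda>\<omega>. \<omega>))"
      by (simp cong: measurable_cong_sets sets_pair_measure_cong)
    then show "(\<integral>\<^sup>+q. ?g (x, q) \<partial>(distr M FS (\<lambda>\<omega>. \<omega>) \<Otimes>\<^sub>M distr M FJ (\<lambda>\<omega>. \<omega>))) =
       (\<integral>\<^sup>+z. (\<integral>\<^sup>+y. ?g (x, z, y) \<partial>distr M FJ (\<lambda>\<omega>. \<omega>)) \<partial>distr M FS (\<lambda>\<omega>. \<omega>))"
      by (rule pJ.nn_integral_fst[symmetric])
  qed
  also have "\<dots> = (\<integral>\<^sup>+x. (\<integral>\<^sup>+u. f u \<partial>law \<xi> k (v0 (fst x))) * indicator A (fst x) \<partial>?PV)"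
    by (simp only: eval)
  also have "\<dots> = (\<integral>\<^sup>+\<omega>\<in>A. (\<integral>\<^sup>+x. f x \<partial>law \<xi> k (v0 \<omega>)) \<partial>M)"
  proof (subst nn_integral_distr[OF dbl])
    have [measurable]: "v0 \<in> borel_measurable FV" using V0_meas_FV by measurable
    have [measurable]: "(\<lambda>x. \<integral>\<^sup>+u. f u \<partial>law \<xi> k (v0 x)) \<in> borel_measurable FV"
      by (rule measurable_compose[OF _ law_meas[OF f]]) measurable
    have [measurable]: "A \<in> sets FV" by (rule A)
    show "(\<lambda>x. (\<integral>\<^sup>+u. f u \<partial>law \<xi> k (v0 (fst x))) * indicator A (fst x)) \<in> borel_measurable ?PV"
      by measurable
  qed simp
  finally show ?thesis .
qed

text \<open>\<open>real_cond_exp\<close> is the difference of the nonnegative conditional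
  expectations of the positive and the negative part. The latter vanishes, so no integrability is
  involved; the mean of \<open>V0\<close> may be infinite.\<close>

lemma cond_exp_V:
  fixes f :: "real \<Rightarrow> real"
  assumes f[measurable]: "f \<in> borel_measurable borel" and nn: "\<And>x. 0 \<le> x \<Longrightarrow> 0 \<le> f x"
  shows "AE \<omega> in M. cond_exp_given M V0 (\<lambda>\<omega>. f (V (Suc k) \<omega>)) \<omega> = (\<integral>x. f x \<partial>law \<xi> k (v0 \<omega>))"
proof -
  have sub: "subalgebra M FV" unfolding subalgebra_def using sets_F by simp
  interpret fin: finite_measure_subalgebra M FV by unfold_locales (rule sub)
  have [measurable]: "V (Suc k) \<in> borel_measurable M" by (rule V_meas)
  have "AE \<omega> in M. (\<integral>\<^sup>+x. ennreal (f x) \<partial>law \<xi> k (v0 \<omega>)) = nn_cond_exp M FV (\<lambda>\<omega>. ennreal (f (V (Suc k) \<omega>))) \<omega>"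
  proof (rule fin.nn_cond_exp_charact)
    show "(\<integral>\<^sup>+\<omega>\<in>A. ennreal (f (V (Suc k) \<omega>)) \<partial>M) = (\<integral>\<^sup>+\<omega>\<in>A. (\<integral>\<^sup>+x. ennreal (f x) \<partial>law \<xi> k (v0 \<omega>)) \<partial>M)"
      if "A \<in> sets FV" for A
      using nn_integral_V[of "\<lambda>x. ennreal (f x)", OF _ that] by simp
    have "v0 \<in> borel_measurable FV" using V0_meas_FV by measurable
    then show "(\<lambda>\<omega>. \<integral>\<^sup>+x. ennreal (f x) \<partial>law \<xi> k (v0 \<omega>)) \<in> borel_measurable FV"
      by (rule measurable_compose[OF _ law_meas]) measurable
  qed measurable
  moreover have "AE \<omega> in M. 0 = nn_cond_exp M FV (\<lambda>\<omega>. ennreal (- f (V (Suc k) \<omega>))) \<omega>"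
  proof (rule fin.nn_cond_exp_charact)
    show "(\<integral>\<^sup>+\<omega>\<in>A. ennreal (- f (V (Suc k) \<omega>)) \<partial>M) = (\<integral>\<^sup>+\<omega>\<in>A. 0 \<partial>M)" for A
      by (rule nn_integral_cong) (simp add: ennreal_neg nn V_nonneg)
  qed measurable
  ultimately show ?thesis
  proof eventually_elim
    case (elim \<omega>)
    have "AE x in law \<xi> k (v0 \<omega>). 0 \<le> f x"
      using AE_law_nonneg[OF \<xi>, of k "v0 \<omega>"] by eventually_elim (rule nn)
    then have "(\<integral>x. f x \<partial>law \<xi> k (v0 \<omega>)) = enn2real (\<integral>\<^sup>+x. ennreal (f x) \<partial>law \<xi> k (v0 \<omega>))"
      by (intro integral_eq_nn_integral) auto
    then show ?case
      using elim unfolding cond_exp_given_def FV_def[symmetric] real_cond_exp_def by simp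
  qed
qed

text \<open>One null set serves all \<open>N\<close>. The shift from n = 1, ..., N to k < N is the
  lag in the index of \<open>law\<close>.\<close>

lemma cond_exp_sum:
  fixes f :: "real \<Rightarrow> real"
  assumes "f \<in> borel_measurable borel" and "\<And>x. 0 \<le> x \<Longrightarrow> 0 \<le> f x"
  shows "AE \<omega> in M. \<forall>N. (\<Sum>n=1..N. cond_exp_given M V0 (\<lambda>\<omega>. f (V n \<omega>)) \<omega> - c) =
     (\<Sum>k<N. (\<integral>x. f x \<partial>law \<xi> k (v0 \<omega>)) - c)"
proof -
  have "AE \<omega> in M. \<forall>k. cond_exp_given M V0 (\<lambda>\<omega>. f (V (Suc k) \<omega>)) \<omega> = (\<integral>x. f x \<partial>law \<xi> k (v0 \<omega>))"
    unfolding AE_all_countable using cond_exp_V[OF assms] by blast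
  then show ?thesis by eventually_elim (simp add: sum.atLeast1_atMost_eq)
qed

end

end

text \<open>Stated outside the storage locales, which contain stability: in the theorem stability
  has to be deduced from \<phi>'(0) > 0, and that deduction already uses this formula.\<close>

lemma laplace_exponent_eq:
  assumes "prob_space M" and sub: "subordinator M \<nu> J" and a: "0 \<le> a"
  shows "laplace_exponent M (net_input J) a = a - levy_measure.eta \<nu> a"
proof -
  interpret prob_space M by fact
  interpret levy_measure \<nu> by unfold_locales (use sub in \<open>auto simp: subordinator_def\<close>)
  have J1: "J 1 \<in> borel_measurable M" and ln: "ln (\<integral>\<omega>. exp (- a * J 1 \<omega>) \<partial>M) = - eta a"
    using sub a unfolding subordinator_def eta_def by auto
  have nn: "0 \<le> J 1 \<omega>" if "\<omega> \<in> space M" for \<omega>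
  proof -
    have "J 0 \<omega> = 0" "mono_on {0..} (\<lambda>t. J t \<omega>)" using sub that unfolding subordinator_def by auto
    then show ?thesis using mono_onD[of "{0..}" "\<lambda>t. J t \<omega>" 0 1] by simp
  qed
  note J = J1 nn
  have int: "integrable M (\<lambda>\<omega>. exp (- a * J 1 \<omega>))"
    using J a by (intro integrable_const_bound[where B = 1]) (auto intro!: AE_I2)
  have pos: "0 < (\<integral>\<omega>. exp (- a * J 1 \<omega>) \<partial>M)"
  proof -
    have "(\<integral>\<omega>. exp (- a * J 1 \<omega>) \<partial>M) \<noteq> 0"
      using AE_False by (subst integral_nonneg_eq_0_iff_AE[OF int]) auto
    moreover have "0 \<le> (\<integral>\<omega>. exp (- a * J 1 \<omega>) \<partial>M)" by simp
    ultimately show ?thesis by linarith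
  qed
  have "(\<integral>\<omega>. exp (- a * net_input J 1 \<omega>) \<partial>M) = (\<integral>\<omega>. exp a * exp (- a * J 1 \<omega>) \<partial>M)"
    by (intro Bochner_Integration.integral_cong refl) (simp add: net_input_def algebra_simps flip: exp_add)
  then have "(\<integral>\<omega>. exp (- a * net_input J 1 \<omega>) \<partial>M) = exp a * (\<integral>\<omega>. exp (- a * J 1 \<omega>) \<partial>M)" by simp
  then show ?thesis
    unfolding laplace_exponent_def using ln_mult_pos[OF exp_gt_zero pos, of a] ln by simp
qed

theorem theorem7:
  fixes M :: "'a measure" and \<nu> \<pi> :: "real measure" and J X :: "real \<Rightarrow> 'a \<Rightarrow> real"
    and V0 :: "'a \<Rightarrow> ereal" and S :: "nat \<Rightarrow> 'a \<Rightarrow> real" and V :: "nat \<Rightarrow> 'a \<Rightarrow> real"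
    and \<phi> :: "real \<Rightarrow> real" and \<xi> :: real
  assumes "prob_space M"
    and "subordinator M \<nu> J"
    and X: "X = net_input J"
    and phi: "\<phi> = laplace_exponent M X"
    and "\<xi> > 0" and "poisson_epochs M \<xi> S"
    and "V0 \<in> borel_measurable M" and "\<And>\<omega>. \<omega> \<in> space M \<Longrightarrow> 0 \<le> V0 \<omega>"
    and "indep_inputs M V0 J S"
    and V: "V = (\<lambda>n \<omega>. real_of_ereal (workload X V0 (S n \<omega>) \<omega>))"
    and "stationary_workload M X \<pi>"
    and "deriv0 1 \<phi> > 0"
    and "measure M {\<omega> \<in> space M. V0 \<omega> < \<infinity>} = 1"
  shows "(\<bar>deriv0 3 \<phi>\<bar> < \<infinity> \<longrightarrow>
      (AE \<omega> in M.
        (\<lambda>N. \<Sum>n=1..N. (cond_exp_given M V0 (V n) \<omega> - (\<integral>x. x \<partial>\<pi>)))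
          \<longlonglongrightarrow> \<xi> * k1 \<phi> (real_of_ereal (V0 \<omega>)))) \<and>
      (\<forall>\<alpha>\<ge>0. AE \<omega> in M.
        (\<lambda>N. ereal (\<Sum>n=1..N. (cond_exp_given M V0 (\<lambda>\<omega>'. exp (- \<alpha> * V n \<omega>')) \<omega>
                            - (\<integral>x. exp (- \<alpha> * x) \<partial>\<pi>))))
          \<longlonglongrightarrow> ereal \<xi> * k2 \<phi> (real_of_ereal (V0 \<omega>)) \<alpha>) \<and>
      (\<forall>\<alpha>\<ge>0. (\<alpha> = 0 \<longrightarrow> deriv0 2 \<phi> < \<infinity>) \<longrightarrow> (AE \<omega> in M.
        (\<lambda>N. ereal (\<Sum>n=1..N. (cond_exp_given M V0 (\<lambda>\<omega>'. V n \<omega>' * exp (- \<alpha> * V n \<omega>')) \<omega>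
                            - (\<integral>x. x * exp (- \<alpha> * x) \<partial>\<pi>))))
          \<longlonglongrightarrow> ereal \<xi> * k3 \<phi> (real_of_ereal (V0 \<omega>)) \<alpha>))"
proof -
  interpret prob_space M by fact
  interpret levy_measure \<nu> by unfold_locales (use assms(2) in \<open>auto simp: subordinator_def\<close>)
  have \<phi>: "\<phi> a = a - eta a" if "0 \<le> a" for a
    unfolding phi X using assms(1,2) that by (rule laplace_exponent_eq)
  have d0: "deriv0 1 \<phi> = 1 - enn2ereal (nmom 1)" "deriv0 2 \<phi> = enn2ereal (nmom 2)"
    "deriv0 3 \<phi> = - enn2ereal (nmom 3)"
    by (rule deriv0_phi; simp add: \<phi>)+
  have "nmom 1 < 1"
  proof -
    have "0 < 1 - enn2ereal (nmom 1)" using assms(12) by (simp only: d0)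
    then have "enn2ereal (nmom 1) < enn2ereal 1" by (cases "nmom 1") (auto simp: one_ereal_def one_ennreal.rep_eq)
    then show ?thesis by (simp only: less_ennreal.rep_eq)
  qed
  then interpret stationary_storage M \<nu> J \<pi>
    using assms(2,11) unfolding X by unfold_locales
  have \<phi>_phi: "\<phi> a = phi a" if "0 \<le> a" for a using \<phi>[OF that] by (simp add: phi_def)
  note cond = cond_exp_sum[OF assms(5,6,7,8,9,13), folded X]
  have v0: "0 \<le> real_of_ereal (V0 \<omega>)" if "\<omega> \<in> space M" for \<omega>
    using assms(8)[OF that] by (rule real_of_ereal_pos)
  have V': "V n \<omega> = real_of_ereal (workload X V0 (S n \<omega>) \<omega>)" for n \<omega> by (simp add: V)
  have 1: "AE \<omega> in M. (\<lambda>N. \<Sum>n=1..N. (cond_exp_given M V0 (V n) \<omega> - (\<integral>x. x \<partial>\<pi>)))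
          \<longlonglongrightarrow> \<xi> * k1 \<phi> (real_of_ereal (V0 \<omega>))"
    if "\<bar>deriv0 3 \<phi>\<bar> < \<infinity>"
  proof -
    have fin3: "nmom 3 < \<infinity>" using that unfolding d0 by (cases "nmom 3") auto
    have "AE \<omega> in M. \<forall>N. (\<Sum>n=1..N. cond_exp_given M V0 (\<lambda>\<omega>. V n \<omega>) \<omega> - (\<integral>x. x \<partial>\<pi>)) =
      (\<Sum>k<N. (\<integral>x. x \<partial>law \<xi> k (real_of_ereal (V0 \<omega>))) - (\<integral>x. x \<partial>\<pi>))"
      unfolding V' by (rule cond) auto
    then show ?thesis
      using AE_space
    proof eventually_elim
      case (elim \<omega>)
      then show ?case
        using limit_mean_real[OF assms(5) v0[OF elim(2)] \<phi>_phi fin3] by simp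
    qed
  qed
  have 2: "AE \<omega> in M.
        (\<lambda>N. ereal (\<Sum>n=1..N. (cond_exp_given M V0 (\<lambda>\<omega>'. exp (- \<alpha> * V n \<omega>')) \<omega>
                            - (\<integral>x. exp (- \<alpha> * x) \<partial>\<pi>))))
          \<longlonglongrightarrow> ereal \<xi> * k2 \<phi> (real_of_ereal (V0 \<omega>)) \<alpha>" if \<alpha>: "\<alpha> \<ge> 0" for \<alpha>
  proof -
    have "AE \<omega> in M. \<forall>N. (\<Sum>n=1..N. cond_exp_given M V0 (\<lambda>\<omega>'. exp (- \<alpha> * V n \<omega>')) \<omega> - (\<integral>x. exp (- \<alpha> * x) \<partial>\<pi>)) =
      (\<Sum>k<N. (\<integral>x. exp (- \<alpha> * x) \<partial>law \<xi> k (real_of_ereal (V0 \<omega>))) - (\<integral>x. exp (- \<alpha> * x) \<partial>\<pi>))"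
      unfolding V' by (rule cond) auto
    then show ?thesis
      using AE_space
    proof eventually_elim
      case (elim \<omega>)
      show ?case
      proof (cases "\<alpha> = 0")
        case True
        \<comment> \<open>At rate 0 every summand is 1 - 1, in agreement with the value 0 of
          \<open>k2\<close> there.\<close>
        interpret l: prob_space "law \<xi> k (real_of_ereal (V0 \<omega>))" for k by (rule prob_space_law[OF assms(5)])
        show ?thesis
          unfolding elim(1)[rule_format] using True l.prob_space pi.prob_space by (simp add: k2_def zero_ereal_def)
      next
        case False
        then show ?thesis
          using elim limit_exp[OF assms(5) v0[OF elim(2)] \<phi>_phi, of \<alpha>] \<alpha> by simp
      qed
    qed
  qed
  have 3: "AE \<omega> in M.
        (\<lambda>N. ereal (\<Sum>n=1..N. (cond_exp_given M V0 (\<lambda>\<omega>'. V n \<omega>' * exp (- \<alpha> * V n \<omega>')) \<omega>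
                            - (\<integral>x. x * exp (- \<alpha> * x) \<partial>\<pi>))))
          \<longlonglongrightarrow> ereal \<xi> * k3 \<phi> (real_of_ereal (V0 \<omega>)) \<alpha>"
    if \<alpha>: "\<alpha> \<ge> 0" "\<alpha> = 0 \<longrightarrow> deriv0 2 \<phi> < \<infinity>" for \<alpha>
  proof -
    have "AE \<omega> in M. \<forall>N. (\<Sum>n=1..N. cond_exp_given M V0 (\<lambda>\<omega>'. V n \<omega>' * exp (- \<alpha> * V n \<omega>')) \<omega>
        - (\<integral>x. x * exp (- \<alpha> * x) \<partial>\<pi>)) =
      (\<Sum>k<N. (\<integral>x. x * exp (- \<alpha> * x) \<partial>law \<xi> k (real_of_ereal (V0 \<omega>))) - (\<integral>x. x * exp (- \<alpha> * x) \<partial>\<pi>))"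
      unfolding V' by (rule cond) auto
    then show ?thesis
      using AE_space
    proof eventually_elim
      case (elim \<omega>)
      show ?case
      proof (cases "\<alpha> = 0")
        case True
        \<comment> \<open>A finite second derivative at 0 makes the stationary mean finite, so that
          the integral over \<pi> is really E V and not the default value 0 of a divergent
          integral.\<close>
        then have "nmom 2 < \<infinity>" using \<alpha>(2) unfolding d0 by (cases "nmom 2") auto
        from limit_mean[OF assms(5) v0[OF elim(2)] \<phi>_phi this]
        show ?thesis using elim True by (simp add: k3_def)
      next
        case False
        then show ?thesis
          using elim limit_xexp[OF assms(5) v0[OF elim(2)] \<phi>_phi, of \<alpha>] \<alpha> by (simp add: k3_def)
      qed
    qed
  qed
  show ?thesis using 1 2 3 by blast
qed

end
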